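(* Let $V$ be a fixed set of $n$ vertices, each $v\in V$ having a cost $c_v>0$ and a capacity $k_v\in\mathbb{Z}_{>0}$. Consider the fully dynamic setting in which the edge set of the graph $G=(V,E)$ starts empty and is modified by an arbitrary sequence of single-edge insertions and single-edge deletions. For every $0<\epsilon<1$ there is a deterministic dynamic algorithm (a dynamic level scheme) that maintains, after every update, a feasible capacitated vertex cover of the current graph whose cost is within a constant factor (approximately $36$) of the minimum cost of a capacitated vertex cover of the current graph, with $O(\log n/\epsilon)$ amortized update time.
   Context: A (soft) capacitated vertex cover of $G=(V,E)$ consists of a number of copies $x_v\in\mathbb{N}$ for each vertex $v$ (unbounded) together with an assignment of every edge $e=\{u,v\}\in E$ to one of its endpoints, such that for every vertex $v$ the number of edges assigned to $v$ is at most $k_v x_v$. Its cost is $\sum_{v} c_v x_v$. The weighted minimum capacitated vertex cover problem asks for one of minimum cost. *)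

theory Defs
  imports Complex_Main
begin

section \<open>Capacitated vertex covers with soft capacities\<close>

text \<open>
  The vertex set is \<open>{..<n}\<close>; an edge is a two-element set of vertices.
  A cover is a pair of multiplicities \<open>x\<close> and an assignment \<open>a\<close> of edges to endpoints.
\<close>

definition edges_on :: "nat \<Rightarrow> nat set set" where
  "edges_on n = {{u, v} | u v. u < n \<and> v < n \<and> u \<noteq> v}"

definition cap_vertex_cover ::
  "nat \<Rightarrow> (nat \<Rightarrow> nat) \<Rightarrow> nat set set \<Rightarrow> (nat \<Rightarrow> nat) \<Rightarrow> (nat set \<Rightarrow> nat) \<Rightarrow> bool" where
  "cap_vertex_cover n k E x a \<longleftrightarrow>
     (\<forall>e\<in>E. a e \<in> e) \<and> (\<forall>v<n. card {e \<in> E. a e = v} \<le> k v * x v)"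

definition cover_cost :: "nat \<Rightarrow> (nat \<Rightarrow> real) \<Rightarrow> (nat \<Rightarrow> nat) \<Rightarrow> real" where
  "cover_cost n c x = (\<Sum>v<n. c v * real (x v))"

definition min_cover_cost :: "nat \<Rightarrow> (nat \<Rightarrow> real) \<Rightarrow> (nat \<Rightarrow> nat) \<Rightarrow> nat set set \<Rightarrow> real" where
  "min_cover_cost n c k E = Inf {cover_cost n c x | x a. cap_vertex_cover n k E x a}"

lemma cap_vertex_cover_exists:
  assumes "E \<subseteq> edges_on n" "\<And>v. v < n \<Longrightarrow> k v > 0"
  shows "\<exists>x a. cap_vertex_cover n k E x a"
proof -
  have "cap_vertex_cover n k E (\<lambda>_. card E) (\<lambda>e. SOME v. v \<in> e)"
    unfolding cap_vertex_cover_def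
  proof (intro conjI ballI allI impI)
    fix e assume "e \<in> E"
    with assms(1) have "\<exists>v. v \<in> e" by (auto simp: edges_on_def)
    then show "(SOME v. v \<in> e) \<in> e" by (rule someI_ex)
  next
    fix v assume "v < n"
    have "edges_on n \<subseteq> Pow {..<n}" by (auto simp: edges_on_def)
    with assms(1) have "finite E" by (meson finite_Pow_iff finite_lessThan finite_subset subset_trans)
    then have "card {e \<in> E. (SOME v. v \<in> e) = v} \<le> card E" by (intro card_mono) auto
    also have "\<dots> \<le> k v * card E" using assms(2)[OF \<open>v < n\<close>] by simp
    finally show "card {e \<in> E. (SOME v. v \<in> e) = v} \<le> k v * card E" .
  qed
  then show ?thesis by blast
qed

text \<open>The infimum is attained.\<close>

lemma min_cover_cost_attained:
  assumes E: "E \<subseteq> edges_on n" and k: "\<And>v. v < n \<Longrightarrow> k v > 0" and c: "\<And>v. v < n \<Longrightarrow> c v > 0"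
  shows "\<exists>x a. cap_vertex_cover n k E x a \<and> cover_cost n c x = min_cover_cost n c k E"
proof -
  define S where "S = {cover_cost n c x | x a. cap_vertex_cover n k E x a}"
  obtain x0 a0 where x0: "cap_vertex_cover n k E x0 a0"
    using cap_vertex_cover_exists[of E n k] E k by blast
  define b where "b = cover_cost n c x0"
  define m where "m v = nat \<lfloor>b / c v\<rfloor>" for v
  define F where "F = {f. \<forall>v. if v < n then f v \<le> m v else f v = 0}"
  have sub: "S \<inter> {..b} \<subseteq> cover_cost n c ` F"
  proof
    fix r assume r: "r \<in> S \<inter> {..b}"
    then obtain x a where x: "r = cover_cost n c x" "cap_vertex_cover n k E x a"
      by (auto simp: S_def)
    have "x v \<le> m v" if "v < n" for v
    proof -
      have "c v * real (x v) \<le> (\<Sum>v<n. c v * real (x v))"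
        using that by (intro member_le_sum) (auto intro!: mult_nonneg_nonneg less_imp_le[OF c])
      with r x have "c v * real (x v) \<le> b" by (simp add: cover_cost_def)
      with c[OF that] have "real (x v) \<le> b / c v" by (simp add: field_simps)
      then show ?thesis by (simp add: m_def le_nat_floor)
    qed
    then have "(\<lambda>v. if v < n then x v else 0) \<in> F"
      by (simp add: F_def)
    moreover have "r = cover_cost n c (\<lambda>v. if v < n then x v else 0)"
      by (simp add: x cover_cost_def)
    ultimately show "r \<in> cover_cost n c ` F" by blast
  qed
  have "F \<subseteq> {f. \<forall>v. (v \<in> {..<n} \<longrightarrow> f v \<in> (\<Union>u<n. {..m u})) \<and> (v \<notin> {..<n} \<longrightarrow> f v = 0)}"
    by (auto simp: F_def split: if_splits)
  then have "finite F"
    by (rule finite_subset) (intro finite_set_of_finite_funs, auto)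
  then have fin: "finite (S \<inter> {..b})"
    using sub by (meson finite_imageI finite_subset)
  have bS: "b \<in> S \<inter> {..b}" using x0 by (auto simp: S_def b_def)
  define r where "r = Min (S \<inter> {..b})"
  have r: "r \<in> S \<inter> {..b}" using fin bS unfolding r_def by (intro Min_in) auto
  have "r \<le> y" if "y \<in> S" for y
  proof (cases "y \<le> b")
    case True
    with that fin show ?thesis unfolding r_def by (intro Min_le) auto
  qed (use r in auto)
  then have "Inf S = r" using r by (intro cInf_eq_minimum) auto
  with r show ?thesis by (auto simp: S_def min_cover_cost_def)
qed



section \<open>Update sequences\<close>

datatype update = Insert nat nat | Delete nat nat

fun valid_update :: "nat \<Rightarrow> nat set set \<Rightarrow> update \<Rightarrow> bool" where
  "valid_update n E (Insert u v) \<longleftrightarrow> {u, v} \<in> edges_on n \<and> {u, v} \<notin> E"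
| "valid_update n E (Delete u v) \<longleftrightarrow> {u, v} \<in> E"

fun apply_update :: "update \<Rightarrow> nat set set \<Rightarrow> nat set set" where
  "apply_update (Insert u v) E = E \<union> {{u, v}}"
| "apply_update (Delete u v) E = E - {{u, v}}"

fun valid_updates :: "nat \<Rightarrow> nat set set \<Rightarrow> update list \<Rightarrow> bool" where
  "valid_updates n E [] \<longleftrightarrow> True"
| "valid_updates n E (q # qs) \<longleftrightarrow> valid_update n E q \<and> valid_updates n (apply_update q E) qs"

definition graph_after :: "update list \<Rightarrow> nat set set" where
  "graph_after qs = fold apply_update qs {}"


section \<open>Machine model\<close>

text \<open>
  A word RAM with additional exact real arithmetic (needed since the costs are real numbers),
  presented as a while language. Memory consists of numbered arrays of \<open>w\<close>-bit words and of
  numbered arrays of reals; a program mentions only finitely many arrays, each indexed by words.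
  Word arithmetic is modulo \<open>2 ^ w\<close>. Reals can be compared, but there is no operation
  (rounding or other) turning a real into a word, and the only literals are natural numbers.
  Every operation takes unit time. The word length is a parameter: an algorithm has to work for
  every \<open>w\<close> that is at least a constant multiple of \<open>log\<^sub>2 (n + 1)\<close>, i.e. \<open>(n + 1) ^ d \<le> 2 ^ w\<close>,
  and for which the capacities fit into words.
\<close>

record memory =
  words :: "nat \<Rightarrow> nat \<Rightarrow> nat"
  reals :: "nat \<Rightarrow> nat \<Rightarrow> real"

datatype wexp =
    WLit nat | WGet nat wexp
  | WAdd wexp wexp | WSub wexp wexp | WMul wexp wexp | WDiv wexp wexp | WMod wexp wexp

datatype rexp =
    RWord wexp | RGet nat wexp
  | RAdd rexp rexp | RSub rexp rexp | RMul rexp rexp | RDiv rexp rexp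

datatype bexp =
    WLess wexp wexp | WEq wexp wexp | RLess rexp rexp | REq rexp rexp
  | BNot bexp | BAnd bexp bexp

datatype com =
    Skip
  | WSet nat wexp wexp
  | RSet nat wexp rexp
  | Seq com com
  | Cond bexp com com
  | While bexp com

fun wval :: "nat \<Rightarrow> memory \<Rightarrow> wexp \<Rightarrow> nat" where
  "wval w s (WLit m) = m mod 2 ^ w"
| "wval w s (WGet i e) = words s i (wval w s e)"
| "wval w s (WAdd e f) = (wval w s e + wval w s f) mod 2 ^ w"
| "wval w s (WSub e f) = nat ((int (wval w s e) - int (wval w s f)) mod 2 ^ w)"
| "wval w s (WMul e f) = (wval w s e * wval w s f) mod 2 ^ w"
| "wval w s (WDiv e f) = wval w s e div wval w s f"
| "wval w s (WMod e f) = wval w s e mod wval w s f"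

fun rval :: "nat \<Rightarrow> memory \<Rightarrow> rexp \<Rightarrow> real" where
  "rval w s (RWord e) = real (wval w s e)"
| "rval w s (RGet i e) = reals s i (wval w s e)"
| "rval w s (RAdd e f) = rval w s e + rval w s f"
| "rval w s (RSub e f) = rval w s e - rval w s f"
| "rval w s (RMul e f) = rval w s e * rval w s f"
| "rval w s (RDiv e f) = rval w s e / rval w s f"

fun bval :: "nat \<Rightarrow> memory \<Rightarrow> bexp \<Rightarrow> bool" where
  "bval w s (WLess e f) \<longleftrightarrow> wval w s e < wval w s f"
| "bval w s (WEq e f) \<longleftrightarrow> wval w s e = wval w s f"
| "bval w s (RLess e f) \<longleftrightarrow> rval w s e < rval w s f"
| "bval w s (REq e f) \<longleftrightarrow> rval w s e = rval w s f"
| "bval w s (BNot b) \<longleftrightarrow> \<not> bval w s b"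
| "bval w s (BAnd b d) \<longleftrightarrow> bval w s b \<and> bval w s d"

fun wtime :: "wexp \<Rightarrow> nat" where
  "wtime (WLit m) = 1"
| "wtime (WGet i e) = 1 + wtime e"
| "wtime (WAdd e f) = 1 + wtime e + wtime f"
| "wtime (WSub e f) = 1 + wtime e + wtime f"
| "wtime (WMul e f) = 1 + wtime e + wtime f"
| "wtime (WDiv e f) = 1 + wtime e + wtime f"
| "wtime (WMod e f) = 1 + wtime e + wtime f"

fun rtime :: "rexp \<Rightarrow> nat" where
  "rtime (RWord e) = 1 + wtime e"
| "rtime (RGet i e) = 1 + wtime e"
| "rtime (RAdd e f) = 1 + rtime e + rtime f"
| "rtime (RSub e f) = 1 + rtime e + rtime f"
| "rtime (RMul e f) = 1 + rtime e + rtime f"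
| "rtime (RDiv e f) = 1 + rtime e + rtime f"

fun btime :: "bexp \<Rightarrow> nat" where
  "btime (WLess e f) = 1 + wtime e + wtime f"
| "btime (WEq e f) = 1 + wtime e + wtime f"
| "btime (RLess e f) = 1 + rtime e + rtime f"
| "btime (REq e f) = 1 + rtime e + rtime f"
| "btime (BNot b) = 1 + btime b"
| "btime (BAnd b d) = 1 + btime b + btime d"

definition set_word :: "nat \<Rightarrow> nat \<Rightarrow> nat \<Rightarrow> memory \<Rightarrow> memory" where
  "set_word i j m s = s\<lparr>words := (words s)(i := (words s i)(j := m))\<rparr>"

definition set_real :: "nat \<Rightarrow> nat \<Rightarrow> real \<Rightarrow> memory \<Rightarrow> memory" where
  "set_real i j r s = s\<lparr>reals := (reals s)(i := (reals s i)(j := r))\<rparr>"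

text \<open>
  \<open>exec w p s t s'\<close>: with word length \<open>w\<close>, program \<open>p\<close> started in memory \<open>s\<close>
  halts after \<open>t\<close> steps in memory \<open>s'\<close>.
\<close>

inductive exec :: "nat \<Rightarrow> com \<Rightarrow> memory \<Rightarrow> nat \<Rightarrow> memory \<Rightarrow> bool" for w :: nat where
  Skip: "exec w Skip s 1 s"
| WSet: "exec w (WSet i e f) s (1 + wtime e + wtime f)
           (set_word i (wval w s e) (wval w s f) s)"
| RSet: "exec w (RSet i e f) s (1 + wtime e + rtime f)
           (set_real i (wval w s e) (rval w s f) s)"
| Seq: "exec w p s t s' \<Longrightarrow> exec w q s' t' s'' \<Longrightarrow> exec w (Seq p q) s (t + t') s''"
| CondTrue: "bval w s b \<Longrightarrow> exec w p s t s' \<Longrightarrow> exec w (Cond b p q) s (1 + btime b + t) s'"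
| CondFalse: "\<not> bval w s b \<Longrightarrow> exec w q s t s' \<Longrightarrow> exec w (Cond b p q) s (1 + btime b + t) s'"
| WhileFalse: "\<not> bval w s b \<Longrightarrow> exec w (While b p) s (1 + btime b) s"
| WhileTrue: "bval w s b \<Longrightarrow> exec w p s t s' \<Longrightarrow> exec w (While b p) s' t' s'' \<Longrightarrow>
    exec w (While b p) s (1 + btime b + t + t') s''"

lemma exec_deterministic:
  "exec w p s t s' \<Longrightarrow> exec w p s u s'' \<Longrightarrow> u = t \<and> s'' = s'"
proof (induction arbitrary: u s'' rule: exec.induct)
  case (Seq p s t s' q t' s2)
  note IH = Seq.IH
  from Seq.prems show ?case
  proof cases
    case (Seq t1 r t2)
    from IH(1)[OF Seq(2)] have r: "t1 = t" "r = s'" by blast+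
    from IH(2)[OF Seq(3)[unfolded r]] Seq(1) r show ?thesis by simp
  qed
next
  case (CondTrue s b p t s' q)
  note IH = CondTrue.IH and b = CondTrue.hyps(1)
  from CondTrue.prems show ?case
  proof cases
    case (CondTrue t1)
    from IH[OF CondTrue(3)] CondTrue(1) show ?thesis by simp
  next
    case CondFalse
    with b show ?thesis by blast
  qed
next
  case (CondFalse s b q t s' p)
  note IH = CondFalse.IH and b = CondFalse.hyps(1)
  from CondFalse.prems show ?case
  proof cases
    case (CondFalse t1)
    from IH[OF CondFalse(3)] CondFalse(1) show ?thesis by simp
  next
    case CondTrue
    with b show ?thesis by blast
  qed
next
  case (WhileFalse s b p)
  from WhileFalse.prems show ?case
    by cases (use WhileFalse.hyps in simp_all)
next
  case (WhileTrue s b p t s' t' s2)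
  note IH = WhileTrue.IH and b = WhileTrue.hyps(1)
  from WhileTrue.prems show ?case
  proof cases
    case WhileFalse
    with b show ?thesis by blast
  next
    case (WhileTrue t1 r t2)
    from IH(1)[OF WhileTrue(3)] have r: "t1 = t" "r = s'" by blast+
    from IH(2)[OF WhileTrue(4)[unfolded r]] WhileTrue(1) r show ?thesis by simp
  qed
next
  case (Skip s)
  then show ?case by cases simp
next
  case (WSet i e f s)
  then show ?case by cases simp
next
  case (RSet i e f s)
  then show ?case by cases simp
qed


section \<open>Dynamic algorithms\<close>

text \<open>
  A dynamic algorithm consists of fixed programs for preprocessing the vertices, for edge
  insertion and for edge deletion. Interface: word array 0 holds the number of vertices (at
  index 0), word array 1 the capacities, and real array 0 the costs; all other memory is
  initially zero. The endpoints of the edge of the current update are passed in word array 2.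
  The solution must be stored explicitly: \<open>x\<^sub>v\<close> at index \<open>v\<close> of word array 3, and the
  vertex to which an edge \<open>e\<close> is assigned at index \<open>Min e * n + Max e\<close> of word array 4.
\<close>

record dyn_alg =
  preprocess :: com
  insertion :: com
  deletion :: com

definition input_memory :: "nat \<Rightarrow> (nat \<Rightarrow> real) \<Rightarrow> (nat \<Rightarrow> nat) \<Rightarrow> memory" where
  "input_memory n c k =
     \<lparr>words = (\<lambda>i j. if i = 0 \<and> j = 0 then n else if i = 1 \<and> j < n then k j else 0),
      reals = (\<lambda>i j. if i = 0 \<and> j < n then c j else 0)\<rparr>"

definition pass_edge :: "nat \<Rightarrow> nat \<Rightarrow> memory \<Rightarrow> memory" where
  "pass_edge u v s = set_word 2 1 v (set_word 2 0 u s)"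

definition output_copies :: "memory \<Rightarrow> nat \<Rightarrow> nat" where
  "output_copies s v = words s 3 v"

definition output_assignment :: "nat \<Rightarrow> memory \<Rightarrow> nat set \<Rightarrow> nat" where
  "output_assignment n s e = words s 4 (Min e * n + Max e)"

fun process_update :: "nat \<Rightarrow> dyn_alg \<Rightarrow> update \<Rightarrow> memory \<Rightarrow> nat \<Rightarrow> memory \<Rightarrow> bool" where
  "process_update w A (Insert u v) s t s' \<longleftrightarrow> exec w (insertion A) (pass_edge u v s) t s'"
| "process_update w A (Delete u v) s t s' \<longleftrightarrow> exec w (deletion A) (pass_edge u v s) t s'"

text \<open>The time in \<open>process_updates\<close> is the total over the whole sequence.\<close>

inductive process_updates ::
  "nat \<Rightarrow> dyn_alg \<Rightarrow> update list \<Rightarrow> memory \<Rightarrow> nat \<Rightarrow> memory \<Rightarrow> bool"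
  for w :: nat and A :: dyn_alg where
  Nil: "process_updates w A [] s 0 s"
| Cons: "process_update w A q s t s' \<Longrightarrow> process_updates w A qs s' t' s'' \<Longrightarrow>
    process_updates w A (q # qs) s (t + t') s''"

text \<open>
  The solution held in memory \<open>s\<close> is a feasible capacitated vertex cover of \<open>({..<n}, E)\<close>
  whose cost is at most \<open>\<rho>\<close> times the minimum.
\<close>

definition holds_approx_cover ::
  "real \<Rightarrow> nat \<Rightarrow> (nat \<Rightarrow> real) \<Rightarrow> (nat \<Rightarrow> nat) \<Rightarrow> nat set set \<Rightarrow> memory \<Rightarrow> bool" where
  "holds_approx_cover \<rho> n c k E s \<longleftrightarrow>
     cap_vertex_cover n k E (output_copies s) (output_assignment n s) \<and>
     cover_cost n c (output_copies s) \<le> \<rho> * min_cover_cost n c k E"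

text \<open>
  Running \<open>A\<close> on one instance with word length \<open>w\<close>: preprocessing halts within time \<open>P\<close>, and
  every valid update sequence \<open>qs\<close>, starting from the empty graph, is processed in total time at
  most \<open>T * length qs\<close>, after which memory holds a \<open>\<rho>\<close>-approximate cover of the current graph.
  Since \<open>qs\<close> ranges over all sequences, hence over all prefixes, and execution is deterministic,
  this covers the situation after every single update.
\<close>

definition maintains_cover ::
  "nat \<Rightarrow> dyn_alg \<Rightarrow> real \<Rightarrow> real \<Rightarrow> real \<Rightarrow> nat \<Rightarrow> (nat \<Rightarrow> real) \<Rightarrow> (nat \<Rightarrow> nat) \<Rightarrow> bool" where
  "maintains_cover w A \<rho> P T n c k \<longleftrightarrow>
     (\<exists>t\<^sub>0 s\<^sub>0. exec w (preprocess A) (input_memory n c k) t\<^sub>0 s\<^sub>0 \<and> real t\<^sub>0 \<le> P \<and>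
        (\<forall>qs. valid_updates n {} qs \<longrightarrow>
           (\<exists>t s. process_updates w A qs s\<^sub>0 t s \<and>
              real t \<le> T * real (length qs) \<and>
              holds_approx_cover \<rho> n c k (graph_after qs) s)))"

end

theory Submission
  imports Defs
begin

text \<open>
  A level scheme whose levels are relative to the cost of each vertex. An edge \<open>{x, y}\<close> has a level
  \<open>b x y\<close> in the scale of \<open>x\<close> and a level \<open>b y x\<close> in the scale of \<open>y\<close>. For \<open>c x \<le> c y\<close> the difference
  \<open>b y x - b x y\<close> is always the rounded down binary logarithm of \<open>c y / c x\<close>, so the two prices
  \<open>c x / 2 ^ b x y\<close> and \<open>c y / 2 ^ b y x\<close> agree up to a factor 2; their minimum \<open>\<pi>\<close> is the dual variable
  of the edge. A vertex \<open>x\<close> is on a level \<open>lev x\<close>, at most \<open>b x y\<close> for all its edges, and an edge is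
  assigned to an endpoint where equality holds. The load of \<open>x\<close> is the sum of all \<open>2 powr - b x y\<close>.
  A vertex is raised when its load exceeds 2, unless \<open>2 ^ lev x\<close> has come within a factor 2 of \<open>k x\<close>:
  then even \<open>k x\<close> edges together have price at most \<open>2 * c x\<close>, so that the dual constraint of \<open>x\<close>
  cannot be violated by more than a constant. It is lowered when its load is below 1/4.

  Hence the sum of all \<open>\<pi>\<close> is at most 5/2 times the optimum. Opening the vertices that own an edge
  costs at most 4 times their loads, i.e. \<open>12 * \<pi>\<close> per edge, and the share \<open>c x / k x\<close> that an edge
  has in a copy of its owner \<open>x\<close> is at most \<open>c x / 2 ^ lev x \<le> 2 * \<pi>\<close>; so the ratio is at most 35.

  Relative levels never exceed \<open>log n + 1\<close>, whatever the costs are. Raising is paid by the edges, which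
  climb one level each; lowering is paid by the load that the vertex has lost since it was last raised.
  The ratio being a constant, nothing has to be tuned to \<open>\<epsilon>\<close>: an update time of \<open>O(log n)\<close> suffices.
\<close>

section \<open>Running programs\<close>

text \<open>The difficulty is that the two repairs undo each other's payment: raising takes load
  from neighbours, which may then become light, and lowering moves edges down, which lets them climb
  again. A potential breaks the cycle by its weights. Moving an edge up releases its two levels and
  must pay for one unit of missing load at the neighbour, for putting that neighbour on the stack,
  and for the round; with weight \<open>a\<close> per level and \<open>d\<close> per unit this needs
  \<open>2 * a \<ge> d + 2\<close>. Lowering a vertex halves its missing load, and this must pay
  \<open>2 * a + 2\<close> for each edge moved down and 2 for the vertex. With the thresholds 2 and
  1/4, solving both conditions with equality in the worst case gives \<open>d = 16\<close> and
  \<open>a = 9\<close>. The second difficulty is that costs are real and cannot be rounded to words.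
  The logarithm of a cost ratio is therefore found by doubling, once per edge at its insertion, and
  cut off at \<open>L + 1\<close>; from then on both levels of the edge move together. Level
  \<open>L\<close> is high enough because \<open>n\<close> edges there have load at most 1.\<close>

fun loopfree :: "com \<Rightarrow> bool" where
  "loopfree (Seq p q) \<longleftrightarrow> loopfree p \<and> loopfree q"
| "loopfree (Cond b p q) \<longleftrightarrow> loopfree p \<and> loopfree q"
| "loopfree (While b p) \<longleftrightarrow> False"
| "loopfree _ \<longleftrightarrow> True"

text \<open>A total function, so that the simplifier can run straight-line blocks symbolically; the
  clause for \<open>While\<close> is a dummy value, excluded wherever \<open>loopfree\<close> is
  assumed.\<close>

fun sem :: "nat \<Rightarrow> com \<Rightarrow> memory \<Rightarrow> memory" where
  "sem w Skip s = s"
| "sem w (WSet i e f) s = set_word i (wval w s e) (wval w s f) s"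
| "sem w (RSet i e f) s = set_real i (wval w s e) (rval w s f) s"
| "sem w (Seq p q) s = sem w q (sem w p s)"
| "sem w (Cond b p q) s = (if bval w s b then sem w p s else sem w q s)"
| "sem w (While b p) s = s"

fun max_time :: "com \<Rightarrow> nat" where
  "max_time Skip = 1"
| "max_time (WSet i e f) = 1 + wtime e + wtime f"
| "max_time (RSet i e f) = 1 + wtime e + rtime f"
| "max_time (Seq p q) = max_time p + max_time q"
| "max_time (Cond b p q) = 1 + btime b + max (max_time p) (max_time q)"
| "max_time (While b p) = 0"

lemma exec_sem:
  "loopfree p \<Longrightarrow> \<exists>t\<le>max_time p. exec w p s t (sem w p s)"
proof (induction p arbitrary: s)
  case (Seq p q)
  from Seq obtain t where t: "t \<le> max_time p" "exec w p s t (sem w p s)" by fastforce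
  from Seq obtain t' where t': "t' \<le> max_time q" "exec w q (sem w p s) t' (sem w q (sem w p s))"
    by fastforce
  have "exec w (Seq p q) s (t + t') (sem w (Seq p q) s)"
    using exec.Seq[OF t(2) t'(2)] by simp
  then show ?case using t(1) t'(1) by (intro exI[of _ "t + t'"]) simp
next
  case (Cond b p q)
  from Cond obtain t where t: "t \<le> max_time p" "exec w p s t (sem w p s)" by fastforce
  from Cond obtain t' where t': "t' \<le> max_time q" "exec w q s t' (sem w q s)" by fastforce
  show ?case
  proof (cases "bval w s b")
    case True
    have "exec w (Cond b p q) s (1 + btime b + t) (sem w (Cond b p q) s)"
      using exec.CondTrue[OF True t(2)] True by simp
    then show ?thesis using t(1) by (intro exI[of _ "1 + btime b + t"]) simp
  next
    case False
    have "exec w (Cond b p q) s (1 + btime b + t') (sem w (Cond b p q) s)"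
      using exec.CondFalse[OF False t'(2)] False by simp
    then show ?thesis using t'(1) by (intro exI[of _ "1 + btime b + t'"]) simp
  qed
next
  case Skip
  show ?case using exec.Skip[of w s] by (intro exI[of _ 1]) simp
next
  case (WSet i e f)
  show ?case using exec.WSet[of w i e f s] by (intro exI[of _ "1 + wtime e + wtime f"]) simp
next
  case (RSet i e f)
  show ?case using exec.RSet[of w i e f s] by (intro exI[of _ "1 + wtime e + rtime f"]) simp
qed simp

text \<open>Termination and amortized time in one rule. The ghost state \<open>g\<close> carries the
  abstract data that the invariant speaks of. A round, test included, takes at least one step, so
  \<open>\<Phi>\<close> falls by at least 1 and the floor of its distance to the lower bound
  \<open>l\<close> is a well-founded measure. Only the last, failing test is not paid by
  \<open>\<Phi>\<close>.\<close>

lemma exec_While: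
  fixes \<Phi> :: "'g \<Rightarrow> real"
  assumes "I g s"
    and step: "\<And>g s. I g s \<Longrightarrow> bval w s b \<Longrightarrow>
      \<exists>t s' g'. exec w p s t s' \<and> I g' s' \<and> real t + real (1 + btime b) + \<Phi> g' \<le> \<Phi> g"
    and bound: "\<And>g s. I g s \<Longrightarrow> l \<le> \<Phi> g"
  shows "\<exists>t s' g'. exec w (While b p) s t s' \<and> I g' s' \<and> \<not> bval w s' b \<and>
    real t + \<Phi> g' \<le> \<Phi> g + real (1 + btime b)"
  using assms(1)
proof (induction "nat \<lfloor>\<Phi> g - l\<rfloor>" arbitrary: g s rule: less_induct)
  case less
  show ?case
  proof (cases "bval w s b")
    case False
    with less.prems show ?thesis using exec.WhileFalse[OF False] by force
  next
    case True
    obtain t s' g' where 1: "exec w p s t s'" "I g' s'"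
      "real t + real (1 + btime b) + \<Phi> g' \<le> \<Phi> g"
      using step[OF less.prems True] by blast
    then have "\<Phi> g' + 1 \<le> \<Phi> g" by linarith
    with bound[OF 1(2)] have "nat \<lfloor>\<Phi> g' - l\<rfloor> < nat \<lfloor>\<Phi> g - l\<rfloor>"
      by linarith
    from less.hyps[OF this 1(2)] obtain t' s'' g'' where 2: "exec w (While b p) s' t' s''"
      "I g'' s''" "\<not> bval w s'' b" "real t' + \<Phi> g'' \<le> \<Phi> g' + real (1 + btime b)" by blast
    have "exec w (While b p) s (1 + btime b + t + t') s''"
      by (rule exec.WhileTrue[OF True 1(1) 2(1)])
    with 1 2 show ?thesis
      by (intro exI[of _ "1 + btime b + t + t'"] exI[of _ s''] exI[of _ g'']) simp
  qed
qed

lemma exec_While_sem: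
  fixes \<Phi> :: "'g \<Rightarrow> real"
  assumes start: "I g s" and p: "loopfree p" "max_time p + (1 + btime b) \<le> K"
    and step: "\<And>g s. I g s \<Longrightarrow> bval w s b \<Longrightarrow> \<exists>g'. I g' (sem w p s) \<and> real K + \<Phi> g' \<le> \<Phi> g"
    and bound: "\<And>g s. I g s \<Longrightarrow> 0 \<le> \<Phi> g"
  shows "\<exists>t s' g'. exec w (While b p) s t s' \<and> I g' s' \<and> \<not> bval w s' b \<and>
    real t + \<Phi> g' \<le> \<Phi> g + real (1 + btime b)"
proof (rule exec_While[where I = I and \<Phi> = \<Phi>, OF start _ bound])
  fix g s assume "I g s" "bval w s b"
  then obtain g' where g': "I g' (sem w p s)" "real K + \<Phi> g' \<le> \<Phi> g" using step by blast
  obtain t where t: "t \<le> max_time p" "exec w p s t (sem w p s)" using exec_sem[OF p(1)] by blast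
  have "t + (1 + btime b) \<le> K" using t(1) p(2) by simp
  then have "real t + real (1 + btime b) + \<Phi> g' \<le> \<Phi> g" using g'(2) by linarith
  then show "\<exists>t s' g'. exec w p s t s' \<and> I g' s' \<and> real t + real (1 + btime b) + \<Phi> g' \<le> \<Phi> g"
    using g'(1) t(2) by blast
qed

text \<open>A frame condition by whole word arrays. Of the real arrays only the costs are protected;
  real array 1 is scratch space for the doubling loop.\<close>

definition same :: "nat set \<Rightarrow> memory \<Rightarrow> memory \<Rightarrow> bool" where
  "same A s s' \<longleftrightarrow> (\<forall>i. i \<notin> A \<longrightarrow> words s' i = words s i) \<and> reals s' 0 = reals s 0"

lemma same_words: "same A s s' \<Longrightarrow> i \<notin> A \<Longrightarrow> words s' i = words s i"
  by (simp add: same_def)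

lemma same_trans: "same A s s' \<Longrightarrow> same B s' s'' \<Longrightarrow> same (A \<union> B) s s''"
  by (simp add: same_def)

lemma same_mono: "same A s s' \<Longrightarrow> A \<subseteq> B \<Longrightarrow> same B s s'"
  by (auto simp: same_def)

lemma words_set_word [simp]:
  "words (set_word i j m s) = (words s)(i := (words s i)(j := m))"
  by (simp add: set_word_def)

lemma reals_set_word [simp]: "reals (set_word i j m s) = reals s"
  by (simp add: set_word_def)

lemma words_set_real [simp]: "words (set_real i j r s) = words s"
  by (simp add: set_real_def)

lemma reals_set_real [simp]:
  "reals (set_real i j r s) = (reals s)(i := (reals s i)(j := r))"
  by (simp add: set_real_def)

lemma word_diff:
  assumes "b \<le> a" "a < 2 ^ w"
  shows "nat ((int a - int b) mod 2 ^ w) = a - b"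
proof -
  have "int a - int b = int (a - b)" using assms by simp
  moreover have "int (a - b) < 2 ^ w"
    using assms(2) by (metis less_imp_diff_less of_nat_less_iff of_nat_numeral of_nat_power)
  moreover have "0 \<le> int (a - b)" by simp
  ultimately show ?thesis by (metis mod_pos_pos_trivial nat_int)
qed

section \<open>The algorithm\<close>

abbreviation var :: "nat \<Rightarrow> wexp" where "var i \<equiv> WGet i (WLit 0)"
abbreviation setv :: "nat \<Rightarrow> wexp \<Rightarrow> com" where "setv i e \<equiv> WSet i (WLit 0) e"
abbreviation ix :: "wexp \<Rightarrow> wexp \<Rightarrow> wexp" where "ix e f \<equiv> WAdd (WMul e (var 0)) f"
abbreviation seq :: "com \<Rightarrow> com \<Rightarrow> com" (infixr ";;" 60) where "p ;; q \<equiv> Seq p q"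

text \<open>
  The bucket of vertex \<open>x\<close> for level \<open>j\<close> is an unordered list of neighbours, stored in \<open>ELT\<close> from
  index \<open>(j * n + x) * n\<close> on; its length is at index \<open>j * n + x\<close> of \<open>SIZE\<close>. At index \<open>x * n + y\<close>, \<open>BKT\<close>
  holds the level \<open>b x y\<close> and \<open>POS\<close> the position of \<open>y\<close> in that bucket, so that \<open>y\<close> can be deleted by
  moving the last entry into its place. \<open>WT\<close> holds the loads times \<open>2 ^ L\<close>, and \<open>CNT\<close> the numbers of
  owned edges. All arrays from \<open>LOGN\<close> on are scalars.
\<close>

abbreviation (input) LEV :: nat where "LEV \<equiv> 5"
abbreviation (input) BKT :: nat where "BKT \<equiv> 6"
abbreviation (input) SIZE :: nat where "SIZE \<equiv> 7"
abbreviation (input) ELT :: nat where "ELT \<equiv> 8"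
abbreviation (input) POS :: nat where "POS \<equiv> 9"
abbreviation (input) WT :: nat where "WT \<equiv> 10"
abbreviation (input) TAB :: nat where "TAB \<equiv> 11"
abbreviation (input) CNT :: nat where "CNT \<equiv> 12"
abbreviation (input) FLAG :: nat where "FLAG \<equiv> 13"
abbreviation (input) STK :: nat where "STK \<equiv> 14"
abbreviation (input) LOGN :: nat where "LOGN \<equiv> 15"
abbreviation (input) FULL :: nat where "FULL \<equiv> 16"
abbreviation (input) SP :: nat where "SP \<equiv> 17"
abbreviation (input) VV :: nat where "VV \<equiv> 20"
abbreviation (input) UU :: nat where "UU \<equiv> 21"
abbreviation (input) II :: nat where "II \<equiv> 22"
abbreviation (input) PP :: nat where "PP \<equiv> 23"
abbreviation (input) ZZ :: nat where "ZZ \<equiv> 24"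
abbreviation (input) AA :: nat where "AA \<equiv> 25"
abbreviation (input) BB :: nat where "BB \<equiv> 26"
abbreviation (input) QQ :: nat where "QQ \<equiv> 27"
abbreviation (input) LL :: nat where "LL \<equiv> 28"
abbreviation (input) IX :: nat where "IX \<equiv> 29"
abbreviation (input) OW :: nat where "OW \<equiv> 30"
abbreviation (input) SS :: nat where "SS \<equiv> 31"

definition half_rem :: "nat \<Rightarrow> nat \<Rightarrow> com" where
  "half_rem X Y =
    setv AA (ix (var X) (var Y)) ;;
    setv BB (ix (WGet BKT (var AA)) (var X)) ;;
    WSet SIZE (var BB) (WSub (WGet SIZE (var BB)) (WLit 1)) ;;
    setv QQ (WGet POS (var AA)) ;;
    setv LL (WGet ELT (ix (var BB) (WGet SIZE (var BB)))) ;;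
    WSet ELT (ix (var BB) (var QQ)) (var LL) ;;
    WSet POS (ix (var X) (var LL)) (var QQ) ;;
    WSet WT (var X) (WSub (WGet WT (var X)) (WGet TAB (WGet BKT (var AA))))"

definition half_add :: "nat \<Rightarrow> nat \<Rightarrow> com" where
  "half_add X Y =
    setv AA (ix (var X) (var Y)) ;;
    setv BB (ix (WGet BKT (var AA)) (var X)) ;;
    WSet ELT (ix (var BB) (WGet SIZE (var BB))) (var Y) ;;
    WSet POS (var AA) (WGet SIZE (var BB)) ;;
    WSet SIZE (var BB) (WAdd (WGet SIZE (var BB)) (WLit 1)) ;;
    WSet WT (var X) (WAdd (WGet WT (var X)) (WGet TAB (WGet BKT (var AA))))"

definition set_bkt :: "nat \<Rightarrow> nat \<Rightarrow> wexp \<Rightarrow> com" where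
  "set_bkt X Y e = WSet BKT (ix (var X) (var Y)) e"

definition get_bkt :: "nat \<Rightarrow> nat \<Rightarrow> wexp" where
  "get_bkt X Y = WGet BKT (ix (var X) (var Y))"

text \<open>The levels survive the removal, since \<open>half_rem\<close> leaves \<open>BKT\<close>
  alone, and are changed while the edge is in no bucket. Applying the same \<open>f\<close> at both
  ends preserves their difference.\<close>

definition shift :: "(wexp \<Rightarrow> wexp \<Rightarrow> wexp) \<Rightarrow> com" where
  "shift f =
    half_rem VV UU ;; half_rem UU VV ;;
    set_bkt VV UU (f (get_bkt VV UU) (WLit 1)) ;; set_bkt UU VV (f (get_bkt UU VV) (WLit 1)) ;;
    half_add VV UU ;; half_add UU VV"

definition set_ix :: com where
  "set_ix = Cond (WLess (var VV) (var UU)) (setv IX (ix (var VV) (var UU))) (setv IX (ix (var UU) (var VV)))"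

text \<open>The quotient plus one may exceed the rounded up quotient by one copy, which the later
  bound \<open>1 + d / k\<close> allows for; adding \<open>k - 1\<close> before dividing could
  overflow a word.\<close>

definition set_copies :: com where
  "set_copies = Cond (WEq (WGet CNT (var OW)) (WLit 0)) (WSet 3 (var OW) (WLit 0))
     (WSet 3 (var OW) (WAdd (WDiv (WGet CNT (var OW)) (WGet 1 (var OW))) (WLit 1)))"

definition drop_owner :: com where
  "drop_owner = set_ix ;; setv OW (WGet 4 (var IX)) ;;
    WSet CNT (var OW) (WSub (WGet CNT (var OW)) (WLit 1)) ;; set_copies"

definition gain_owner :: "nat \<Rightarrow> com" where
  "gain_owner Z = set_ix ;; setv OW (var Z) ;; WSet 4 (var IX) (var OW) ;;
    WSet CNT (var OW) (WAdd (WGet CNT (var OW)) (WLit 1)) ;; set_copies"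

definition push :: "nat \<Rightarrow> com" where
  "push X = Cond (WEq (WGet FLAG (var X)) (WLit 0))
    (WSet FLAG (var X) (WLit 1) ;; WSet STK (var SP) (var X) ;; setv SP (WAdd (var SP) (WLit 1))) Skip"

definition pop :: com where
  "pop = setv SP (WSub (var SP) (WLit 1)) ;; WSet FLAG (var VV) (WLit 0)"

definition bucket :: wexp where "bucket = ix (var II) (var VV)"

definition up_body :: com where
  "up_body = setv UU (WGet ELT (ix bucket (WSub (WGet SIZE bucket) (WLit 1)))) ;;
    shift WAdd ;; drop_owner ;; gain_owner VV ;; push UU"

definition raise :: com where
  "raise = While (WLess (WLit 0) (WGet SIZE bucket)) up_body ;;
    WSet LEV (var VV) (WAdd (var II) (WLit 1))"

text \<open>Unlike in \<open>up_body\<close> the bucket need not become empty: an edge whose level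
  at the other end equals the level of that end cannot move and is handed over to it. So positions
  are scanned, and downwards: a removal fills the hole with the last entry, which has been visited
  already.\<close>

definition down_body :: com where
  "down_body = setv PP (WSub (var PP) (WLit 1)) ;; setv UU (WGet ELT (ix bucket (var PP))) ;;
    Cond (WLess (WGet LEV (var UU)) (get_bkt UU VV)) (shift WSub ;; push UU)
      (drop_owner ;; gain_owner UU)"

definition lower :: com where
  "lower = setv PP (WGet SIZE bucket) ;; While (WLess (WLit 0) (var PP)) down_body ;;
    WSet LEV (var VV) (WSub (var II) (WLit 1))"

definition fetch :: com where
  "fetch = setv VV (WGet STK (WSub (var SP) (WLit 1))) ;; setv II (WGet LEV (var VV))"

text \<open>Dividing \<open>2 ^ L\<close> by the table entry recovers \<open>2 ^ lev\<close>, so no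
  second table of powers is kept; vertex levels are at most \<open>L\<close>, where the entry is
  positive.\<close>

definition too_heavy :: bexp where
  "too_heavy = BAnd (WLess (WMul (WLit 2) (var FULL)) (WGet WT (var VV)))
    (BNot (WLess (WGet 1 (var VV)) (WMul (WLit 2) (WDiv (var FULL) (WGet TAB (var II))))))"

definition too_light :: bexp where
  "too_light = BAnd (WLess (WMul (WLit 4) (WGet WT (var VV))) (var FULL)) (WLess (WLit 0) (var II))"

text \<open>A vertex is popped only when it needs no repair, so it may move several levels, one per
  round, and it is still marked as waiting while its own level and load change.\<close>

definition repair_body :: com where
  "repair_body = fetch ;; Cond too_heavy raise (Cond too_light lower pop)"

definition repair :: com where
  "repair = While (WLess (WLit 0) (var SP)) repair_body"

definition sort_ends :: com where
  "sort_ends = Cond (RLess (RGet 0 (WGet 2 (WLit 1))) (RGet 0 (WGet 2 (WLit 0))))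
    (setv UU (WGet 2 (WLit 1)) ;; setv VV (WGet 2 (WLit 0)))
    (setv UU (WGet 2 (WLit 0)) ;; setv VV (WGet 2 (WLit 1))) ;;
    setv SS (WLit 0) ;; RSet 1 (WLit 0) (RGet 0 (var UU))"

text \<open>Asks whether one more doubling keeps the smaller cost within the larger one. The first
  conjunct stops the count at \<open>L + 1\<close>, which bounds the running time whatever the cost
  ratio is.\<close>

definition offset_test :: bexp where
  "offset_test = BAnd (BNot (WLess (var LOGN) (var SS)))
    (BNot (RLess (RGet 0 (var VV)) (RMul (RWord (WLit 2)) (RGet 1 (WLit 0)))))"

definition offset_body :: com where
  "offset_body = RSet 1 (WLit 0) (RMul (RWord (WLit 2)) (RGet 1 (WLit 0))) ;;
    setv SS (WAdd (var SS) (WLit 1))"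

text \<open>The lowest two levels with the prescribed difference that are not below the levels of
  the two ends. Equality then holds at one end, kept in \<open>ZZ\<close>, which may own the
  edge.\<close>

definition place_edge :: com where
  "place_edge = Cond (WLess (WAdd (WGet LEV (var UU)) (var SS)) (WGet LEV (var VV)))
      (setv II (WGet LEV (var VV)) ;; setv PP (WSub (WGet LEV (var VV)) (var SS)) ;; setv ZZ (var VV))
      (setv II (WAdd (WGet LEV (var UU)) (var SS)) ;; setv PP (WGet LEV (var UU)) ;; setv ZZ (var UU)) ;;
    set_bkt UU VV (var PP) ;; set_bkt VV UU (var II)"

definition insert_edge :: com where
  "insert_edge = place_edge ;; half_add UU VV ;; half_add VV UU ;; gain_owner ZZ ;; push UU ;; push VV"

definition delete_edge :: com where
  "delete_edge = setv UU (WGet 2 (WLit 0)) ;; setv VV (WGet 2 (WLit 1)) ;;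
    half_rem UU VV ;; half_rem VV UU ;; drop_owner ;; push UU ;; push VV"

definition init_loop :: com where
  "init_loop = While (WLess (var FULL) (var 0))
     (setv FULL (WMul (WLit 2) (var FULL)) ;; setv LOGN (WAdd (var LOGN) (WLit 1)))"

definition table_loop :: com where
  "table_loop = While (WLess (WLit 0) (var QQ))
     (WSet TAB (var PP) (var QQ) ;; setv QQ (WDiv (var QQ) (WLit 2)) ;;
      setv PP (WAdd (var PP) (WLit 1)))"

definition vc_alg :: dyn_alg where
  "vc_alg = \<lparr>preprocess =
      Cond (WEq (var 0) (WLit 0)) Skip (setv FULL (WLit 1) ;; init_loop ;; setv QQ (var FULL) ;; table_loop),
    insertion = sort_ends ;; While offset_test offset_body ;; insert_edge ;; repair,
    deletion = delete_edge ;; repair\<rparr>"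

section \<open>Data structures in memory\<close>

type_synonym arc_levels = "nat \<Rightarrow> nat \<Rightarrow> nat"

text \<open>\<open>L\<close> is the binary logarithm of \<open>n\<close>, rounded up: its two bounds
  leave no other value.\<close>

locale vc_instance =
  fixes n w L :: nat and c :: "nat \<Rightarrow> real" and k :: "nat \<Rightarrow> nat"
  assumes n_pos: "0 < n"
    and word_large: "(n + 1) ^ 6 \<le> 2 ^ w"
    and L_lower: "n \<le> 2 ^ L" and L_upper: "2 ^ L < 2 * n"
    and c_pos: "\<And>v. v < n \<Longrightarrow> 0 < c v"
    and k_pos: "\<And>v. v < n \<Longrightarrow> 0 < k v"
    and k_word: "\<And>v. v < n \<Longrightarrow> k v < 2 ^ w"
begin

text \<open>What an edge on level \<open>j\<close> contributes to a load, scaled by \<open>2 ^ L\<close>; beyond level \<open>L\<close> it is 0.\<close>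

definition T :: "nat \<Rightarrow> nat" where "T j = 2 ^ L div 2 ^ j"

text \<open>One end of an edge is on the level of its owner, hence at most \<open>L\<close>, and the
  level at the other end exceeds it by at most the largest offset \<open>L + 1\<close>.\<close>

definition J :: nat where "J = 2 * L + 1"

lemma L_le: "L \<le> n"
proof (rule ccontr)
  assume "\<not> L \<le> n"
  then have "2 * 2 ^ n \<le> (2 :: nat) ^ L"
    by (metis Suc_leI not_le power_Suc power_increasing one_le_numeral)
  moreover have "n < 2 ^ n" by simp
  ultimately show False using L_upper by linarith
qed

lemma T_0: "T 0 = 2 ^ L" by (simp add: T_def)

lemma T_Suc: "T (Suc j) = T j div 2"
  by (simp add: T_def div_mult2_eq[symmetric] mult.commute)

lemma T_le: "j \<le> L \<Longrightarrow> T j = 2 ^ (L - j)"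
  by (simp add: T_def power_diff)

lemma T_gt: "L < j \<Longrightarrow> T j = 0"
  by (simp add: T_def)

lemma T_antimono: "i \<le> j \<Longrightarrow> T j \<le> T i"
  by (simp add: T_def div_le_mono2)

lemma T_bound: "T j \<le> 2 * n"
  using T_antimono[of 0 j] L_upper by (simp add: T_0)

text \<open>The largest index is that of an entry of \<open>ELT\<close>,
  \<open>(j * n + x) * n + p\<close> with \<open>j \<le> 2 * n + 1\<close>, a cubic with small
  coefficients. The sixth power leaves a factor \<open>(n + 1) ^ 3 \<ge> 8\<close> to absorb
  them.\<close>

lemma poly_bounds:
  "2 * n ^ 3 + 2 * n ^ 2 + n < 2 ^ w" "8 * n ^ 2 + 4 < 2 ^ w"
proof -
  have "n ^ 3 + 3 * n^2 + 3 * n + 1 = (n + 1) ^ 3" by (simp add: algebra_simps eval_nat_numeral)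
  moreover have "n + 1 \<le> (n + 1) ^ 2" by (simp add: power2_eq_square)
  moreover have "8 * (n + 1) ^ 3 \<le> (n + 1) ^ 3 * (n + 1) ^ 3"
  proof -
    have "2 ^ 3 \<le> (n + 1) ^ 3" using n_pos by (intro power_mono) auto
    then show ?thesis by (intro mult_right_mono) simp_all
  qed
  moreover have "(n + 1) ^ 3 * (n + 1) ^ 3 = (n + 1) ^ 6" by (simp add: power_add[symmetric])
  ultimately have *: "8 * n ^ 3 + 24 * n ^ 2 + 24 * n + 8 \<le> 2 ^ w" using word_large by linarith
  then show "2 * n ^ 3 + 2 * n ^ 2 + n < 2 ^ w" by linarith
  from * show "8 * n ^ 2 + 4 < 2 ^ w" using n_pos by linarith
qed

lemma small_lits [simp]:
  "(1::nat) < 2 ^ w" "(2::nat) < 2 ^ w" "(4::nat) < 2 ^ w" "0 < w"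
  "Suc 0 mod 2 ^ w = Suc 0" "(2::nat) mod 2 ^ w = 2" "(4::nat) mod 2 ^ w = 4"
proof -
  show 1: "(1::nat) < 2 ^ w" "(2::nat) < 2 ^ w" "(4::nat) < 2 ^ w" using poly_bounds(2) by linarith+
  then show "0 < w" by (cases w) auto
  with 1 show "Suc 0 mod 2 ^ w = Suc 0" "(2::nat) mod 2 ^ w = 2" "(4::nat) mod 2 ^ w = 4" by auto
qed

lemma pair_bound:
  assumes "x < n" "y < n" shows "x * n < 2 ^ w" "x * n + y < 2 ^ w"
proof -
  have "x * n + y < n * n"
  proof -
    have "x * n + y < Suc x * n" using assms by simp
    also have "\<dots> \<le> n * n" using assms by (intro mult_right_mono) auto
    finally show ?thesis .
  qed
  then show "x * n + y < 2 ^ w" using poly_bounds(2) by (simp add: power2_eq_square)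
  then show "x * n < 2 ^ w" by simp
qed

lemma bucket_le: "j \<le> J \<Longrightarrow> x < n \<Longrightarrow> j * n + x \<le> 2 * n ^ 2 + 2 * n"
proof -
  assume a: "j \<le> J" "x < n"
  then have "j \<le> 2 * n + 1" using L_le by (simp add: J_def)
  then have "j * n \<le> (2 * n + 1) * n" by (rule mult_right_mono) simp
  with a show ?thesis by (simp add: algebra_simps power2_eq_square)
qed

lemma bucket_bound:
  assumes "j \<le> J" "x < n" shows "j * n < 2 ^ w" "j * n + x < 2 ^ w"
proof -
  have "n ^ 2 \<le> n ^ 3" using n_pos by (intro power_increasing) auto
  moreover have "n \<le> n ^ 2" by (simp add: power2_eq_square)
  ultimately show "j * n + x < 2 ^ w"
    using bucket_le[OF assms] poly_bounds(1) by linarith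
  then show "j * n < 2 ^ w" by simp
qed

lemma cell_bound:
  assumes "j \<le> J" "x < n" "p \<le> n"
  shows "(j * n + x) * n < 2 ^ w" "(j * n + x) * n + p < 2 ^ w"
proof -
  have "(j * n + x) * n \<le> (2 * n ^ 2 + 2 * n) * n"
    using bucket_le[OF assms(1,2)] by (rule mult_right_mono) simp
  then show "(j * n + x) * n + p < 2 ^ w"
    using poly_bounds(1) assms(3) by (simp add: algebra_simps power2_eq_square power3_eq_cube)
  then show "(j * n + x) * n < 2 ^ w" by simp
qed

lemma n_bound: "n < 2 ^ w"
proof -
  have "n \<le> n ^ 2" by (simp add: power2_eq_square)
  then show ?thesis using poly_bounds(2) by linarith
qed

lemma ix_inj:
  assumes "y < n" "y' < n" shows "x * n + y = x' * n + y' \<longleftrightarrow> x = x' \<and> y = y'"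
proof
  assume *: "x * n + y = x' * n + y'"
  have "x = (x * n + y) div n" "x' = (x' * n + y') div n"
    "y = (x * n + y) mod n" "y' = (x' * n + y') mod n" using assms by simp_all
  with * show "x = x' \<and> y = y'" by metis
qed auto

definition static :: "memory \<Rightarrow> bool" where
  "static s \<longleftrightarrow> words s 0 0 = n \<and> (\<forall>v<n. words s 1 v = k v) \<and> (\<forall>v<n. reals s 0 v = c v) \<and>
    (\<forall>j. words s TAB j = T j) \<and> words s LOGN 0 = L \<and> words s FULL 0 = 2 ^ L"

lemma static_same: "same A s s' \<Longrightarrow> A \<inter> {0, 1, TAB, LOGN, FULL} = {} \<Longrightarrow> static s \<Longrightarrow> static s'"
  by (auto simp: static_def same_def)

lemma staticD:
  assumes "static s"
  shows "words s 0 0 = n" "words s TAB j = T j" "words s LOGN 0 = L" "words s FULL 0 = 2 ^ L"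
    "v < n \<Longrightarrow> words s 1 v = k v" "v < n \<Longrightarrow> reals s 0 v = c v"
  using assms by (auto simp: static_def)

subsection \<open>Incident edges by level\<close>

text \<open>Stated for plain functions instead of memory, so that moving the last entry into a hole
  can be reasoned about without words. The two clauses make \<open>el x j\<close> and
  \<open>ps x\<close> inverse to each other, between the positions below \<open>sz x j\<close> and
  the neighbours of \<open>x\<close> on level \<open>j\<close>.\<close>

definition slots ::
  "(nat \<times> nat) set \<Rightarrow> arc_levels \<Rightarrow> arc_levels \<Rightarrow> (nat \<Rightarrow> nat \<Rightarrow> nat \<Rightarrow> nat) \<Rightarrow>
   arc_levels \<Rightarrow> bool" where
  "slots H b sz el ps \<longleftrightarrow>
    (\<forall>x y. (x, y) \<in> H \<longrightarrow> ps x y < sz x (b x y) \<and> el x (b x y) (ps x y) = y) \<and>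
    (\<forall>x<n. \<forall>j\<le>J. \<forall>p<sz x j. (x, el x j p) \<in> H \<and> b x (el x j p) = j \<and> ps x (el x j p) = p)"

text \<open>The hole \<open>q\<close> is filled with the last entry \<open>l\<close>. If
  \<open>y\<close> is itself the last entry, then \<open>l = y\<close>, and both writes concern a
  position and a neighbour that no longer count.\<close>

lemma slots_rem:
  assumes S: "slots H b sz el ps" and H: "H \<subseteq> {..<n} \<times> {..<n}" and xy: "(x, y) \<in> H"
    and j: "j = b x y" "j \<le> J" and q: "q = ps x y" and l: "l = el x j (sz x j - 1)"
    and sz': "\<And>x' j'. x' < n \<Longrightarrow> j' \<le> J \<Longrightarrow> sz' x' j' = (if x' = x \<and> j' = j then sz x j - 1 else sz x' j')"
    and el': "\<And>x' j' p. x' < n \<Longrightarrow> j' \<le> J \<Longrightarrow> p < sz x' j' \<Longrightarrow>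
        el' x' j' p = (if x' = x \<and> j' = j \<and> p = q then l else el x' j' p)"
    and ps': "\<And>x' y'. x' < n \<Longrightarrow> y' < n \<Longrightarrow> ps' x' y' = (if x' = x \<and> y' = l then q else ps x' y')"
    and bJ: "\<And>x y. (x, y) \<in> H \<Longrightarrow> b x y \<le> J"
  shows "slots (H - {(x, y)}) b sz' el' ps'"
proof -
  have 1: "ps a e < sz a (b a e)" "el a (b a e) (ps a e) = e" if "(a, e) \<in> H" for a e
    using S that by (auto simp: slots_def)
  have 2: "(a, el a i p) \<in> H" "b a (el a i p) = i" "ps a (el a i p) = p"
    if "a < n" "i \<le> J" "p < sz a i" for a i p
    using S that by (auto simp: slots_def)
  have xn: "x < n" "y < n" using xy H by auto
  have pos: "q < sz x j" "el x j q = y" using 1[OF xy] j q by auto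
  then have last: "sz x j - 1 < sz x j" by linarith
  have lH: "(x, l) \<in> H" "b x l = j" "ps x l = sz x j - 1" using 2[OF xn(1) j(2) last] l by auto
  then have ln: "l < n" using H by auto
  have A: "ps' a e < sz' a (b a e) \<and> el' a (b a e) (ps' a e) = e"
    if ae: "(a, e) \<in> H" "(a, e) \<noteq> (x, y)" for a e
  proof -
    have an: "a < n" "e < n" using ae H by auto
    note b = bJ[OF ae(1)] and o = 1[OF ae(1)]
    show ?thesis
    proof (cases "a = x \<and> b a e = j")
      case True
      show ?thesis
      proof (cases "e = l")
        case True2: True
        have "q \<noteq> sz x j - 1" using lH True2 pos ae l True by metis
        then show ?thesis using True True2 an b o pos by (auto simp: sz' el' ps')
      next
        case False
        have "ps a e \<noteq> sz x j - 1" using o False True l by auto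
        moreover have "ps a e \<noteq> q" using o True pos ae by auto
        ultimately show ?thesis using True False an b o by (auto simp: sz' el' ps')
      qed
    next
      case False
      then have "\<not> (a = x \<and> e = l)" using lH by auto
      then show ?thesis using False an b o by (auto simp: sz' el' ps')
    qed
  qed
  have B: "(a, el' a i p) \<in> H - {(x, y)} \<and> b a (el' a i p) = i \<and> ps' a (el' a i p) = p"
    if a: "a < n" "i \<le> J" "p < sz' a i" for a i p
  proof (cases "a = x \<and> i = j")
    case True
    then have p: "p < sz x j - 1" using a by (simp add: sz')
    show ?thesis
    proof (cases "p = q")
      case True2: True
      have "l \<noteq> y" using True2 p lH q by auto
      then show ?thesis using True True2 a p lH ln xn by (auto simp: el' ps')
    next
      case False
      have p': "p < sz x j" using p by simp
      note o = 2[OF xn(1) j(2) p']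
      have "el x j p \<noteq> l" using o p lH by auto
      moreover have "el x j p \<noteq> y" using o False q by auto
      moreover have "el x j p < n" using o H by auto
      ultimately show ?thesis using True False a p' o by (auto simp: el' ps')
    qed
  next
    case False
    then have p: "p < sz a i" using a by (auto simp: sz')
    note o = 2[OF a(1,2) p]
    have e: "el' a i p = el a i p" using False p a by (auto simp: el')
    have "(a, el a i p) \<noteq> (x, y)" using o False j by auto
    moreover have "\<not> (a = x \<and> el a i p = l)" using o False lH by auto
    moreover have "el a i p < n" using o H by auto
    ultimately show ?thesis using o a e by (auto simp: ps')
  qed
  show ?thesis unfolding slots_def by (intro conjI allI impI; use A B in blast)
qed

text \<open>The hypothesis on \<open>el'\<close> is confined to \<open>p < n\<close> because only
  then are the cells of different buckets distinct in the flat array;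
  \<open>p \<le> sz x' j'\<close> includes the new last position.\<close>

lemma slots_add:
  assumes S: "slots H b sz el ps" and H: "H \<subseteq> {..<n} \<times> {..<n}" and xy: "(x, y) \<notin> H" "x < n" "y < n"
    and j: "j = b x y" "j \<le> J"
    and sz': "\<And>x' j'. x' < n \<Longrightarrow> j' \<le> J \<Longrightarrow> sz' x' j' = (if x' = x \<and> j' = j then sz x j + 1 else sz x' j')"
    and el': "\<And>x' j' p. x' < n \<Longrightarrow> j' \<le> J \<Longrightarrow> p \<le> sz x' j' \<Longrightarrow> p < n \<Longrightarrow>
        el' x' j' p = (if x' = x \<and> j' = j \<and> p = sz x j then y else el x' j' p)"
    and ps': "\<And>x' y'. x' < n \<Longrightarrow> y' < n \<Longrightarrow> ps' x' y' = (if x' = x \<and> y' = y then sz x j else ps x' y')"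
    and bJ: "\<And>x y. (x, y) \<in> H \<Longrightarrow> b x y \<le> J"
    and szn: "\<And>x j. x < n \<Longrightarrow> j \<le> J \<Longrightarrow> sz x j \<le> n" "sz x j < n"
  shows "slots (insert (x, y) H) b sz' el' ps'"
proof -
  have 1: "ps a e < sz a (b a e)" "el a (b a e) (ps a e) = e" if "(a, e) \<in> H" for a e
    using S that by (auto simp: slots_def)
  have 2: "(a, el a i p) \<in> H" "b a (el a i p) = i" "ps a (el a i p) = p"
    if "a < n" "i \<le> J" "p < sz a i" for a i p
    using S that by (auto simp: slots_def)
  have A: "ps' a e < sz' a (b a e) \<and> el' a (b a e) (ps' a e) = e"
    if ae: "(a, e) \<in> insert (x, y) H" for a e
  proof (cases "(a, e) = (x, y)")
    case True
    then show ?thesis using xy j szn by (auto simp: sz' el' ps')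
  next
    case False
    then have h: "(a, e) \<in> H" using ae by auto
    then have an: "a < n" "e < n" using H by auto
    have "ps a e < n" using 1(1)[OF h] szn(1)[OF an(1) bJ[OF h]] by linarith
    then show ?thesis using False an bJ[OF h] 1[OF h] by (auto simp: sz' el' ps')
  qed
  have B: "(a, el' a i p) \<in> insert (x, y) H \<and> b a (el' a i p) = i \<and> ps' a (el' a i p) = p"
    if a: "a < n" "i \<le> J" "p < sz' a i" for a i p
  proof (cases "a = x \<and> i = j \<and> p = sz x j")
    case True
    then show ?thesis using xy j szn by (auto simp: sz' el' ps')
  next
    case False
    then have p: "p < sz a i" using a by (auto simp: sz' split: if_splits)
    have pn: "p < n" using p szn(1)[OF a(1,2)] by linarith
    note o = 2[OF a(1,2) p]
    have "(a, el a i p) \<noteq> (x, y)" using o xy by auto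
    moreover have "el a i p < n" using o H by auto
    ultimately show ?thesis using o a p pn False by (auto simp: el' ps')
  qed
  show ?thesis unfolding slots_def by (intro conjI allI impI; use A B in blast)
qed

lemma slots_bij:
  assumes "slots H b sz el ps" "x < n" "j \<le> J"
  shows "bij_betw (el x j) {..<sz x j} {y. (x, y) \<in> H \<and> b x y = j}"
proof (rule bij_betw_imageI)
  show "inj_on (el x j) {..<sz x j}"
    using assms by (intro inj_on_inverseI[of _ "ps x"]) (auto simp: slots_def)
  show "el x j ` {..<sz x j} = {y. (x, y) \<in> H \<and> b x y = j}"
  proof safe
    fix y assume "(x, y) \<in> H" "j = b x y"
    with assms show "y \<in> el x (b x y) ` {..<sz x (b x y)}"
      by (intro image_eqI[of _ _ "ps x y"]) (auto simp: slots_def)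
  qed (use assms in \<open>auto simp: slots_def\<close>)
qed

definition load :: "(nat \<times> nat) set \<Rightarrow> arc_levels \<Rightarrow> nat \<Rightarrow> nat" where
  "load H b x = (\<Sum>y\<in>H `` {x}. T (b x y))"

definition buckets :: "memory \<Rightarrow> (nat \<times> nat) set \<Rightarrow> arc_levels \<Rightarrow> bool" where
  "buckets s H b \<longleftrightarrow> H \<subseteq> {..<n} \<times> {..<n} \<and>
    (\<forall>x y. (x, y) \<in> H \<longrightarrow> words s BKT (x * n + y) = b x y \<and> b x y \<le> J) \<and>
    slots H b (\<lambda>x j. words s SIZE (j * n + x)) (\<lambda>x j p. words s ELT ((j * n + x) * n + p))
      (\<lambda>x y. words s POS (x * n + y)) \<and>
    (\<forall>x<n. words s WT x = load H b x)"

lemma buckets_same: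
  assumes "same A s s'" "A \<inter> {BKT, SIZE, ELT, POS, WT} = {}" "buckets s H b"
  shows "buckets s' H b"
proof -
  have "words s' BKT = words s BKT" "words s' SIZE = words s SIZE" "words s' ELT = words s ELT"
    "words s' POS = words s POS" "words s' WT = words s WT"
    using assms(1,2) by (auto simp: same_def disjoint_iff)
  with assms(3) show ?thesis by (simp add: buckets_def)
qed

lemma load_le:
  assumes "H \<subseteq> {..<n} \<times> {..<n}" shows "load H b x \<le> 2 * n ^ 2"
proof -
  have "H `` {x} \<subseteq> {..<n}" using assms by auto
  then have "card (H `` {x}) \<le> n" by (metis card_mono card_lessThan finite_lessThan)
  have "load H b x \<le> (\<Sum>y\<in>H `` {x}. 2 * n)"
    unfolding load_def by (rule sum_mono) (rule T_bound)
  also have "\<dots> \<le> n * (2 * n)" using \<open>card (H `` {x}) \<le> n\<close> by simp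
  finally show ?thesis by (simp add: power2_eq_square)
qed

lemma load_remove:
  assumes "H \<subseteq> {..<n} \<times> {..<n}" "(x, y) \<in> H"
  shows "load (H - {(x, y)}) b z = load H b z - (if z = x then T (b x y) else 0)"
    "T (b x y) \<le> load H b x"
proof -
  have fin: "finite (H `` {x})"
    by (rule finite_subset[of _ "{..<n}"]) (use assms in auto)
  have y: "y \<in> H `` {x}" using assms by auto
  have "(H - {(x, y)}) `` {z} = (if z = x then H `` {x} - {y} else H `` {z})" by auto
  then show "load (H - {(x, y)}) b z = load H b z - (if z = x then T (b x y) else 0)"
    unfolding load_def using fin y by (auto simp: sum_diff1_nat)
  show "T (b x y) \<le> load H b x"
    unfolding load_def using fin y by (intro member_le_sum) auto
qed

lemma load_insert:
  assumes "H \<subseteq> {..<n} \<times> {..<n}" "(x, y) \<notin> H"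
  shows "load (insert (x, y) H) b z = load H b z + (if z = x then T (b x y) else 0)"
proof -
  have fin: "finite (H `` {x})"
    by (rule finite_subset[of _ "{..<n}"]) (use assms in auto)
  have y: "y \<notin> H `` {x}" using assms by auto
  have "insert (x, y) H `` {z} = (if z = x then insert y (H `` {x}) else H `` {z})" by auto
  then show ?thesis unfolding load_def using fin y by auto
qed

text \<open>By the bijection of \<open>slots_bij\<close>. The third claim provides room for an
  insertion: the non-neighbour \<open>y\<close> is missing from the bucket.\<close>

lemma buckets_card:
  assumes "buckets s H b" "x < n" "j \<le> J"
  shows "words s SIZE (j * n + x) = card {y. (x, y) \<in> H \<and> b x y = j}"
    "words s SIZE (j * n + x) \<le> n"
    "(x, y) \<notin> H \<Longrightarrow> y < n \<Longrightarrow> words s SIZE (j * n + x) < n"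
proof -
  have "slots H b (\<lambda>x j. words s SIZE (j * n + x)) (\<lambda>x j p. words s ELT ((j * n + x) * n + p))
      (\<lambda>x y. words s POS (x * n + y))" and H: "H \<subseteq> {..<n} \<times> {..<n}"
    using assms by (auto simp: buckets_def)
  from bij_betw_same_card[OF slots_bij[OF this(1) assms(2,3)]]
  show 1: "words s SIZE (j * n + x) = card {y. (x, y) \<in> H \<and> b x y = j}" by simp
  have sub: "{y. (x, y) \<in> H \<and> b x y = j} \<subseteq> {..<n}" using H by auto
  then show "words s SIZE (j * n + x) \<le> n"
    using 1 by (metis card_mono card_lessThan finite_lessThan)
  assume "(x, y) \<notin> H" "y < n"
  then have "{y. (x, y) \<in> H \<and> b x y = j} \<subset> {..<n}" using sub by auto
  then show "words s SIZE (j * n + x) < n"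
    using 1 by (metis psubset_card_mono card_lessThan finite_lessThan)
qed

lemma bucketsD:
  assumes "buckets s H b"
  shows "H \<subseteq> {..<n} \<times> {..<n}"
    "(x, y) \<in> H \<Longrightarrow> x < n" "(x, y) \<in> H \<Longrightarrow> y < n"
    "(x, y) \<in> H \<Longrightarrow> words s BKT (x * n + y) = b x y" "(x, y) \<in> H \<Longrightarrow> b x y \<le> J"
    "x < n \<Longrightarrow> words s WT x = load H b x"
    "(x, y) \<in> H \<Longrightarrow> words s POS (x * n + y) < words s SIZE (b x y * n + x)"
    "(x, y) \<in> H \<Longrightarrow> words s ELT ((b x y * n + x) * n + words s POS (x * n + y)) = y"
    "x < n \<Longrightarrow> j \<le> J \<Longrightarrow> p < words s SIZE (j * n + x) \<Longrightarrow>
      (x, words s ELT ((j * n + x) * n + p)) \<in> H \<and> b x (words s ELT ((j * n + x) * n + p)) = j \<and>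
      words s POS (x * n + words s ELT ((j * n + x) * n + p)) = p"
  using assms by (auto simp: buckets_def slots_def)

text \<open>The third claim serves the scan in \<open>lower\<close>: among the first
  \<open>n\<close> positions of each bucket, only the freed one is overwritten.\<close>

lemma half_rem:
  assumes st: "static s" and bk: "buckets s H b" and xy: "(x, y) \<in> H"
    and X: "words s X 0 = x" "20 \<le> X" "X < 25" and Y: "words s Y 0 = y" "20 \<le> Y" "Y < 25"
  defines "s' \<equiv> sem w (half_rem X Y) s"
  shows "buckets s' (H - {(x, y)}) b" "same {SIZE, ELT, POS, WT, AA, BB, QQ, LL} s s'"
    and "j \<le> J \<Longrightarrow> x' < n \<Longrightarrow> p < n \<Longrightarrow> \<not> (x' = x \<and> j = b x y \<and> p = words s POS (x * n + y)) \<Longrightarrow>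
      words s' ELT ((j * n + x') * n + p) = words s ELT ((j * n + x') * n + p)"
proof -
  define j' where "j' = b x y"
  define B where "B = j' * n + x"
  define q where "q = words s POS (x * n + y)"
  define l where "l = words s ELT (B * n + (words s SIZE B - Suc 0))"
  note D = bucketsD[OF bk]
  have xn: "x < n" "y < n" using D(2,3) xy by auto
  have j': "j' \<le> J" using D(5)[OF xy] by (simp add: j'_def)
  have qs: "q < words s SIZE B" using D(7)[OF xy] by (simp add: q_def B_def j'_def)
  have sB: "words s SIZE B \<le> n" using buckets_card(2)[OF bk xn(1) j'] by (simp add: B_def)
  have lst: "words s SIZE B - 1 < words s SIZE B" using qs by simp
  have lH: "(x, l) \<in> H" using D(9)[OF xn(1) j', of "words s SIZE B - 1"] lst
    by (simp add: l_def B_def)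
  then have ln: "l < n" using D(3) by blast
  have bnd: "x * n < 2 ^ w" "x * n + y < 2 ^ w" "j' * n < 2 ^ w" "B < 2 ^ w"
    "B * n < 2 ^ w" "B * n + (words s SIZE B - 1) < 2 ^ w" "B * n + q < 2 ^ w"
    "x * n + l < 2 ^ w" "words s SIZE B < 2 ^ w" "load H b x < 2 ^ w"
    using pair_bound[OF xn] pair_bound[OF xn(1) ln] bucket_bound[OF j' xn(1)]
      cell_bound[OF j' xn(1), of "words s SIZE B - 1"] cell_bound[OF j' xn(1), of q] sB qs
      n_bound load_le[OF D(1), of b x] poly_bounds(2)
    by (auto simp: B_def)
  have bxy: "words s BKT (x * n + y) = j'" using D(4)[OF xy] by (simp add: j'_def)
  have sub1: "nat ((int (words s SIZE B) - 1) mod 2 ^ w) = words s SIZE B - 1"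
    using word_diff[of 1 "words s SIZE B" w] bnd qs by simp
  have sub2: "nat ((int (load H b x) - int (T j')) mod 2 ^ w) = load H b x - T j'"
    using word_diff[of "T j'" "load H b x" w] bnd load_remove(2)[OF D(1) xy, of b] by (simp add: j'_def)
  have mod1: "int (Suc 0) mod 2 ^ w = 1" using small_lits(1)
    by (metis int_ops(2) mod_pos_pos_trivial of_nat_0_le_iff of_nat_less_numeral_power_cancel_iff One_nat_def)
  have Xne: "X \<noteq> i" "Y \<noteq> i" if "i < 20 \<or> 25 \<le> i" for i using X Y that by auto
  have s': "s' = set_word WT x (load H b x - T j') (set_word POS (x * n + l) q (set_word ELT (B * n + q) l
      (set_word LL 0 l (set_word QQ 0 q (set_word SIZE B (words s SIZE B - 1)
      (set_word BB 0 B (set_word AA 0 (x * n + y) s)))))))"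
    unfolding s'_def half_rem_def
    using X(1) Y(1) xn ln bnd
    by (simp add: Xne[symmetric] Xne staticD[OF st] bxy B_def[symmetric] sub1 q_def[symmetric]
        l_def[symmetric] D(6) sub2 mod1)
  have cell: "(i * n + a) * n + p = (j' * n + x) * n + q \<longleftrightarrow> i = j' \<and> a = x \<and> p = q"
    if "a < n" "p < n" for i a p
  proof -
    have "q < n" using qs sB by simp
    then show ?thesis using that xn by (simp add: ix_inj)
  qed
  show "same {SIZE, ELT, POS, WT, AA, BB, QQ, LL} s s'" by (auto simp: s' same_def)
  show "words s' ELT ((j * n + x') * n + p) = words s ELT ((j * n + x') * n + p)"
    if "j \<le> J" "x' < n" "p < n" "\<not> (x' = x \<and> j = b x y \<and> p = words s POS (x * n + y))"
    using that unfolding j'_def[symmetric] q_def[symmetric] by (auto simp: s' B_def cell)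
  have sl: "slots (H - {(x, y)}) b (\<lambda>x j. words s' SIZE (j * n + x))
     (\<lambda>x j p. words s' ELT ((j * n + x) * n + p)) (\<lambda>x y. words s' POS (x * n + y))"
  proof (rule slots_rem[OF _ D(1) xy, of b "\<lambda>x j. words s SIZE (j * n + x)"
        "\<lambda>x j p. words s ELT ((j * n + x) * n + p)" "\<lambda>x y. words s POS (x * n + y)" j' q l])
    show "words s' ELT ((i * n + a) * n + p) = (if a = x \<and> i = j' \<and> p = q then l
        else words s ELT ((i * n + a) * n + p))"
      if "a < n" "i \<le> J" "p < words s SIZE (i * n + a)" for a i p
    proof -
      have "p < n" using buckets_card(2)[OF bk that(1,2)] that(3) by simp
      then show ?thesis using that by (auto simp: s' B_def cell)
    qed
  qed (use bk j' xn ln D(5) in \<open>auto simp: buckets_def j'_def[symmetric] q_def l_def B_def s' ix_inj\<close>)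
  have lw: "words s' WT a = load (H - {(x, y)}) b a" if "a < n" for a
    using that D(6) load_remove(1)[OF D(1) xy, of b a] by (auto simp: s' j'_def)
  have "words s' BKT = words s BKT" by (simp add: s')
  with sl lw D(1,4,5) show "buckets s' (H - {(x, y)}) b" by (auto simp: buckets_def)
qed

lemma half_add:
  assumes st: "static s" and bk: "buckets s H b" and xy: "(x, y) \<notin> H" "x < n" "y < n"
    and X: "words s X 0 = x" "20 \<le> X" "X < 25" and Y: "words s Y 0 = y" "20 \<le> Y" "Y < 25"
    and bxy: "words s BKT (x * n + y) = b x y" "b x y \<le> J"
  defines "s' \<equiv> sem w (half_add X Y) s"
  shows "buckets s' (insert (x, y) H) b" "same {SIZE, ELT, POS, WT, AA, BB} s s'"
    and "j \<le> J \<Longrightarrow> x' < n \<Longrightarrow> p < n \<Longrightarrow> \<not> (x' = x \<and> j = b x y) \<Longrightarrow>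
      words s' ELT ((j * n + x') * n + p) = words s ELT ((j * n + x') * n + p)"
proof -
  define j' where "j' = b x y"
  define B where "B = j' * n + x"
  define q where "q = words s SIZE B"
  note D = bucketsD[OF bk]
  have j': "j' \<le> J" using bxy by (simp add: j'_def)
  have qn: "q < n" using buckets_card(3)[OF bk xy(2) j' xy(1,3)] by (simp add: q_def B_def)
  have ld: "load (insert (x, y) H) b z = load H b z + (if z = x then T j' else 0)" for z
    using load_insert[OF D(1) xy(1)] by (simp add: j'_def)
  have "load (insert (x, y) H) b x \<le> 2 * n ^ 2" by (rule load_le) (use D(1) xy in auto)
  then have lb: "load H b x + T j' < 2 ^ w" using poly_bounds(2) by (simp add: ld)
  have bnd: "x * n < 2 ^ w" "x * n + y < 2 ^ w" "j' * n < 2 ^ w" "B < 2 ^ w"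
    "B * n < 2 ^ w" "B * n + q < 2 ^ w" "Suc q < 2 ^ w"
    using pair_bound[OF xy(2,3)] bucket_bound[OF j' xy(2)]
      cell_bound[OF j' xy(2), of q] qn n_bound
    by (auto simp: B_def)
  have Xne: "X \<noteq> i" "Y \<noteq> i" if "i < 20 \<or> 25 \<le> i" for i using X Y that by auto
  have s': "s' = set_word WT x (load H b x + T j') (set_word SIZE B (Suc q) (set_word POS (x * n + y) q
     (set_word ELT (B * n + q) y (set_word BB 0 B (set_word AA 0 (x * n + y) s)))))"
    unfolding s'_def half_add_def
    using X(1) Y(1) xy bnd lb
    by (simp add: Xne[symmetric] Xne staticD[OF st] bxy(1) j'_def[symmetric] B_def[symmetric]
        q_def[symmetric] D(6))
  have cell: "(i * n + a) * n + p = (j' * n + x) * n + q \<longleftrightarrow> i = j' \<and> a = x \<and> p = q"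
    if "a < n" "p < n" for i a p
    using that xy qn by (simp add: ix_inj)
  show "same {SIZE, ELT, POS, WT, AA, BB} s s'" by (auto simp: s' same_def)
  show "words s' ELT ((j * n + x') * n + p) = words s ELT ((j * n + x') * n + p)"
    if "j \<le> J" "x' < n" "p < n" "\<not> (x' = x \<and> j = b x y)"
    using that unfolding j'_def[symmetric] by (auto simp: s' B_def cell)
  have sl: "slots (insert (x, y) H) b (\<lambda>x j. words s' SIZE (j * n + x))
     (\<lambda>x j p. words s' ELT ((j * n + x) * n + p)) (\<lambda>x y. words s' POS (x * n + y))"
    by (rule slots_add[OF _ D(1) xy, of b "\<lambda>x j. words s SIZE (j * n + x)"
        "\<lambda>x j p. words s ELT ((j * n + x) * n + p)" "\<lambda>x y. words s POS (x * n + y)" j'])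
      (use bk j' xy qn D(5) buckets_card(2)[OF bk] in
        \<open>auto simp: buckets_def j'_def[symmetric] q_def B_def s' ix_inj cell[unfolded q_def B_def]\<close>)
  have lw: "words s' WT a = load (insert (x, y) H) b a" if "a < n" for a
    using that D(6) by (auto simp: s' ld)
  have "words s' BKT = words s BKT" by (simp add: s')
  with sl lw D(1,4,5) xy bxy show "buckets s' (insert (x, y) H) b" by (auto simp: buckets_def)
qed


section \<open>Moving an edge to other levels\<close>

lemma slots_cong:
  assumes "\<And>x y. (x, y) \<in> H \<Longrightarrow> b x y = b' x y" "slots H b sz el ps"
  shows "slots H b' sz el ps"
  using assms(2) unfolding slots_def by (auto simp: assms(1)[symmetric])

lemma load_cong:
  "(\<And>y. (x, y) \<in> H \<Longrightarrow> b x y = b' x y) \<Longrightarrow> load H b x = load H b' x"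
  unfolding load_def by (intro sum.cong) auto

text \<open>A level is overwritten only while its arc is absent from \<open>H\<close>; buckets and
  loads do not depend on it then.\<close>

lemma set_bkt:
  fixes e :: wexp
  assumes st: "static s" and bk: "buckets s H b" and xy: "(x, y) \<notin> H" "x < n" "y < n"
    and X: "words s X 0 = x" and Y: "words s Y 0 = y"
  defines "s' \<equiv> sem w (set_bkt X Y e) s"
  shows "buckets s' H (b(x := (b x)(y := wval w s e)))" "same {BKT} s s'"
    "words s' BKT = (words s BKT)(x * n + y := wval w s e)"
proof -
  have s': "s' = set_word BKT (x * n + y) (wval w s e) s"
    using X Y xy pair_bound[OF xy(2,3)] by (simp add: s'_def set_bkt_def staticD[OF st])
  then show "same {BKT} s s'" "words s' BKT = (words s BKT)(x * n + y := wval w s e)"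
    by (auto simp: same_def)
  let ?b = "b(x := (b x)(y := wval w s e))"
  note D = bucketsD[OF bk]
  have eq: "b a d = ?b a d" if "(a, d) \<in> H" for a d using that xy by auto
  have "slots H ?b (\<lambda>x j. words s' SIZE (j * n + x)) (\<lambda>x j p. words s' ELT ((j * n + x) * n + p))
      (\<lambda>x y. words s' POS (x * n + y))"
    by (rule slots_cong[OF eq]) (use bk in \<open>auto simp: buckets_def s'\<close>)
  moreover have "words s' WT a = load H ?b a" if "a < n" for a
    using load_cong[of a H b ?b] eq D(6)[OF that] by (simp add: s')
  moreover have "words s' BKT (a * n + d) = ?b a d \<and> ?b a d \<le> J" if "(a, d) \<in> H" for a d
    using D(2-5)[OF that] that xy by (auto simp: s' ix_inj)
  ultimately show "buckets s' H ?b" using D(1) by (auto simp: buckets_def)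
qed

lemma get_bkt:
  assumes "static s" "words s BKT (x * n + y) = m" "x < n" "y < n" "words s X 0 = x" "words s Y 0 = y"
  shows "wval w s (get_bkt X Y) = m"
  using assms pair_bound[OF assms(3,4)] by (simp add: get_bkt_def staticD[OF assms(1)])

definition upd2 :: "nat \<Rightarrow> nat \<Rightarrow> (nat \<Rightarrow> nat) \<Rightarrow> arc_levels \<Rightarrow> nat \<Rightarrow> nat \<Rightarrow> nat" where
  "upd2 v u g b x y = (if (x, y) = (v, u) \<or> (x, y) = (u, v) then g (b x y) else b x y)"

text \<open>\<open>f\<close> is addition or subtraction on words and \<open>g\<close> its meaning on
  numbers. Agreement is required at the two current levels only, since words may wrap around
  elsewhere. The third claim again protects the entries of \<open>v\<close> that are still to be
  scanned.\<close>

lemma shift: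
  assumes st: "static s" and bk: "buckets s H b" and vu: "(v, u) \<in> H" "(u, v) \<in> H" "v \<noteq> u"
    and V: "words s VV 0 = v" and U: "words s UU 0 = u"
    and f: "\<And>s e. wval w s e = b v u \<Longrightarrow> wval w s (f e (WLit 1)) = g (b v u)"
      "\<And>s e. wval w s e = b u v \<Longrightarrow> wval w s (f e (WLit 1)) = g (b u v)"
    and g: "g (b v u) \<le> J" "g (b u v) \<le> J"
  defines "s' \<equiv> sem w (shift f) s"
  shows "buckets s' H (upd2 v u g b)" "same {BKT, SIZE, ELT, POS, WT, AA, BB, QQ, LL} s s'"
    and "j \<le> J \<Longrightarrow> p < n \<Longrightarrow> j \<noteq> g (b v u) \<Longrightarrow> \<not> (j = b v u \<and> p = words s POS (v * n + u)) \<Longrightarrow>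
      words s' ELT ((j * n + v) * n + p) = words s ELT ((j * n + v) * n + p)"
proof -
  note D = bucketsD[OF bk]
  have vn: "v < n" "u < n" using D(2,3) vu by auto
  let ?A = "{BKT, SIZE, ELT, POS, WT, AA, BB, QQ, LL}"
  define s1 where "s1 = sem w (half_rem VV UU) s"
  define s2 where "s2 = sem w (half_rem UU VV) s1"
  define s3 where "s3 = sem w (set_bkt VV UU (f (get_bkt VV UU) (WLit 1))) s2"
  define s4 where "s4 = sem w (set_bkt UU VV (f (get_bkt UU VV) (WLit 1))) s3"
  define s5 where "s5 = sem w (half_add VV UU) s4"
  define b1 where "b1 = b(v := (b v)(u := g (b v u)))"
  define b2 where "b2 = b1(u := (b1 u)(v := g (b u v)))"
  have s': "s' = sem w (half_add UU VV) s5"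
    by (simp add: s'_def shift_def s1_def s2_def s3_def s4_def s5_def)
  note h1 = half_rem[OF st bk vu(1) V _ _ U, folded s1_def, simplified]
  have sm1: "same ?A s s1" by (rule same_mono[OF h1(2)]) auto
  have st1: "static s1" by (rule static_same[OF sm1 _ st]) auto
  have V1: "words s1 VV 0 = v" "words s1 UU 0 = u" using V U same_words[OF sm1] by simp_all
  have "(u, v) \<in> H - {(v, u)}" using vu by auto
  note h2 = half_rem[OF st1 h1(1) this V1(2) _ _ V1(1), folded s2_def, simplified]
  have sm2: "same ?A s1 s2" by (rule same_mono[OF h2(2)]) auto
  have st2: "static s2" by (rule static_same[OF sm2 _ st1]) auto
  have V2: "words s2 VV 0 = v" "words s2 UU 0 = u" using V1 same_words[OF sm2] by simp_all
  have B2: "words s2 BKT = words s BKT" using same_words[OF h1(2)] same_words[OF h2(2)] by simp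
  have g2: "wval w s2 (f (get_bkt VV UU) (WLit 1)) = g (b v u)"
    by (rule f(1), rule get_bkt[OF st2 _ vn V2]) (simp add: B2 D(4) vu)
  let ?H = "H - {(v, u)} - {(u, v)}"
  have nin: "(v, u) \<notin> ?H" "(u, v) \<notin> ?H" by auto
  note h3 = set_bkt[OF st2 h2(1) nin(1) vn V2, of "f (get_bkt VV UU) (WLit 1)", folded s3_def,
      unfolded g2, folded b1_def]
  have sm3: "same ?A s2 s3" by (rule same_mono[OF h3(2)]) auto
  have st3: "static s3" by (rule static_same[OF sm3 _ st2]) auto
  have V3: "words s3 VV 0 = v" "words s3 UU 0 = u" using V2 same_words[OF sm3] by simp_all
  have g3: "wval w s3 (f (get_bkt UU VV) (WLit 1)) = g (b u v)"
    by (rule f(2), rule get_bkt[OF st3 _ vn(2,1) V3(2,1)])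
      (use vu vn in \<open>simp add: h3(3) B2 D(4) ix_inj\<close>)
  note h4 = set_bkt[OF st3 h3(1) nin(2) vn(2,1) V3(2,1), of "f (get_bkt UU VV) (WLit 1)", folded s4_def,
      unfolded g3, folded b2_def]
  have sm4: "same ?A s3 s4" by (rule same_mono[OF h4(2)]) auto
  have st4: "static s4" by (rule static_same[OF sm4 _ st3]) auto
  have V4: "words s4 VV 0 = v" "words s4 UU 0 = u" using V3 same_words[OF sm4] by simp_all
  have b2: "b2 = upd2 v u g b" using vu by (auto simp: b2_def b1_def upd2_def fun_eq_iff)
  have B4: "words s4 BKT (v * n + u) = b2 v u" "words s4 BKT (u * n + v) = b2 u v" "b2 v u \<le> J" "b2 u v \<le> J"
    using vu g vn by (auto simp: h4(3) h3(3) ix_inj b2 upd2_def)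
  note h5 = half_add[OF st4 h4(1) nin(1) vn V4(1) _ _ V4(2) _ _ B4(1,3), folded s5_def, simplified]
  have sm5: "same ?A s4 s5" by (rule same_mono[OF h5(2)]) auto
  have st5: "static s5" by (rule static_same[OF sm5 _ st4]) auto
  have V5: "words s5 VV 0 = v" "words s5 UU 0 = u" using V4 same_words[OF sm5] by simp_all
  have B5: "words s5 BKT (u * n + v) = b2 u v" using same_words[OF h5(2)] B4 by simp
  have nin2: "(u, v) \<notin> insert (v, u) ?H" using vu by auto
  note h6 = half_add[OF st5 h5(1) nin2 vn(2,1) V5(2) _ _ V5(1) _ _ B5 B4(4), folded s', simplified]
  have "insert (u, v) (insert (v, u) ?H) = H" using vu by auto
  with h6(1) show "buckets s' H (upd2 v u g b)" by (simp add: b2)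
  have sm6: "same ?A s5 s'" by (rule same_mono[OF h6(2)]) auto
  show "same ?A s s'"
    using same_trans[OF same_trans[OF same_trans[OF same_trans[OF same_trans[OF sm1 sm2] sm3] sm4] sm5] sm6]
    by simp
  show "words s' ELT ((j * n + v) * n + p) = words s ELT ((j * n + v) * n + p)"
    if j: "j \<le> J" and p: "p < n" "j \<noteq> g (b v u)" "\<not> (j = b v u \<and> p = words s POS (v * n + u))"
  proof -
    have "words s' ELT ((j * n + v) * n + p) = words s5 ELT ((j * n + v) * n + p)"
      using h6(3)[OF j vn(1) p(1)] vu by simp
    also have "\<dots> = words s4 ELT ((j * n + v) * n + p)"
      using h5(3)[OF j vn(1) p(1)] vu p by (simp add: b2 upd2_def)
    also have "words s4 ELT = words s2 ELT"
      using same_words[OF h3(2)] same_words[OF h4(2)] by simp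
    also have "words s2 ELT ((j * n + v) * n + p) = words s1 ELT ((j * n + v) * n + p)"
      using h2(3)[OF j vn(1) p(1)] vu by simp
    also have "\<dots> = words s ELT ((j * n + v) * n + p)"
      using h1(3)[OF j vn(1) p(1)] p by auto
    finally show ?thesis .
  qed
qed

subsection \<open>The assignment\<close>

definition copies :: "nat \<Rightarrow> nat \<Rightarrow> nat" where
  "copies x d = (if d = 0 then 0 else d div k x + 1)"

definition owned :: "memory \<Rightarrow> nat set set \<Rightarrow> (nat set \<Rightarrow> nat) \<Rightarrow> bool" where
  "owned s E own \<longleftrightarrow> E \<subseteq> edges_on n \<and> (\<forall>e\<in>E. words s 4 (Min e * n + Max e) = own e \<and> own e < n) \<and>
    (\<forall>x<n. words s CNT x = card {e \<in> E. own e = x} \<and>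
      words s 3 x = copies x (card {e \<in> E. own e = x}))"

lemma owned_same: "same A s s' \<Longrightarrow> A \<inter> {3, 4, CNT} = {} \<Longrightarrow> owned s E own \<Longrightarrow> owned s' E own"
  by (auto simp: owned_def same_def)

lemma finite_edges_on: "finite (edges_on n)" "card (edges_on n) \<le> n ^ 2"
proof -
  have "edges_on n \<subseteq> (\<lambda>(x, y). {x, y}) ` ({..<n} \<times> {..<n})" by (auto simp: edges_on_def)
  then show "finite (edges_on n)" "card (edges_on n) \<le> n ^ 2"
    using surj_card_le[of "{..<n} \<times> {..<n}" "edges_on n" "\<lambda>(x, y). {x, y}"]
    by (auto intro: finite_subset simp: power2_eq_square)
qed

lemma card_edges_le:
  assumes "E \<subseteq> edges_on n" shows "finite E" "card {e \<in> E. P e} \<le> n ^ 2"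
proof -
  show "finite E" using assms finite_edges_on finite_subset by blast
  have "card {e \<in> E. P e} \<le> card (edges_on n)"
    using assms finite_edges_on by (intro card_mono) auto
  then show "card {e \<in> E. P e} \<le> n ^ 2" using finite_edges_on by simp
qed

definition edge_ix :: "nat set \<Rightarrow> nat" where "edge_ix e = Min e * n + Max e"

lemma edge_ix_inj:
  assumes "e \<in> edges_on n" "e' \<in> edges_on n" "edge_ix e = edge_ix e'" shows "e = e'"
proof -
  have *: "Max d < n \<and> d = {Min d, Max d}" if "d \<in> edges_on n" for d
    using that by (auto simp: edges_on_def)
  have "Min e = Min e' \<and> Max e = Max e'"
    using assms(3) *[OF assms(1)] *[OF assms(2)] by (simp add: edge_ix_def ix_inj)
  then show ?thesis using *[OF assms(1)] *[OF assms(2)] by metis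
qed

lemma set_ix:
  assumes st: "static s" and vn: "v < n" "u < n" "v \<noteq> u"
    and V: "words s VV 0 = v" and U: "words s UU 0 = u"
  shows "sem w set_ix s = set_word IX 0 (edge_ix {v, u}) s"
  using V U vn pair_bound[OF vn(1,2)] pair_bound[OF vn(2,1)]
  by (auto simp: set_ix_def staticD[OF st] edge_ix_def)

lemma set_copies:
  assumes st: "static s" and x: "words s OW 0 = x" "x < n" and d: "words s CNT x = d" "d \<le> n ^ 2"
  shows "sem w set_copies s = set_word 3 x (copies x d) s"
proof -
  have "d div k x \<le> d" by simp
  then have "d div k x \<le> n ^ 2" using d(2) by linarith
  then have "Suc (d div k x) < 2 ^ w" using poly_bounds(2) by linarith
  then show ?thesis using x d staticD(5)[OF st x(2), simplified] by (simp add: set_copies_def copies_def)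
qed

lemma drop_owner:
  assumes st: "static s" and ow: "owned s E own" and e: "{v, u} \<in> E"
    and V: "words s VV 0 = v" and U: "words s UU 0 = u"
  defines "s' \<equiv> sem w drop_owner s"
  shows "owned s' (E - {{v, u}}) own" "same {3, CNT, IX, OW} s s'"
proof -
  define x where "x = own {v, u}"
  define d where "d = card {e \<in> E. own e = x}"
  have E: "E \<subseteq> edges_on n" using ow by (simp add: owned_def)
  have vn: "v < n" "u < n" "v \<noteq> u" using e E by (auto simp: edges_on_def doubleton_eq_iff)
  have x: "x < n" "words s 4 (edge_ix {v, u}) = x"
    using ow e by (auto simp: owned_def x_def edge_ix_def)
  have d: "d > 0" "d \<le> n ^ 2"
    using e card_edges_le[OF E] by (auto simp: d_def card_gt_0_iff x_def)
  have cn: "words s CNT x = d" using ow x by (simp add: owned_def d_def)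
  have sub: "nat ((int d - 1) mod 2 ^ w) = d - 1"
    using word_diff[of 1 d w] d poly_bounds(2) by simp
  have card': "card {e \<in> E - {{v, u}}. own e = z} =
      (if z = x then d - 1 else card {e \<in> E. own e = z})" for z
  proof (cases "z = x")
    case True
    have "{e \<in> E - {{v, u}}. own e = x} = {e \<in> E. own e = x} - {{v, u}}" by auto
    then show ?thesis using e True card_edges_le(1)[OF E] by (simp add: d_def x_def)
  next
    case False
    then have "{e \<in> E - {{v, u}}. own e = z} = {e \<in> E. own e = z}" by (auto simp: x_def)
    then show ?thesis using False by simp
  qed
  define s1 where "s1 = set_word CNT x (d - 1) (set_word OW 0 x (set_word IX 0 (edge_ix {v, u}) s))"
  have "static s1" by (rule static_same[OF _ _ st, of "{CNT, OW, IX}"]) (auto simp: s1_def same_def)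
  then have c: "sem w set_copies s1 = set_word 3 x (copies x (d - 1)) s1"
    by (rule set_copies) (use x d in \<open>auto simp: s1_def\<close>)
  have s': "s' = set_word 3 x (copies x (d - 1)) s1"
    unfolding s'_def drop_owner_def c[symmetric]
    using small_lits(1) by (simp add: set_ix[OF st vn V U] s1_def x cn sub)
  show "same {3, CNT, IX, OW} s s'" by (auto simp: s' s1_def same_def)
  have "words s' CNT y = card {e \<in> E - {{v, u}}. own e = y} \<and>
      words s' 3 y = copies y (card {e \<in> E - {{v, u}}. own e = y})" if "y < n" for y
    using ow that unfolding card' by (auto simp: owned_def s' s1_def)
  moreover have "words s' 4 = words s 4" by (simp add: s' s1_def)
  ultimately show "owned s' (E - {{v, u}}) own"
    using ow unfolding owned_def by auto
qed

lemma gain_owner: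
  assumes st: "static s" and ow: "owned s E own" and e: "{v, u} \<notin> E" "{v, u} \<in> edges_on n"
    and V: "words s VV 0 = v" and U: "words s UU 0 = u" and Z: "words s Z 0 = x" "x < n" "Z < 25" "20 \<le> Z"
  defines "s' \<equiv> sem w (gain_owner Z) s"
  shows "owned s' (insert {v, u} E) (own({v, u} := x))" "same {3, 4, CNT, IX, OW} s s'"
proof -
  define d where "d = card {e \<in> E. own e = x}"
  have E: "insert {v, u} E \<subseteq> edges_on n" "E \<subseteq> edges_on n" using ow e by (auto simp: owned_def)
  have vn: "v < n" "u < n" "v \<noteq> u" using e by (auto simp: edges_on_def doubleton_eq_iff)
  let ?own = "own({v, u} := x)"
  have card': "card {e \<in> insert {v, u} E. ?own e = z} =
      (if z = x then Suc d else card {e \<in> E. own e = z})" for z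
  proof (cases "z = x")
    case True
    have "{e \<in> insert {v, u} E. ?own e = x} = insert {v, u} {e \<in> E. own e = x}" using e by auto
    then show ?thesis using e True card_edges_le(1)[OF E(2)] by (simp add: d_def)
  next
    case False
    then have "{e \<in> insert {v, u} E. ?own e = z} = {e \<in> E. own e = z}" using e by auto
    then show ?thesis using False by simp
  qed
  have d: "Suc d \<le> n ^ 2" using card_edges_le(2)[OF E(1), of "\<lambda>e. ?own e = x"] card'[of x] by simp
  have cn: "words s CNT x = d" using ow Z by (simp add: owned_def d_def)
  have dw: "Suc d < 2 ^ w" using d poly_bounds(2) by linarith
  define s1 where "s1 = set_word CNT x (Suc d) (set_word 4 (edge_ix {v, u}) x
     (set_word OW 0 x (set_word IX 0 (edge_ix {v, u}) s)))"
  have "static s1" by (rule static_same[OF _ _ st, of "{CNT, OW, IX, 4}"]) (auto simp: s1_def same_def)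
  then have c: "sem w set_copies s1 = set_word 3 x (copies x (Suc d)) s1"
    by (rule set_copies) (use Z d in \<open>auto simp: s1_def\<close>)
  have Zne: "Z \<noteq> IX" using Z by auto
  have s': "s' = set_word 3 x (copies x (Suc d)) s1"
    unfolding s'_def gain_owner_def c[symmetric]
    using dw Zne by (simp add: set_ix[OF st vn V U] s1_def Z cn)
  show "same {3, 4, CNT, IX, OW} s s'" by (auto simp: s' s1_def same_def)
  have "words s' 4 (Min e' * n + Max e') = ?own e' \<and> ?own e' < n" if e': "e' \<in> insert {v, u} E" for e'
  proof (cases "e' = {v, u}")
    case False
    then have "edge_ix e' \<noteq> edge_ix {v, u}" using edge_ix_inj E(1) e' by blast
    then show ?thesis using False ow e' by (auto simp: s' s1_def owned_def edge_ix_def)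
  qed (simp add: s' s1_def edge_ix_def Z)
  moreover have "words s' CNT y = card {e \<in> insert {v, u} E. ?own e = y} \<and>
      words s' 3 y = copies y (card {e \<in> insert {v, u} E. ?own e = y})" if "y < n" for y
    using ow that unfolding card' by (auto simp: owned_def s' s1_def)
  ultimately show "owned s' (insert {v, u} E) ?own"
    unfolding owned_def using E(1) by blast
qed

text \<open>Passing through the edge set without the edge adjusts the counts of the old and the new
  owner separately; nothing needs to be known about the old owner, not even that it differs from
  \<open>x\<close>.\<close>

lemma reassign:
  assumes st: "static s" and ow: "owned s E own" and e: "{v, u} \<in> E"
    and V: "words s VV 0 = v" and U: "words s UU 0 = u" and Z: "words s Z 0 = x" "x < n" "Z < 25" "20 \<le> Z"
  defines "s' \<equiv> sem w (gain_owner Z) (sem w drop_owner s)"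
  shows "owned s' E (own({v, u} := x))" "same {3, 4, CNT, IX, OW} s s'"
proof -
  define s1 where "s1 = sem w drop_owner s"
  note h1 = drop_owner[OF st ow e V U, folded s1_def]
  have st1: "static s1" by (rule static_same[OF h1(2) _ st]) auto
  have "Z \<noteq> 3" "Z \<noteq> CNT" "Z \<noteq> IX" "Z \<noteq> OW" using Z by auto
  then have V1: "words s1 VV 0 = v" "words s1 UU 0 = u" "words s1 Z 0 = x"
    using V U Z same_words[OF h1(2)] by simp_all
  have e': "{v, u} \<notin> E - {{v, u}}" "{v, u} \<in> edges_on n" using e ow by (auto simp: owned_def)
  note h2 = gain_owner[OF st1 h1(1) e' V1 Z(2-4), folded s'_def, unfolded s1_def, folded s'_def]
  have "insert {v, u} (E - {{v, u}}) = E" using e by auto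
  with h2(1) show "owned s' E (own({v, u} := x))" by simp
  show "same {3, 4, CNT, IX, OW} s s'"
    by (rule same_mono[OF same_trans[OF h1(2)[unfolded s1_def] h2(2)]]) auto
qed

subsection \<open>The vertices waiting to be repaired\<close>

text \<open>The flags keep the entries distinct, so that the stack represents a set and its height
  is at most \<open>n\<close>.\<close>

definition stack :: "memory \<Rightarrow> nat set \<Rightarrow> bool" where
  "stack s D \<longleftrightarrow> D \<subseteq> {..<n} \<and> words s SP 0 = card D \<and>
    (\<forall>x<n. words s FLAG x = (if x \<in> D then 1 else 0)) \<and> bij_betw (words s STK) {..<card D} D"

lemma stack_same: "same A s s' \<Longrightarrow> A \<inter> {SP, FLAG, STK} = {} \<Longrightarrow> stack s D \<Longrightarrow> stack s' D"
  by (auto simp: stack_def same_def)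

lemma stack_card: "stack s D \<Longrightarrow> card D \<le> n" "stack s D \<Longrightarrow> finite D"
  by (metis stack_def card_mono card_lessThan finite_lessThan)
    (metis stack_def finite_lessThan finite_subset)

lemma push:
  assumes sk: "stack s D" and X: "words s X 0 = x" "x < n" "20 \<le> X"
  defines "s' \<equiv> sem w (push X) s"
  shows "stack s' (insert x D)" "same {SP, FLAG, STK} s s'"
proof -
  have X': "X \<noteq> FLAG" "X \<noteq> STK" "X \<noteq> SP" using X by auto
  show "same {SP, FLAG, STK} s s'" by (auto simp: s'_def push_def same_def X)
  show "stack s' (insert x D)"
  proof (cases "x \<in> D")
    case True
    then show ?thesis using sk X by (auto simp: s'_def push_def stack_def insert_absorb)
  next
    case False
    note fin = stack_card(2)[OF sk]
    have c: "Suc (card D) < 2 ^ w"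
    proof -
      have "n + 1 \<le> n ^ 2 + 1" by (simp add: power2_eq_square)
      then show ?thesis using stack_card(1)[OF sk] poly_bounds(2) by linarith
    qed
    have s': "s' = set_word SP 0 (Suc (card D)) (set_word STK (card D) x (set_word FLAG x 1 s))"
      using False sk X X' c by (simp add: s'_def push_def stack_def)
    have "bij_betw (words s' STK) {..<card D} D"
      using sk by (subst bij_betw_cong[of _ _ "words s STK"]) (auto simp: s' stack_def)
    moreover have "words s' STK (card D) = x" by (simp add: s')
    ultimately have "bij_betw (words s' STK) (insert (card D) {..<card D}) (insert x D)"
      using False by (metis lessThan_iff notIn_Un_bij_betw less_irrefl insert_is_Un sup_commute)
    moreover have "insert (card D) {..<card D} = {..<card (insert x D)}"
      using False fin by (simp add: lessThan_Suc)
    ultimately show ?thesis using sk X False fin by (auto simp: stack_def s')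
  qed
qed

lemma stack_top:
  assumes "stack s D" "D \<noteq> {}"
  shows "words s STK (words s SP 0 - 1) \<in> D"
    "nat ((int (words s SP 0) - 1) mod 2 ^ w) = words s SP 0 - 1"
proof -
  have "card D > 0" using assms stack_card by (simp add: card_gt_0_iff)
  then show "words s STK (words s SP 0 - 1) \<in> D"
    using assms by (auto simp: stack_def bij_betw_def)
  show "nat ((int (words s SP 0) - 1) mod 2 ^ w) = words s SP 0 - 1"
    using word_diff[of 1 "words s SP 0" w] \<open>card D > 0\<close> stack_card(1)[OF assms(1)] n_bound assms(1)
    by (simp add: stack_def)
qed

lemma pop:
  assumes sk: "stack s D" and "D \<noteq> {}" and V: "words s VV 0 = words s STK (words s SP 0 - 1)"
  defines "s' \<equiv> sem w pop s"
  shows "stack s' (D - {words s VV 0})" "same {SP, FLAG} s s'"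
proof -
  note top = stack_top[OF sk assms(2)]
  note fin = stack_card(2)[OF sk]
  have c: "card D > 0" using assms(2) fin by (simp add: card_gt_0_iff)
  define v where "v = words s VV 0"
  have vD: "v \<in> D" using top(1) V by (simp add: v_def)
  have s': "s' = set_word FLAG v 0 (set_word SP 0 (card D - 1) s)"
    using small_lits(1) top(2) sk by (simp add: s'_def pop_def v_def stack_def)
  show "same {SP, FLAG} s s'" by (auto simp: s' same_def)
  have bij: "bij_betw (words s STK) {..<card D} D" "words s SP 0 = card D" using sk by (auto simp: stack_def)
  have "bij_betw (words s STK) ({..<card D} - {card D - 1}) (D - {v})"
    using c bij V by (intro bij_betw_DiffI) (auto simp: v_def bij_betw_def)
  moreover have "{..<card D} - {card D - 1} = {..<card (D - {v})}" using vD fin by auto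
  ultimately show "stack s' (D - {words s VV 0})"
    using sk vD fin unfolding v_def[symmetric] by (auto simp: stack_def s')
qed


section \<open>Approximation guarantee\<close>

definition arcs :: "nat set set \<Rightarrow> (nat \<times> nat) set" where
  "arcs E = {(x, y). {x, y} \<in> E}"

lemma arcs_iff [simp]: "(x, y) \<in> arcs E \<longleftrightarrow> {x, y} \<in> E"
  by (simp add: arcs_def)

lemma edge_ends:
  assumes "E \<subseteq> edges_on n" "{x, y} \<in> E" shows "x < n" "y < n" "x \<noteq> y"
  using assms by (auto simp: edges_on_def doubleton_eq_iff)

lemma arcs_subset: "E \<subseteq> edges_on n \<Longrightarrow> arcs E \<subseteq> {..<n} \<times> {..<n}"
  using edge_ends by (auto simp: arcs_def)

text \<open>
  The offset \<open>L + 1\<close> stands for all larger ones: it keeps \<open>b y x\<close> above \<open>L\<close>, so that \<open>y\<close> never owns the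
  edge and its load ignores it.
\<close>

definition offset :: "nat \<Rightarrow> nat \<Rightarrow> nat \<Rightarrow> nat \<Rightarrow> bool" where
  "offset x y i j \<longleftrightarrow> c x \<le> c y \<and> i \<le> j \<and> j \<le> i + L + 1 \<and> c x * 2 ^ (j - i) \<le> c y \<and>
     (j \<le> i + L \<longrightarrow> c y < c x * 2 ^ (j - i + 1))"

definition edge_inv ::
  "(nat \<Rightarrow> nat) \<Rightarrow> arc_levels \<Rightarrow> (nat set \<Rightarrow> nat) \<Rightarrow> nat \<Rightarrow> nat \<Rightarrow> bool" where
  "edge_inv lev b own x y \<longleftrightarrow> lev x \<le> b x y \<and> lev y \<le> b y x \<and>
     (own {x, y} = x \<and> b x y = lev x \<or> own {x, y} = y \<and> b y x = lev y) \<and>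
     (offset x y (b x y) (b y x) \<or> offset y x (b y x) (b x y))"

lemma edge_inv_sym: "edge_inv lev b own x y \<longleftrightarrow> edge_inv lev b own y x"
  by (auto simp: edge_inv_def insert_commute)

text \<open>\<open>2 ^ lev x \<le> k x\<close> bounds the share \<open>c x / k x\<close> of an edge
  in a copy by its price at \<open>x\<close>; \<open>lev x \<le> L\<close> keeps owned edges in the
  range where that price is at most twice the dual variable.\<close>

definition config ::
  "nat set set \<Rightarrow> arc_levels \<Rightarrow> (nat \<Rightarrow> nat) \<Rightarrow> (nat set \<Rightarrow> nat) \<Rightarrow> bool" where
  "config E b lev own \<longleftrightarrow> E \<subseteq> edges_on n \<and> (\<forall>x y. {x, y} \<in> E \<longrightarrow> edge_inv lev b own x y) \<and>
     (\<forall>x<n. 2 ^ lev x \<le> k x \<and> lev x \<le> L)"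

definition heavy :: "(nat \<times> nat) set \<Rightarrow> arc_levels \<Rightarrow> (nat \<Rightarrow> nat) \<Rightarrow> nat \<Rightarrow> bool" where
  "heavy H b lev x \<longleftrightarrow> 2 * 2 ^ L < load H b x \<and> 2 * 2 ^ lev x \<le> k x"

text \<open>The threshold is far below 1 on purpose: a raise starts from a load above 2 and at most
  halves it, so at least 1 is left and 3/4 must be lost before the vertex is lowered again, while
  the edges then in its bucket weigh less than 1/4.\<close>

definition light :: "(nat \<times> nat) set \<Rightarrow> arc_levels \<Rightarrow> (nat \<Rightarrow> nat) \<Rightarrow> nat \<Rightarrow> bool" where
  "light H b lev x \<longleftrightarrow> 4 * load H b x < 2 ^ L \<and> 0 < lev x"

lemma edge_other:
  assumes "E \<subseteq> edges_on n" "e \<in> E" "v \<in> e"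
  obtains y where "e = {v, y}" "{v, y} \<in> E"
proof -
  obtain p q where pq: "e = {p, q}" using assms by (auto simp: edges_on_def)
  show ?thesis
  proof (cases "v = p")
    case True
    then show ?thesis using pq assms that[of q] by simp
  next
    case False
    then have "e = {v, p}" using pq assms(3) by auto
    then show ?thesis using assms(2) that[of p] by simp
  qed
qed

abbreviation stable :: "(nat \<times> nat) set \<Rightarrow> arc_levels \<Rightarrow> (nat \<Rightarrow> nat) \<Rightarrow> nat \<Rightarrow> bool" where
  "stable H b lev x \<equiv> \<not> heavy H b lev x \<and> \<not> light H b lev x"

lemma sum_incident:
  fixes f :: "nat set \<Rightarrow> real"
  assumes "E \<subseteq> edges_on n"
  shows "(\<Sum>e | e \<in> E \<and> v \<in> e. f e) = (\<Sum>y\<in>arcs E `` {v}. f {v, y})"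
proof -
  have "bij_betw (\<lambda>y. {v, y}) (arcs E `` {v}) {e. e \<in> E \<and> v \<in> e}"
  proof (rule bij_betw_imageI)
    show "inj_on (\<lambda>y. {v, y}) (arcs E `` {v})" by (auto simp: inj_on_def doubleton_eq_iff)
    show "(\<lambda>y. {v, y}) ` (arcs E `` {v}) = {e. e \<in> E \<and> v \<in> e}"
    proof (intro equalityI subsetI)
      fix e assume "e \<in> {e. e \<in> E \<and> v \<in> e}"
      then obtain y where "e = {v, y}" "{v, y} \<in> E" using edge_other[OF assms] by blast
      then show "e \<in> (\<lambda>y. {v, y}) ` (arcs E `` {v})" by auto
    qed auto
  qed
  from sum.reindex_bij_betw[OF this, of f] show ?thesis by simp
qed

lemma sum_incident_vertices:
  fixes f :: "nat set \<Rightarrow> real"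
  assumes E: "E \<subseteq> edges_on n"
  shows "(\<Sum>v<n. \<Sum>e | e \<in> E \<and> v \<in> e. f e) = 2 * (\<Sum>e\<in>E. f e)"
proof -
  have "(\<Sum>v<n. \<Sum>e | e \<in> E \<and> v \<in> e. f e) = (\<Sum>e\<in>E. \<Sum>v | v \<in> {..<n} \<and> v \<in> e. f e)"
    using card_edges_le(1)[OF E] by (intro sum.swap_restrict) auto
  also have "\<dots> = (\<Sum>e\<in>E. 2 * f e)"
  proof (rule sum.cong)
    fix e assume "e \<in> E"
    then obtain a d where e: "e = {a, d}" "a < n" "d < n" "a \<noteq> d" using E by (auto simp: edges_on_def)
    then have "{v. v \<in> {..<n} \<and> v \<in> e} = {a, d}" by auto
    then show "(\<Sum>v | v \<in> {..<n} \<and> v \<in> e. f e) = 2 * f e" using e by simp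
  qed simp
  finally show ?thesis by (simp add: sum_distrib_left)
qed

text \<open>The sum is grouped by the endpoint to which the given cover assigns each edge. A vertex
  with an assigned edge has at least one copy, so a bounded total suffices; in the other alternative
  each of its at most \<open>k v * x v\<close> edges contributes at most
  \<open>\<gamma> * c v / k v\<close>.\<close>

lemma weak_duality:
  fixes \<pi> :: "nat set \<Rightarrow> real"
  assumes E: "E \<subseteq> edges_on n" and cov: "cap_vertex_cover n k E x a"
    and dual: "\<And>v. v < n \<Longrightarrow> (\<Sum>e | e \<in> E \<and> v \<in> e. \<pi> e) \<le> \<gamma> * c v \<or>
      (\<forall>e\<in>E. v \<in> e \<longrightarrow> \<pi> e * k v \<le> \<gamma> * c v)"
    and nonneg: "\<And>e. e \<in> E \<Longrightarrow> 0 \<le> \<pi> e" and \<gamma>: "0 \<le> \<gamma>"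
  shows "(\<Sum>e\<in>E. \<pi> e) \<le> \<gamma> * cover_cost n c x"
proof -
  have fin: "finite E" by (rule card_edges_le(1)[OF E])
  have a: "a e \<in> e" if "e \<in> E" for e
    using cov that by (simp add: cap_vertex_cover_def)
  have "a ` E \<subseteq> {..<n}" using a E by (fastforce simp: edges_on_def)
  note a = a this
  have "(\<Sum>e\<in>E. \<pi> e) = (\<Sum>v<n. \<Sum>e | e \<in> E \<and> a e = v. \<pi> e)"
    using a by (intro sum.group[symmetric] fin) auto
  also have "\<dots> \<le> (\<Sum>v<n. \<gamma> * (c v * real (x v)))"
  proof (rule sum_mono)
    fix v assume "v \<in> {..<n}"
    then have v: "v < n" by simp
    let ?A = "{e \<in> E. a e = v}"
    have le: "card ?A \<le> k v * x v" using cov v by (auto simp: cap_vertex_cover_def)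
    have cv: "0 \<le> \<gamma> * c v" using c_pos[OF v] \<gamma> by simp
    show "(\<Sum>e | e \<in> E \<and> a e = v. \<pi> e) \<le> \<gamma> * (c v * real (x v))"
    proof (cases "?A = {}")
      case True
      show ?thesis unfolding True using cv by (simp add: mult.assoc[symmetric])
    next
      case False
      then have "card ?A > 0" using fin by (simp add: card_gt_0_iff)
      then have x1: "1 \<le> real (x v)" using le by (cases "x v") auto
      from dual[OF v] show ?thesis
      proof
        assume *: "(\<Sum>e | e \<in> E \<and> v \<in> e. \<pi> e) \<le> \<gamma> * c v"
        have "(\<Sum>e | e \<in> E \<and> a e = v. \<pi> e) \<le> (\<Sum>e | e \<in> E \<and> v \<in> e. \<pi> e)"
          using fin a nonneg by (intro sum_mono2) auto
        also note *
        also have "\<gamma> * c v \<le> \<gamma> * c v * real (x v)" using mult_left_mono[OF x1 cv] by simp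
        finally show ?thesis by (simp add: mult.assoc)
      next
        assume *: "\<forall>e\<in>E. v \<in> e \<longrightarrow> \<pi> e * k v \<le> \<gamma> * c v"
        have kv: "0 < real (k v)" using k_pos[OF v] by simp
        have "(\<Sum>e | e \<in> E \<and> a e = v. \<pi> e) \<le> (\<Sum>e | e \<in> E \<and> a e = v. \<gamma> * c v / k v)"
          using * a kv by (intro sum_mono) (auto simp: field_simps)
        also have "\<dots> = real (card ?A) * (\<gamma> * c v / k v)" by simp
        also have "\<dots> \<le> real (k v * x v) * (\<gamma> * c v / k v)"
          using le cv kv by (intro mult_right_mono) (simp_all only: of_nat_le_iff divide_nonneg_pos)
        also have "\<dots> = \<gamma> * (c v * real (x v))" using kv by simp
        finally show ?thesis .
      qed
    qed
  qed
  also have "\<dots> = \<gamma> * cover_cost n c x" by (simp add: cover_cost_def sum_distrib_left)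
  finally show ?thesis .
qed

section \<open>Edge prices, dual constraints and the cost of a stable configuration\<close>

definition price :: "arc_levels \<Rightarrow> nat \<Rightarrow> nat \<Rightarrow> real" where
  "price b x y = c x / 2 ^ b x y"

definition dual :: "arc_levels \<Rightarrow> nat set \<Rightarrow> real" where
  "dual b e = min (price b (Min e) (Max e)) (price b (Max e) (Min e))"

lemma dual_edge: "dual b {x, y} = min (price b x y) (price b y x)"
  by (cases "x \<le> y") (auto simp: dual_def min_def max_def)

lemma T_real: "real (T j) / 2 ^ L = (if j \<le> L then 1 / 2 ^ j else 0)"
  by (auto simp: T_le T_gt field_simps power_add[symmetric])

text \<open>The truncated offset \<open>L + 1\<close> carries no upper bound on \<open>c y\<close>;
  it puts \<open>b y x\<close> above \<open>L\<close>, so the premise of the second claim rules it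
  out.\<close>

lemma offset_price:
  assumes "offset x y (b x y) (b y x)" "x < n"
  shows "price b x y \<le> price b y x" "b y x \<le> L \<Longrightarrow> price b y x \<le> 2 * price b x y"
proof -
  define d where "d = b y x - b x y"
  have byx: "b y x = b x y + d" using assms by (simp add: d_def offset_def)
  have "c x * 2 ^ d \<le> c y" using assms by (simp add: d_def offset_def)
  then show "price b x y \<le> price b y x"
    by (simp add: price_def byx power_add field_simps)
  show "price b y x \<le> 2 * price b x y" if "b y x \<le> L"
  proof -
    have "c y < c x * 2 ^ (d + 1)" using assms that by (simp add: d_def offset_def)
    then show ?thesis by (simp add: price_def byx power_add field_simps)
  qed
qed

lemma price_pos: "x < n \<Longrightarrow> 0 < price b x y"
  using c_pos by (simp add: price_def)

context
  fixes E b lev own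
  assumes conf: "config E b lev own"
    and stable: "\<And>x. x < n \<Longrightarrow> stable (arcs E) b lev x"
begin

lemma conf_E: "E \<subseteq> edges_on n"
  using conf by (simp add: config_def)

lemma conf_inv: "{x, y} \<in> E \<Longrightarrow> edge_inv lev b own x y"
  using conf by (simp add: config_def)

lemma conf_lev: "x < n \<Longrightarrow> 2 ^ lev x \<le> k x"
  using conf by (simp add: config_def)

lemma price_cases:
  assumes "{x, y} \<in> E"
  shows "price b x y \<le> price b y x \<and> (b y x \<le> L \<longrightarrow> price b y x \<le> 2 * price b x y) \<or>
    price b y x \<le> price b x y \<and> (b x y \<le> L \<longrightarrow> price b x y \<le> 2 * price b y x)"
  using conf_inv[OF assms] edge_ends[OF conf_E assms] offset_price[of x y b] offset_price[of y x b]
  by (auto simp: edge_inv_def)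

lemma price_le_dual:
  assumes "{x, y} \<in> E" "b x y \<le> L"
  shows "price b x y \<le> 2 * dual b {x, y}"
  using price_cases[OF assms(1)] assms(2) price_pos[of x b y] price_pos[of y b x]
    edge_ends[OF conf_E assms(1)] by (auto simp: dual_edge min_def)

lemma dual_nonneg: "e \<in> E \<Longrightarrow> 0 \<le> dual b e"
  using conf_E price_pos[of _ b] by (auto simp: edges_on_def dual_edge less_imp_le)

definition charge :: "nat \<Rightarrow> nat \<Rightarrow> real" where
  "charge x y = c x * real (T (b x y)) / 2 ^ L"

lemma charge_eq: "charge x y = (if b x y \<le> L then price b x y else 0)"
  unfolding charge_def times_divide_eq_right[symmetric] T_real by (simp add: price_def)

text \<open>The smaller of the two prices is the dual variable. The other is at most twice as large,
  unless its level is above \<open>L\<close>, where its charge is 0; hence 1 + 2.\<close>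

lemma charge_le: "{x, y} \<in> E \<Longrightarrow> charge x y + charge y x \<le> 3 * dual b {x, y}"
  using price_cases[of x y] price_pos[of x b y] price_pos[of y b x] edge_ends[OF conf_E, of x y]
  by (auto simp: charge_eq dual_edge min_def)

lemma sum_charge: "(\<Sum>y\<in>arcs E `` {x}. charge x y) = c x * real (load (arcs E) b x) / 2 ^ L"
  by (simp add: charge_def load_def sum_distrib_left sum_divide_distrib)

lemma finite_nbrs: "finite (arcs E `` {x})"
  by (rule finite_subset[of _ "{..<n}"]) (use arcs_subset[OF conf_E] in auto)

text \<open>Only pairs of opposite arcs can be bounded, so the sum over all arcs is symmetrised
  first; every edge is then counted twice on both sides.\<close>

lemma total_charge: "(\<Sum>x<n. c x * real (load (arcs E) b x) / 2 ^ L) \<le> 3 * (\<Sum>e\<in>E. dual b e)"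
proof -
  have Sig: "arcs E = Sigma {..<n} (\<lambda>x. arcs E `` {x})"
    using arcs_subset[OF conf_E] by auto
  have tot: "(\<Sum>x<n. \<Sum>y\<in>arcs E `` {x}. f x y) = (\<Sum>(x, y)\<in>arcs E. f x y)" for f :: "nat \<Rightarrow> nat \<Rightarrow> real"
    by (subst (2) Sig, rule sum.Sigma) (use finite_nbrs in auto)
  have swap: "(\<Sum>(x, y)\<in>arcs E. charge x y) = (\<Sum>(x, y)\<in>arcs E. charge y x)"
    by (rule sum.reindex_bij_witness[of _ prod.swap prod.swap]) (auto simp: insert_commute)
  have "2 * (\<Sum>(x, y)\<in>arcs E. charge x y) = (\<Sum>(x, y)\<in>arcs E. charge x y + charge y x)"
    using swap by (simp add: sum.distrib case_prod_beta)
  also have "\<dots> \<le> (\<Sum>(x, y)\<in>arcs E. 3 * dual b {x, y})"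
    by (rule sum_mono) (use charge_le in auto)
  also have "\<dots> = (\<Sum>x<n. \<Sum>y\<in>arcs E `` {x}. 3 * dual b {x, y})" by (rule tot[symmetric])
  also have "\<dots> = (\<Sum>x<n. \<Sum>e | e \<in> E \<and> x \<in> e. 3 * dual b e)"
    by (simp add: sum_incident[OF conf_E])
  also have "\<dots> = 2 * (\<Sum>e\<in>E. 3 * dual b e)" by (rule sum_incident_vertices[OF conf_E])
  also have "\<dots> = 6 * (\<Sum>e\<in>E. dual b e)" by (simp add: sum_distrib_left[symmetric])
  finally show ?thesis unfolding tot[symmetric] sum_charge by simp
qed

lemma dual_feasible:
  assumes v: "v < n"
  shows "(\<Sum>e | e \<in> E \<and> v \<in> e. dual b e) \<le> 5 / 2 * c v \<or>
    (\<forall>e\<in>E. v \<in> e \<longrightarrow> dual b e * k v \<le> 5 / 2 * c v)"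
proof (cases "load (arcs E) b v \<le> 2 * 2 ^ L")
  case True
  have "(\<Sum>e | e \<in> E \<and> v \<in> e. dual b e) = (\<Sum>y\<in>arcs E `` {v}. dual b {v, y})"
    by (rule sum_incident[OF conf_E])
  \<comment> \<open>Above level \<open>L\<close> an arc has charge 0 but still a price of at most
    \<open>c v / 2 ^ (L + 1)\<close>. There are at most \<open>n \<le> 2 ^ L\<close> arcs, so this
    adds at most \<open>c v / 2\<close> to the \<open>2 * c v\<close> that come from the
    load.\<close>
  also have "\<dots> \<le> (\<Sum>y\<in>arcs E `` {v}. charge v y + c v / 2 ^ (L + 1))"
  proof (rule sum_mono)
    fix y
    have "dual b {v, y} \<le> price b v y" by (simp add: dual_edge)
    also have "\<dots> \<le> charge v y + c v / 2 ^ (L + 1)"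
    proof (cases "b v y \<le> L")
      case False
      then have "(2::real) ^ (L + 1) \<le> 2 ^ b v y" by (intro power_increasing) auto
      then have "c v / 2 ^ b v y \<le> c v / 2 ^ (L + 1)"
        using c_pos[OF v] by (intro divide_left_mono) auto
      with False show ?thesis by (simp add: charge_eq price_def)
    qed (use c_pos[OF v] in \<open>simp add: charge_eq\<close>)
    finally show "dual b {v, y} \<le> charge v y + c v / 2 ^ (L + 1)" .
  qed
  also have "\<dots> = c v * (real (load (arcs E) b v) / 2 ^ L) + real (card (arcs E `` {v})) * (c v / 2 ^ (L + 1))"
    by (simp add: sum.distrib sum_charge)
  also have "\<dots> \<le> c v * 2 + 2 ^ L * (c v / 2 ^ (L + 1))"
  proof (rule add_mono)
    have "real (load (arcs E) b v) \<le> real (2 * 2 ^ L)" using True by (simp only: of_nat_le_iff)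
    then show "c v * (real (load (arcs E) b v) / 2 ^ L) \<le> c v * 2"
      using c_pos[OF v] by (intro mult_left_mono) (auto simp: field_simps)
    have "arcs E `` {v} \<subseteq> {..<n}" using arcs_subset[OF conf_E] by auto
    then have "card (arcs E `` {v}) \<le> n" by (metis card_mono card_lessThan finite_lessThan)
    then have "card (arcs E `` {v}) \<le> 2 ^ L" using L_lower by linarith
    then have "real (card (arcs E `` {v})) \<le> real (2 ^ L)" by (simp only: of_nat_le_iff)
    then show "real (card (arcs E `` {v})) * (c v / 2 ^ (L + 1)) \<le> 2 ^ L * (c v / 2 ^ (L + 1))"
      using c_pos[OF v] by (intro mult_right_mono) auto
  qed
  also have "\<dots> = 5 / 2 * c v" by simp
  finally show ?thesis by blast
next
  case False
  \<comment> \<open>The load alone would call for a raise, so it is the capacity that forbids it.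
    All prices at \<open>v\<close> being at most \<open>c v / 2 ^ lev v\<close>, a total of
    \<open>k v\<close> of them stays below \<open>2 * c v\<close>.\<close>
  then have "k v < 2 * 2 ^ lev v" using stable[OF v] by (auto simp: heavy_def)
  then have "real (k v) \<le> real (2 * 2 ^ lev v)" by (simp only: of_nat_le_iff less_imp_le)
  then have kv: "real (k v) \<le> 2 * 2 ^ lev v" by simp
  have "dual b e * k v \<le> 5 / 2 * c v" if "e \<in> E" "v \<in> e" for e
  proof -
    obtain y where e: "e = {v, y}" "{v, y} \<in> E" using edge_other[OF conf_E \<open>e \<in> E\<close> \<open>v \<in> e\<close>] by blast
    have "lev v \<le> b v y" using conf_inv[OF e(2)] by (simp add: edge_inv_def)
    then have "(2::real) ^ lev v \<le> 2 ^ b v y" by (intro power_increasing) auto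
    then have "real (k v) \<le> 2 * 2 ^ b v y" using kv by linarith
    then have "price b v y * k v \<le> price b v y * (2 * 2 ^ b v y)"
      using price_pos[OF v] by (intro mult_left_mono) (auto simp: less_imp_le)
    also have "\<dots> = 2 * c v" by (simp add: price_def)
    finally have "price b v y * k v \<le> 2 * c v" .
    moreover have "dual b e * k v \<le> price b v y * k v"
      unfolding e by (intro mult_right_mono) (simp_all add: dual_edge)
    ultimately show ?thesis using c_pos[OF v] by linarith
  qed
  then show ?thesis by blast
qed

lemma own_in: "e \<in> E \<Longrightarrow> own e \<in> e"
  using conf_E conf_inv by (auto simp: edges_on_def edge_inv_def)

text \<open>An owned edge is on the level of its owner. This level is at most \<open>L\<close>, so
  the price is within a factor 2 of the dual variable, and \<open>2 ^ lev v \<le> k v\<close>, so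
  the price is at least \<open>c v / k v\<close>.\<close>

lemma owner_price:
  assumes "e \<in> E" "own e = v" shows "c v / k v \<le> 2 * dual b e"
    "\<exists>y. {v, y} \<in> E \<and> b v y = lev v"
proof -
  obtain y where e: "e = {v, y}"
    using edge_other[OF conf_E assms(1) own_in[OF assms(1)]] assms(2) by metis
  have vy: "{v, y} \<in> E" "v < n" "v \<noteq> y" using assms e edge_ends[OF conf_E, of v y] by auto
  have b: "b v y = lev v"
    using conf_inv[OF vy(1)] assms e vy(3) by (auto simp: edge_inv_def)
  then show "\<exists>y. {v, y} \<in> E \<and> b v y = lev v" using vy by blast
  have "lev v \<le> L" using conf vy by (auto simp: config_def)
  then have "price b v y \<le> 2 * dual b e" using price_le_dual[OF vy(1)] b e by simp
  moreover have "real (2 ^ lev v) \<le> real (k v)" using conf_lev[OF vy(2)] by (simp only: of_nat_le_iff)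
  then have "c v / k v \<le> price b v y"
    unfolding price_def b using c_pos[OF vy(2)] k_pos[OF vy(2)] by (intro divide_left_mono) auto
  ultimately show "c v / k v \<le> 2 * dual b e" by linarith
qed

text \<open>On a positive level a stable vertex is not light; on level 0 the owned edge alone has
  the weight \<open>T 0 = 2 ^ L\<close>.\<close>

lemma owner_load:
  assumes v: "v < n" and "e \<in> E" "own e = v" shows "2 ^ L \<le> 4 * load (arcs E) b v"
proof (cases "lev v = 0")
  case False
  then show ?thesis using stable[OF v] by (auto simp: light_def)
next
  case True
  obtain y where y: "{v, y} \<in> E" "b v y = 0" using owner_price(2)[OF assms(2,3)] True by auto
  have "T (b v y) \<le> load (arcs E) b v"
    unfolding load_def using y finite_nbrs by (intro member_le_sum) auto
  then show ?thesis by (simp add: y T_0)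
qed

lemma constant_ratio:
  assumes x: "\<And>v. v < n \<Longrightarrow> x v = copies v (card {e \<in> E. a e = v})" and a: "\<And>e. e \<in> E \<Longrightarrow> a e = own e"
  shows "cap_vertex_cover n k E x a" "cover_cost n c x \<le> 35 * min_cover_cost n c k E"
proof -
  have aown: "{e \<in> E. a e = v} = {e \<in> E. own e = v}" for v using a by auto
  have fin: "finite E" by (rule card_edges_le(1)[OF conf_E])
  show "cap_vertex_cover n k E x a"
    unfolding cap_vertex_cover_def
  proof (intro conjI ballI allI impI)
    fix v assume v: "v < n"
    define d where "d = card {e \<in> E. a e = v}"
    have "d = k v * (d div k v) + d mod k v" by simp
    moreover have "d mod k v < k v" using k_pos[OF v] by simp
    ultimately have "d \<le> k v * (d div k v) + k v" by linarith
    then have "d \<le> k v * (d div k v + 1)" by simp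
    then show "card {e \<in> E. a e = v} \<le> k v * x v"
      unfolding x[OF v] by (auto simp: copies_def d_def)
  qed (use a own_in in auto)
  have "cover_cost n c x \<le> (\<Sum>v<n. 4 * (c v * real (load (arcs E) b v) / 2 ^ L) +
      (\<Sum>e | e \<in> E \<and> own e = v. 2 * dual b e))"
    unfolding cover_cost_def
  proof (rule sum_mono)
    fix v assume "v \<in> {..<n}"
    then have v: "v < n" by simp
    let ?A = "{e \<in> E. own e = v}"
    have cv: "0 < c v" "0 < real (k v)" using c_pos[OF v] k_pos[OF v] by auto
    show "c v * real (x v) \<le> 4 * (c v * real (load (arcs E) b v) / 2 ^ L) +
      (\<Sum>e | e \<in> E \<and> own e = v. 2 * dual b e)"
    proof (cases "?A = {}")
      case True
      have "card ?A = 0" unfolding True by simp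
      then have "x v = 0" using x[OF v] by (simp add: aown copies_def)
      moreover have "(\<Sum>e | e \<in> E \<and> own e = v. 2 * dual b e) = 0" unfolding True by simp
      ultimately show ?thesis using cv by simp
    next
      case False
      then obtain e where e: "e \<in> E" "own e = v" by auto
      have "real (2 ^ L) \<le> real (4 * load (arcs E) b v)" using owner_load[OF v e] by (simp only: of_nat_le_iff)
      then have ld: "c v * 1 \<le> c v * (4 * real (load (arcs E) b v) / 2 ^ L)"
        using cv by (intro mult_left_mono) (auto simp: field_simps)
      have "real (card ?A div k v) \<le> real (card ?A) / real (k v)" by (rule of_nat_div_le_of_nat)
      then have "real (x v) \<le> 1 + real (card ?A) / k v"
        using x[OF v] by (simp add: aown copies_def)
      then have "c v * real (x v) \<le> c v * (1 + real (card ?A) / k v)"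
        using cv by (intro mult_left_mono) auto
      also have "\<dots> = c v + (\<Sum>e | e \<in> E \<and> own e = v. c v / k v)" by (simp add: algebra_simps)
      also have "\<dots> \<le> c v + (\<Sum>e | e \<in> E \<and> own e = v. 2 * dual b e)"
        by (intro add_left_mono sum_mono) (use owner_price(1) in auto)
      finally show ?thesis using ld by (simp add: mult.left_commute)
    qed
  qed
  also have "\<dots> = 4 * (\<Sum>v<n. c v * real (load (arcs E) b v) / 2 ^ L) +
      (\<Sum>v<n. \<Sum>e | e \<in> E \<and> own e = v. 2 * dual b e)"
    by (simp only: sum.distrib sum_distrib_left)
  also have "(\<Sum>v<n. \<Sum>e | e \<in> E \<and> own e = v. 2 * dual b e) = (\<Sum>e\<in>E. 2 * dual b e)"
  proof (rule sum.group[OF fin])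
    show "own ` E \<subseteq> {..<n}" using own_in conf_E by (fastforce simp: edges_on_def)
  qed simp
  \<comment> \<open>\<open>4 * 3\<close> for opening the owners, by \<open>total_charge\<close>, and
    2 for the shares in their copies. Multiplied by the 5/2 of the dual constraints, 14 becomes
    35.\<close>
  also have "4 * (\<Sum>v<n. c v * real (load (arcs E) b v) / 2 ^ L) + (\<Sum>e\<in>E. 2 * dual b e)
      \<le> 14 * (\<Sum>e\<in>E. dual b e)"
    using total_charge by (simp only: sum_distrib_left[symmetric])
  finally have upper: "cover_cost n c x \<le> 14 * (\<Sum>e\<in>E. dual b e)" .
  obtain x' a' where opt: "cap_vertex_cover n k E x' a'" "cover_cost n c x' = min_cover_cost n c k E"
    using min_cover_cost_attained[OF conf_E, of k c] k_pos c_pos by blast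
  have "(\<Sum>e\<in>E. dual b e) \<le> 5 / 2 * cover_cost n c x'"
    by (rule weak_duality[OF conf_E opt(1) dual_feasible dual_nonneg]) auto
  with upper opt show "cover_cost n c x \<le> 35 * min_cover_cost n c k E" by simp
qed

end

section \<open>The potential\<close>

text \<open>The load that is missing to a full \<open>2 ^ L\<close>, in units of \<open>T i\<close>.
  Arcs at a vertex of level \<open>i\<close> are on level \<open>i\<close> or higher, so none weighs
  more than a unit and losing one costs at most 1. On level 0 nothing can be lowered and nothing has
  to be saved up.\<close>

definition deficit :: "nat \<Rightarrow> nat \<Rightarrow> real" where
  "deficit i d = (if i = 0 then 0 else max 0 (2 ^ L - real d) / real (T i))"

lemma deficit_nonneg: "0 \<le> deficit i d"
  by (simp add: deficit_def)

lemma deficit_mono: "d \<le> d' \<Longrightarrow> deficit i d' \<le> deficit i d"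
  by (auto simp: deficit_def intro!: divide_right_mono)

lemma deficit_drop:
  assumes "d \<le> d' + T i" "i \<le> L" shows "deficit i d' \<le> deficit i d + 1"
proof -
  have t: "0 < real (T i)" using assms by (simp add: T_le)
  have "real d \<le> real d' + real (T i)" using assms(1) by linarith
  then have "max 0 (2 ^ L - real d') \<le> max 0 (2 ^ L - real d) + real (T i)" by linarith
  then have "max 0 (2 ^ L - real d') / T i \<le> (max 0 (2 ^ L - real d) + T i) / T i"
    using t by (intro divide_right_mono) auto
  then show ?thesis using t by (auto simp: deficit_def add_divide_distrib)
qed

text \<open>In units of \<open>T i\<close> let \<open>P = 2 ^ i\<close> and let \<open>q\<close> be
  the load. The unit doubles, so the deficit falls from \<open>P - q\<close> to at most half of
  that, or to 0 on level 0. The weight 16 then releases at least \<open>8 * (P - q)\<close>, and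
  this is at least \<open>20 * q + 2\<close> because \<open>4 * q < P\<close> and
  \<open>2 \<le> P\<close>; finally \<open>m \<le> q\<close>. The 20 is the cost of moving one edge
  down: 18 for two levels, one push and one round.\<close>

lemma deficit_lower:
  assumes "4 * d < 2 ^ L" "d \<le> d'" "0 < i" "i \<le> L" "m * T i \<le> d"
  shows "16 * deficit (i - 1) d' + 20 * real m + 2 \<le> 16 * deficit i d"
proof -
  define t where "t = real (T i)"
  have t: "0 < t" "2 ^ L = t * 2 ^ i" using assms(4) by (simp_all add: T_le t_def power_add[symmetric])
  have "L - (i - 1) = Suc (L - i)" using assms(3,4) by simp
  then have t': "real (T (i - 1)) = 2 * t" using assms(3,4) by (simp add: T_le t_def)
  define q where "q = real d / t"
  have d: "real d = q * t" using t by (simp add: q_def)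
  have "real (4 * d) < real (2 ^ L)" using assms(1) by (simp only: of_nat_less_iff)
  then have "4 * real d < 2 ^ L" by simp
  then have "(4 * q) * t < 2 ^ i * t" by (simp add: d t mult.commute mult.left_commute)
  then have q: "4 * q < 2 ^ i" using t by (simp only: mult_less_cancel_right_pos)
  have q0: "0 \<le> q" using t by (simp add: q_def)
  have "real m * t \<le> real d" using assms(5) unfolding t_def by (metis of_nat_le_iff of_nat_mult)
  then have m: "real m \<le> q" using t by (simp add: d)
  have i2: "(2::real) \<le> 2 ^ i" using assms(3) self_le_power[of "2::real" i] by simp
  have "max 0 (2 ^ L - real d) = (2 ^ i - q) * t"
    using q q0 t by (simp add: d algebra_simps max_def)
  then have 1: "deficit i d = 2 ^ i - q" using assms(3) t by (simp add: deficit_def t_def[symmetric])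
  have "deficit (i - 1) d' \<le> deficit (i - 1) d" by (rule deficit_mono) fact
  also have "\<dots> \<le> (2 ^ i - q) / 2"
  proof (cases "i - 1 = 0")
    case False
    then show ?thesis unfolding deficit_def using \<open>max 0 _ = _\<close> t using t' by simp
  qed (use q q0 in \<open>simp add: deficit_def\<close>)
  finally have 2: "deficit (i - 1) d' \<le> (2 ^ i - q) / 2" .
  define P D where "P = (2::real) ^ i" and "D = deficit (i - 1) d'"
  have "2 * D \<le> P - q" "4 * q < P" "2 \<le> P" using 2 q i2 by (simp_all add: P_def D_def)
  then have "16 * D + 20 * real m + 2 \<le> 16 * (P - q)" using m by (simp add: algebra_simps)
  then show ?thesis using 1 by (simp add: P_def D_def)
qed

text \<open>The number of levels that the arcs can still climb. An insertion adds at most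
  \<open>2 * J\<close> to it, the main source of the logarithm in the update time.\<close>

definition mass :: "(nat \<times> nat) set \<Rightarrow> arc_levels \<Rightarrow> real" where
  "mass H b = (\<Sum>(x, y)\<in>H. real J - real (b x y))"

definition deficits :: "(nat \<times> nat) set \<Rightarrow> arc_levels \<Rightarrow> (nat \<Rightarrow> nat) \<Rightarrow> nat set \<Rightarrow> real" where
  "deficits H b lev V = (\<Sum>x\<in>V. deficit (lev x) (load H b x))"

lemma deficits_cong:
  "(\<And>x. x \<in> V \<Longrightarrow> load H b x = load H' b' x \<and> lev x = lev' x) \<Longrightarrow>
    deficits H b lev V = deficits H' b' lev' V"
  unfolding deficits_def by (intro sum.cong) auto

lemma deficits_mono:
  "(\<And>x. x \<in> V \<Longrightarrow> load H b x \<le> load H' b' x) \<Longrightarrow> deficits H' b' lev V \<le> deficits H b lev V"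
  unfolding deficits_def by (intro sum_mono deficit_mono) auto

lemma deficits_drop:
  assumes "finite V" "\<And>x. x \<in> V \<Longrightarrow> x \<noteq> u \<Longrightarrow> load H b x \<le> load H' b' x"
    and "load H b u \<le> load H' b' u + T (lev u)" "lev u \<le> L"
  shows "deficits H' b' lev V \<le> deficits H b lev V + 1"
proof -
  have "deficits H' b' lev V \<le> (\<Sum>x\<in>V. deficit (lev x) (load H b x) + (if x = u then 1 else 0))"
    unfolding deficits_def
  proof (rule sum_mono)
    fix x assume "x \<in> V"
    then show "deficit (lev x) (load H' b' x) \<le> deficit (lev x) (load H b x) + (if x = u then 1 else 0)"
      using deficit_drop[OF assms(3,4)] deficit_mono[OF assms(2)] by (cases "x = u") auto
  qed
  also have "\<dots> \<le> deficits H b lev V + 1"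
    using assms(1) by (simp add: deficits_def sum.distrib)
  finally show ?thesis .
qed

lemma deficits_insert:
  assumes "v < n"
  shows "deficits H b lev {..<n} = deficit (lev v) (load H b v) + deficits H b lev ({..<n} - {v})"
  unfolding deficits_def using assms by (intro sum.remove) auto

section \<open>Effect of moving one edge on loads and mass\<close>

lemma load_upd2:
  assumes "H \<subseteq> {..<n} \<times> {..<n}" "(v, u) \<in> H" "(u, v) \<in> H" "v \<noteq> u"
  shows "load H (upd2 v u g b) v + T (b v u) = load H b v + T (g (b v u))"
    "load H (upd2 v u g b) u + T (b u v) = load H b u + T (g (b u v))"
    "x \<noteq> v \<Longrightarrow> x \<noteq> u \<Longrightarrow> load H (upd2 v u g b) x = load H b x"
proof -
  have *: "load H (upd2 v u g b) x + T (b x y) = load H b x + T (g (b x y))"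
    if "(x, y) \<in> H" "(x, y) = (v, u) \<or> (x, y) = (u, v)" for x y
  proof -
    have "finite (H `` {x})" by (rule finite_subset[of _ "{..<n}"]) (use assms in auto)
    moreover have "(\<Sum>z\<in>H `` {x} - {y}. T (upd2 v u g b x z)) = (\<Sum>z\<in>H `` {x} - {y}. T (b x z))"
      using that(2) assms(4) by (intro sum.cong) (auto simp: upd2_def)
    moreover have "y \<in> H `` {x}" "upd2 v u g b x y = g (b x y)" using that by (auto simp: upd2_def)
    ultimately show ?thesis unfolding load_def by (simp add: sum.remove)
  qed
  show "load H (upd2 v u g b) v + T (b v u) = load H b v + T (g (b v u))"
    "load H (upd2 v u g b) u + T (b u v) = load H b u + T (g (b u v))" using * assms by auto
  show "x \<noteq> v \<Longrightarrow> x \<noteq> u \<Longrightarrow> load H (upd2 v u g b) x = load H b x"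
    by (rule load_cong) (simp add: upd2_def)
qed

lemma mass_upd2:
  assumes "H \<subseteq> {..<n} \<times> {..<n}" "(v, u) \<in> H" "(u, v) \<in> H" "v \<noteq> u"
  shows "mass H (upd2 v u g b) = mass H b + (real (b v u) - real (g (b v u))) + (real (b u v) - real (g (b u v)))"
proof -
  have fin: "finite H" using assms(1) by (rule finite_subset) simp
  let ?R = "H - {(v, u)} - {(u, v)}"
  have S: "(\<Sum>(x, y)\<in>H. f x y) = f v u + f u v + (\<Sum>(x, y)\<in>?R. f x y)" for f :: "nat \<Rightarrow> nat \<Rightarrow> real"
  proof -
    have "(\<Sum>(x, y)\<in>H. f x y) = f v u + (\<Sum>(x, y)\<in>H - {(v, u)}. f x y)"
      using sum.remove[OF fin assms(2), of "\<lambda>(x, y). f x y"] by simp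
    also have "(\<Sum>(x, y)\<in>H - {(v, u)}. f x y) = f u v + (\<Sum>(x, y)\<in>?R. f x y)"
      using sum.remove[of "H - {(v, u)}" "(u, v)" "\<lambda>(x, y). f x y"] fin assms by simp
    finally show ?thesis by simp
  qed
  have R: "(\<Sum>(x, y)\<in>?R. real J - real (upd2 v u g b x y)) = (\<Sum>(x, y)\<in>?R. real J - real (b x y))"
    by (intro sum.cong refl) (auto simp: upd2_def split: if_splits)
  have "upd2 v u g b v u = g (b v u)" "upd2 v u g b u v = g (b u v)" by (auto simp: upd2_def)
  then show ?thesis
    unfolding mass_def S[of "\<lambda>x y. real J - real (upd2 v u g b x y)"] S[of "\<lambda>x y. real J - real (b x y)"] R
    by simp
qed

lemma load_ge_card:
  assumes "H \<subseteq> {..<n} \<times> {..<n}"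
  shows "card {y. (x, y) \<in> H \<and> b x y = i} * T i \<le> load H b x"
proof -
  have fin: "finite (H `` {x})" by (rule finite_subset[of _ "{..<n}"]) (use assms in auto)
  have "card {y. (x, y) \<in> H \<and> b x y = i} * T i = (\<Sum>y | (x, y) \<in> H \<and> b x y = i. T (b x y))" by simp
  also have "\<dots> \<le> load H b x" unfolding load_def using fin by (intro sum_mono2) auto
  finally show ?thesis .
qed

text \<open>Below \<open>L\<close> the weights are powers of two and one level costs exactly half.
  The step from \<open>L\<close> to \<open>L + 1\<close> would cost everything and is
  excluded.\<close>

lemma load_halved:
  assumes "\<And>y. (x, y) \<in> H \<Longrightarrow> b' x y = b x y \<or> b x y < L \<and> b' x y = Suc (b x y)"
  shows "load H b x \<le> 2 * load H b' x"
proof -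
  have "T j \<le> 2 * T (Suc j)" if "j < L" for j
  proof -
    have "L - j = Suc (L - Suc j)" using that by simp
    then show ?thesis using that by (simp add: T_le)
  qed
  then have "T (b x y) \<le> 2 * T (b' x y)" if "(x, y) \<in> H" for y using assms[OF that] by auto
  then show ?thesis unfolding load_def sum_distrib_left by (intro sum_mono) auto
qed

end

text \<open>The summand 100 covers the tests and assignments outside of the listed blocks.\<close>

definition step_time :: nat where
  "step_time = max_time up_body + max_time down_body + max_time fetch + max_time pop + max_time delete_edge +
     max_time sort_ends + max_time offset_body + max_time insert_edge + btime too_heavy + btime too_light +
     btime offset_test + wtime bucket + 100"

context vc_instance
begin

section \<open>Repairing vertices\<close>

definition inv ::
  "memory \<Rightarrow> nat set set \<Rightarrow> arc_levels \<Rightarrow> (nat \<Rightarrow> nat) \<Rightarrow> (nat set \<Rightarrow> nat) \<Rightarrow> nat set \<Rightarrow> bool" where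
  "inv s E b lev own D \<longleftrightarrow> static s \<and> buckets s (arcs E) b \<and> owned s E own \<and> stack s D \<and>
     (\<forall>x<n. words s LEV x = lev x) \<and> config E b lev own \<and>
     (\<forall>x<n. x \<notin> D \<longrightarrow> stable (arcs E) b lev x)"

lemma invD:
  assumes "inv s E b lev own D"
  shows "static s" "buckets s (arcs E) b" "owned s E own" "stack s D" "x < n \<Longrightarrow> words s LEV x = lev x"
    "config E b lev own" "x < n \<Longrightarrow> x \<notin> D \<Longrightarrow> stable (arcs E) b lev x"
  using assms by (auto simp: inv_def)

text \<open>
  The negative term pays for raising a vertex whose bucket is empty. It is harmless because a vertex
  that needs no repair has a positive level only if it is incident with an edge.
\<close>

definition potential ::
  "nat set set \<Rightarrow> arc_levels \<Rightarrow> (nat \<Rightarrow> nat) \<Rightarrow> nat set \<Rightarrow> real" where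
  "potential E b lev D = real step_time * (9 * mass (arcs E) b + 16 * deficits (arcs E) b lev {..<n} -
     real (\<Sum>x<n. lev x) + real (card D))"

lemma inv_same:
  assumes inv: "inv s E b lev own D" and sm: "same A s s'"
    and A: "A \<inter> {0, 1, 3, 4, LEV, BKT, SIZE, ELT, POS, WT, TAB, CNT, FLAG, STK, LOGN, FULL, SP} = {}"
  shows "inv s' E b lev own D"
  unfolding inv_def
proof (intro conjI allI impI)
  show "static s'" by (rule static_same[OF sm]) (use inv A in \<open>auto simp: inv_def\<close>)
  show "buckets s' (arcs E) b" by (rule buckets_same[OF sm]) (use inv A in \<open>auto simp: inv_def\<close>)
  show "owned s' E own" by (rule owned_same[OF sm]) (use inv A in \<open>auto simp: inv_def\<close>)
  show "stack s' D" by (rule stack_same[OF sm]) (use inv A in \<open>auto simp: inv_def\<close>)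
  show "config E b lev own" using inv by (simp add: inv_def)
  have "LEV \<notin> A" using A by auto
  then show "words s' LEV x = lev x" if "x < n" for x
    using inv that same_words[OF sm] by (simp add: inv_def)
  show "\<not> heavy (arcs E) b lev x" "\<not> light (arcs E) b lev x" if "x < n" "x \<notin> D" for x
    using inv that by (auto simp: inv_def)
qed

lemma J_bound: "J < 2 ^ w"
proof -
  have "J * n < 2 ^ w" using bucket_bound(1)[of J 0] n_pos by simp
  moreover have "J \<le> J * n" using n_pos by simp
  ultimately show ?thesis by linarith
qed

lemma mass_nonneg: "buckets s H b \<Longrightarrow> 0 \<le> mass H b"
  unfolding mass_def by (intro sum_nonneg) (auto simp: bucketsD)

lemma deficits_nonneg: "0 \<le> deficits H b lev V"
  unfolding deficits_def by (intro sum_nonneg deficit_nonneg)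

lemma edge_inv_cong:
  assumes "edge_inv lev b own x y" "lev' x = lev x" "lev' y = lev y" "b' x y = b x y" "b' y x = b y x"
    "own' {x, y} = own {x, y}"
  shows "edge_inv lev' b' own' x y"
  using assms by (simp add: edge_inv_def)

lemma stable_cong:
  assumes "load H b' x = load H b x" "lev' x = lev x"
  shows "heavy H b' lev' x \<longleftrightarrow> heavy H b lev x" "light H b' lev' x \<longleftrightarrow> light H b lev x"
  using assms by (auto simp: heavy_def light_def)

lemma offset_Suc: "offset x y (Suc i) (Suc j) \<longleftrightarrow> offset x y i j"
  by (simp add: offset_def)

lemma offset_bound: "offset x y i j \<or> offset y x j i \<Longrightarrow> j \<le> i + L + 1"
  by (auto simp: offset_def)

lemma config_edge: "config E b lev own \<Longrightarrow> {x, y} \<in> E \<Longrightarrow> edge_inv lev b own x y"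
  by (simp add: config_def)

lemma owned_edges: "owned s E own \<Longrightarrow> E \<subseteq> edges_on n"
  by (simp add: owned_def)

text \<open>The common last step of raising and lowering. Only the level of \<open>v\<close>
  changes, and \<open>v\<close> is still in \<open>D\<close>, so nothing has to be known about its
  stability.\<close>

lemma set_level:
  assumes st: "static s" and bk: "buckets s (arcs E) b" and ow: "owned s E own" and sk: "stack s D"
    and LV: "\<And>x. x < n \<Longrightarrow> words s LEV x = lev x" and lev: "\<And>x. x < n \<Longrightarrow> 2 ^ lev x \<le> k x \<and> lev x \<le> L"
    and ei: "\<And>x y. {x, y} \<in> E \<Longrightarrow> edge_inv (lev(v := j)) b own x y"
    and j: "2 ^ j \<le> k v" "j \<le> L" and vD: "v \<in> D"
    and sb: "\<And>x. x < n \<Longrightarrow> x \<notin> D \<Longrightarrow> stable (arcs E) b lev x"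
  shows "inv (set_word LEV v j s) E b (lev(v := j)) own D"
  unfolding inv_def
proof (intro conjI allI impI)
  have sm: "same {LEV} s (set_word LEV v j s)" by (auto simp: same_def)
  show "static (set_word LEV v j s)" by (rule static_same[OF sm _ st]) auto
  show "buckets (set_word LEV v j s) (arcs E) b" by (rule buckets_same[OF sm _ bk]) auto
  show "owned (set_word LEV v j s) E own" by (rule owned_same[OF sm _ ow]) auto
  show "stack (set_word LEV v j s) D" by (rule stack_same[OF sm _ sk]) auto
  show "config E b (lev(v := j)) own"
    using owned_edges[OF ow] ei lev j by (auto simp: config_def)
  show "words (set_word LEV v j s) LEV x = (lev(v := j)) x" if "x < n" for x using LV that by simp
  show "\<not> heavy (arcs E) b (lev(v := j)) x" "\<not> light (arcs E) b (lev(v := j)) x" if "x < n" "x \<notin> D" for x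
  proof -
    have "x \<noteq> v" using that vD by auto
    then show "\<not> heavy (arcs E) b (lev(v := j)) x" "\<not> light (arcs E) b (lev(v := j)) x"
      using sb[OF that] stable_cong[of "arcs E" b x b "lev(v := j)" lev] by simp_all
  qed
qed

lemma sum_level_upd:
  fixes lev :: "nat \<Rightarrow> nat"
  assumes "v < n" shows "(\<Sum>x<n. (lev(v := j)) x) + lev v = (\<Sum>x<n. lev x) + j"
proof -
  have "(\<Sum>x<n. f x) = f v + (\<Sum>x\<in>{..<n} - {v}. f x)" for f :: "nat \<Rightarrow> nat"
    using assms by (intro sum.remove) auto
  from this[of lev] this[of "lev(v := j)"] show ?thesis by simp
qed

lemma bucket_val:
  assumes "static s" "words s VV 0 = v" "words s II 0 = i" "v < n" "i \<le> J"
  shows "wval w s bucket = i * n + v"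
  using assms bucket_bound[OF assms(5,4)] by (simp add: bucket_def staticD[OF assms(1)])

subsection \<open>Raising a heavy vertex\<close>

text \<open>
  While a vertex \<open>v\<close> leaves level \<open>i\<close>, the arcs still waiting in its bucket \<open>i\<close> obey the
  invariant for the old level and all other edges that for the new one.
\<close>

definition raising ::
  "nat set set \<Rightarrow> (nat \<Rightarrow> nat) \<Rightarrow> arc_levels \<Rightarrow> nat \<Rightarrow>
   arc_levels \<times> (nat set \<Rightarrow> nat) \<times> nat set \<Rightarrow> memory \<Rightarrow> bool" where
  "raising E lev b0 v = (\<lambda>(b, own, D) s. static s \<and> buckets s (arcs E) b \<and> owned s E own \<and> stack s D \<and>
     (\<forall>x<n. words s LEV x = lev x) \<and> words s VV 0 = v \<and> words s II 0 = lev v \<and> v \<in> D \<and>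
     (\<forall>x y. {x, y} \<in> E \<longrightarrow> edge_inv (if x = v \<and> b x y = lev v \<or> y = v \<and> b y x = lev v then lev
        else lev(v := Suc (lev v))) b own x y) \<and>
     (\<forall>y. {v, y} \<in> E \<longrightarrow> b v y = b0 v y \<or> b0 v y = lev v \<and> b v y = Suc (b0 v y)) \<and>
     (\<forall>x<n. x \<notin> D \<longrightarrow> stable (arcs E) b lev x))"

text \<open>The share of \<open>v\<close> is left out: its deficit is settled once, when its new
  level is set, and the level sum does not change inside the loops.\<close>

definition loop_potential ::
  "nat set set \<Rightarrow> (nat \<Rightarrow> nat) \<Rightarrow> nat \<Rightarrow> arc_levels \<Rightarrow> nat set \<Rightarrow> real" where
  "loop_potential E lev v b D = real step_time * (9 * mass (arcs E) b +
     16 * deficits (arcs E) b lev ({..<n} - {v}) + real (card D))"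

lemma loop_potential_nonneg: "buckets s (arcs E) b \<Longrightarrow> 0 \<le> loop_potential E lev v b D"
  unfolding loop_potential_def
  by (intro mult_nonneg_nonneg add_nonneg_nonneg) (auto simp: mass_nonneg deficits_nonneg)

lemma card_insert_real: "finite D \<Longrightarrow> real (card (insert x D)) \<le> real (card D) + 1"
  by (simp add: card_insert_if)

text \<open>Accounts: \<open>mass\<close> falls by 2, worth 18. Of this 16 pay for the deficit of
  \<open>u\<close>, which rises by at most 1 since its arc weighs at most \<open>T (lev u)\<close>,
  1 pays for pushing \<open>u\<close> and 1 for the round.\<close>

lemma up_body:
  assumes R: "raising E lev b0 v (b, own, D) s" and levL: "\<And>x. x < n \<Longrightarrow> lev x \<le> L" and iL: "lev v < L"
    and ne: "0 < words s SIZE (lev v * n + v)" and vn: "v < n"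
  shows "\<exists>b' own' D'. raising E lev b0 v (b', own', D') (sem w up_body s) \<and>
    real step_time + loop_potential E lev v b' D' \<le> loop_potential E lev v b D"
proof -
  define i where "i = lev v"
  define z where "z = words s SIZE (i * n + v)"
  define u where "u = words s ELT ((i * n + v) * n + (z - 1))"
  define lev' where "lev' = lev(v := Suc i)"
  have st: "static s" and bk: "buckets s (arcs E) b" and ow: "owned s E own" and sk: "stack s D"
    and LV: "\<And>x. x < n \<Longrightarrow> words s LEV x = lev x" and V: "words s VV 0 = v" and I: "words s II 0 = i"
    and vD: "v \<in> D"
    and ei: "\<And>x y. {x, y} \<in> E \<Longrightarrow> edge_inv (if x = v \<and> b x y = i \<or> y = v \<and> b y x = i then lev else lev') b own x y"
    and b0: "\<And>y. {v, y} \<in> E \<Longrightarrow> b v y = b0 v y \<or> b0 v y = i \<and> b v y = Suc (b0 v y)"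
    and sb: "\<And>x. x < n \<Longrightarrow> x \<notin> D \<Longrightarrow> stable (arcs E) b lev x"
    using R unfolding raising_def prod.case i_def lev'_def by blast+
  note D = bucketsD[OF bk]
  have iJ: "i \<le> J" using iL by (simp add: J_def i_def)
  have z: "0 < z" "z \<le> n" using ne buckets_card(2)[OF bk vn iJ] by (simp_all add: z_def i_def)
  have u: "{v, u} \<in> E" "b v u = i"
    using D(9)[OF vn iJ, of "z - 1"] z by (simp_all add: u_def z_def)
  have un: "u < n" "v \<noteq> u" using edge_ends[OF owned_edges[OF ow] u(1)] by auto
  have uv: "{u, v} \<in> E" using u(1) by (simp add: insert_commute)
  have zw: "z < 2 ^ w" using z(2) n_bound by linarith
  have zs: "nat ((int z - 1) mod 2 ^ w) = z - 1" using word_diff[of 1 z w] z zw by simp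
  have p1: "z - 1 \<le> n" using z by simp
  note cb = cell_bound[OF iJ vn p1]
  define s1 where "s1 = sem w (setv UU (WGet ELT (ix bucket (WSub (WGet SIZE bucket) (WLit 1))))) s"
  have s1: "s1 = set_word UU 0 u s"
    using cb bucket_val[OF st V I vn iJ] small_lits(1)
    by (simp add: s1_def staticD[OF st] zs[simplified] z_def[symmetric] u_def)
  have sm1: "same {UU} s s1" by (auto simp: s1 same_def)
  have st1: "static s1" by (rule static_same[OF sm1 _ st]) simp
  have bk1: "buckets s1 (arcs E) b" by (rule buckets_same[OF sm1 _ bk]) simp
  have V1: "words s1 VV 0 = v" "words s1 UU 0 = u" using V by (simp_all add: s1)
  define s2 where "s2 = sem w (shift WAdd) s1"
  have eu: "edge_inv lev b own v u" using ei[OF u(1)] u(2) by simp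
  have buv: "b u v \<le> i + L + 1" "lev u \<le> b u v"
    using eu u(2) offset_bound[of v u "b v u" "b u v"] by (auto simp: edge_inv_def)
  have gJ: "Suc (b v u) \<le> J" "Suc (b u v) \<le> J"
    using u(2) iL buv by (simp_all add: J_def i_def)
  define b' where "b' = upd2 v u Suc b"
  have vu: "(v, u) \<in> arcs E" "(u, v) \<in> arcs E" using u uv by auto
  have f: "wval w s (WAdd e (WLit 1)) = Suc m" if "wval w s e = m" "Suc m \<le> J" for s e m
    using that J_bound small_lits(1) by simp
  note h2 = shift[OF st1 bk1 vu un(2) V1, of WAdd Suc, OF f f gJ, simplified gJ, simplified, folded s2_def b'_def]
  have sm2: "same {BKT, SIZE, ELT, POS, WT, AA, BB, QQ, LL} s1 s2" by (rule h2(2))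
  have sm12: "same {UU, BKT, SIZE, ELT, POS, WT, AA, BB, QQ, LL} s s2"
    by (rule same_mono[OF same_trans[OF sm1 sm2]]) auto
  have st2: "static s2" by (rule static_same[OF sm2 _ st1]) auto
  have ow2: "owned s2 E own" by (rule owned_same[OF sm12 _ ow]) auto
  have sk2: "stack s2 D" by (rule stack_same[OF sm12 _ sk]) auto
  have V2: "words s2 VV 0 = v" "words s2 UU 0 = u" using V1 same_words[OF sm2] by simp_all
  define own' where "own' = own({v, u} := v)"
  define s3 where "s3 = sem w (gain_owner VV) (sem w drop_owner s2)"
  note h3 = reassign[OF st2 ow2 u(1) V2 V2(1) vn, simplified, folded s3_def own'_def]
  have sm3: "same {3, 4, CNT, IX, OW} s2 s3" by (rule h3(2))
  have sm13: "same {UU, BKT, SIZE, ELT, POS, WT, AA, BB, QQ, LL, 3, 4, CNT, IX, OW} s s3"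
    by (rule same_mono[OF same_trans[OF sm12 sm3]]) auto
  have sk3: "stack s3 D" by (rule stack_same[OF sm13 _ sk]) auto
  have V3: "words s3 VV 0 = v" "words s3 UU 0 = u" using V2 same_words[OF sm3] by simp_all
  define s4 where "s4 = sem w (push UU) s3"
  note h4 = push[OF sk3 V3(2) un(1), simplified, folded s4_def]
  have sm14: "same {UU, BKT, SIZE, ELT, POS, WT, AA, BB, QQ, LL, 3, 4, CNT, IX, OW, SP, FLAG, STK} s s4"
    by (rule same_mono[OF same_trans[OF sm13 h4(2)]]) auto
  have s4: "sem w up_body s = s4"
    by (simp add: up_body_def s4_def s3_def s2_def s1_def del: sem.simps(2))
  have bk3: "buckets s3 (arcs E) b'" by (rule buckets_same[OF sm3 _ h2(1)]) auto
  have bk4: "buckets s4 (arcs E) b'" by (rule buckets_same[OF h4(2) _ bk3]) auto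
  have ow4: "owned s4 E own'" by (rule owned_same[OF h4(2) _ h3(1)]) auto
  have st4: "static s4" by (rule static_same[OF sm14 _ st]) auto
  have b'v: "b' v u = Suc i" "b' u v = Suc (b u v)" using u(2) by (auto simp: b'_def upd2_def)
  have b'_other: "b' x y = b x y" if "{x, y} \<noteq> {v, u}" for x y
    using that by (auto simp: b'_def upd2_def)
  have ei': "edge_inv (if x = v \<and> b' x y = i \<or> y = v \<and> b' y x = i then lev else lev') b' own' x y"
    if xy: "{x, y} \<in> E" for x y
  proof (cases "{x, y} = {v, u}")
    case True
    \<comment> \<open>Both levels have risen by one, so the offset is unchanged, and
      \<open>v\<close>, now the owner, will be on the level of the edge.\<close>
    have "edge_inv lev' b' own' v u"
      using eu un buv by (auto simp: edge_inv_def lev'_def own'_def b'v offset_Suc u(2))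
    moreover from True have "x = v \<and> y = u \<or> x = u \<and> y = v" by (auto simp: doubleton_eq_iff)
    ultimately show ?thesis using un b'v by (auto simp: edge_inv_sym[of _ _ _ u v])
  next
    case False
    have "{y, x} \<noteq> {v, u}" using False by (simp add: insert_commute)
    note b = b'_other[OF False] b'_other[OF this]
    have o: "own' {x, y} = own {x, y}" using False by (simp add: own'_def)
    show ?thesis unfolding b by (rule edge_inv_cong[OF ei[OF xy]]) (simp_all add: b o)
  qed
  have b0': "b' v y = b0 v y \<or> b0 v y = i \<and> b' v y = Suc (b0 v y)" if "{v, y} \<in> E" for y
  proof (cases "y = u")
    case True
    then show ?thesis using b0[OF u(1)] u(2) b'v(1) by (metis n_not_Suc_n)
  next
    case False
    then have "b' v y = b v y" using un by (auto simp: b'_def upd2_def)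
    then show ?thesis using b0[OF that] by simp
  qed
  note lu = load_upd2[OF D(1) vu un(2), where g = Suc and b = b, folded b'_def]
  have sb': "stable (arcs E) b' lev x" if "x < n" "x \<notin> insert u D" for x
  proof -
    have "load (arcs E) b' x = load (arcs E) b x" using that vD by (intro lu(3)) auto
    then show ?thesis using stable_cong[of "arcs E" b' x b lev lev] sb[of x] that by simp
  qed
  have "raising E lev b0 v (b', own', insert u D) s4"
    unfolding raising_def prod.case i_def[symmetric] lev'_def[symmetric]
    using st4 bk4 ow4 h4(1) ei' b0' sb' vD LV V I same_words[OF sm14] by auto
  moreover have "real step_time + loop_potential E lev v b' (insert u D) \<le> loop_potential E lev v b D"
  proof -
    have "mass (arcs E) b' = mass (arcs E) b - 2"
      using mass_upd2[OF D(1) vu un(2), where g = Suc and b = b] by (simp add: b'_def)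
    moreover have "deficits (arcs E) b' lev ({..<n} - {v}) \<le> deficits (arcs E) b lev ({..<n} - {v}) + 1"
    proof (rule deficits_drop[of _ u])
      show "load (arcs E) b x \<le> load (arcs E) b' x" if "x \<in> {..<n} - {v}" "x \<noteq> u" for x
        using that lu(3)[of x] by simp
      show "load (arcs E) b u \<le> load (arcs E) b' u + T (lev u)"
        using lu(2) T_antimono[OF buv(2)] by linarith
    qed (use levL un in auto)
    moreover have "real (card (insert u D)) \<le> real (card D) + 1"
      by (rule card_insert_real[OF stack_card(2)[OF sk]])
    ultimately have "1 + (9 * mass (arcs E) b' + 16 * deficits (arcs E) b' lev ({..<n} - {v}) + real (card (insert u D)))
       \<le> 9 * mass (arcs E) b + 16 * deficits (arcs E) b lev ({..<n} - {v}) + real (card D)"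
      by linarith
    from mult_left_mono[OF this, of "real step_time"] show ?thesis
      unfolding loop_potential_def by (simp add: distrib_left)
  qed
  ultimately show ?thesis unfolding s4 by blast
qed

lemma loopfree_blocks:
  "loopfree up_body" "loopfree down_body" "loopfree fetch" "loopfree pop" "loopfree sort_ends"
  "loopfree offset_body" "loopfree insert_edge" "loopfree delete_edge"
  by (simp_all add: up_body_def down_body_def fetch_def pop_def sort_ends_def offset_body_def insert_edge_def place_edge_def
      delete_edge_def shift_def half_rem_def half_add_def set_bkt_def drop_owner_def gain_owner_def
      set_ix_def set_copies_def push_def)

text \<open>The deficit of \<open>v\<close> vanishes and the level sum grows by one, which releases
  one \<open>step_time\<close> to set against the constant work outside the loop body.\<close>

lemma raise:
  assumes inv: "inv s E b lev own D" and vD: "v \<in> D"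
    and V: "words s VV 0 = v" and I: "words s II 0 = lev v"
    and hv: "heavy (arcs E) b lev v"
  shows "\<exists>t s' b' lev' own' D'. exec w raise s t s' \<and> inv s' E b' lev' own' D' \<and>
     real t + potential E b' lev' D' + real step_time \<le> potential E b lev D + real (wtime bucket + 20)"
proof -
  note iD = invD[OF inv]
  note st = iD(1) and bk = iD(2) and ow = iD(3) and sk = iD(4) and LV = iD(5) and cf = iD(6) and sb = iD(7)
  have vn: "v < n" using vD sk by (auto simp: stack_def)
  have E: "E \<subseteq> edges_on n" using cf by (simp add: config_def)
  have levL: "lev x \<le> L" if "x < n" for x using cf that by (simp add: config_def)
  \<comment> \<open>On level \<open>L\<close> or above every arc has weight at most 1, and at most
    \<open>n \<le> 2 ^ L\<close> arcs cannot make a vertex heavy.\<close>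
  have iL: "lev v < L"
  proof (rule ccontr)
    assume "\<not> lev v < L"
    then have "T (b v y) \<le> 1" if "{v, y} \<in> E" for y
      using T_antimono[of L "b v y"] config_edge[OF cf that] by (simp add: edge_inv_def T_le)
    then have "load (arcs E) b v \<le> card (arcs E `` {v}) * 1"
      unfolding load_def by (intro sum_bounded_above[THEN order_trans]) auto
    also have "card (arcs E `` {v}) \<le> card {..<n}"
      using arcs_subset[OF E] by (intro card_mono) auto
    finally show False using hv L_lower by (simp add: heavy_def)
  qed
  have iJ: "lev v \<le> J" using iL by (simp add: J_def)
  let ?lev' = "lev(v := Suc (lev v))"
  let ?c = "WLess (WLit 0) (WGet SIZE bucket)"
  have guard: "bval w s ?c \<longleftrightarrow> 0 < words s SIZE (lev v * n + v)" if "raising E lev b v g s" for g s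
    using bucket_val[of s v "lev v"] that vn iJ by (auto simp: raising_def split: prod.splits)
  let ?\<Phi> = "\<lambda>(b, own, D). loop_potential E lev v b D"
  have "raising E lev b v (b, own, D) s"
    unfolding raising_def prod.case
  proof (intro conjI allI impI)
    fix x y assume xy: "{x, y} \<in> E"
    note e = config_edge[OF cf xy]
    show "edge_inv (if x = v \<and> b x y = lev v \<or> y = v \<and> b y x = lev v then lev else ?lev') b own x y"
    proof (cases "x = v \<and> b x y = lev v \<or> y = v \<and> b y x = lev v")
      case False
      then show ?thesis using e edge_ends[OF E xy] unfolding edge_inv_def by auto
    qed (use e in simp)
  qed (use st bk ow sk LV V I vD sb in auto)
  note start = this
  have step: "\<exists>g'. raising E lev b v g' (sem w up_body s) \<and> real step_time + ?\<Phi> g' \<le> ?\<Phi> g"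
    if g: "raising E lev b v g s" "bval w s ?c" for g s
  proof -
    obtain b1 own1 D1 where g': "g = (b1, own1, D1)" by (cases g)
    have sz: "0 < words s SIZE (lev v * n + v)" using guard[OF g(1)] g(2) by simp
    show ?thesis using up_body[OF g(1)[unfolded g'] levL iL sz vn] unfolding g' by force
  qed
  have bound: "0 \<le> ?\<Phi> g" if "raising E lev b v g s" for g s
    using that by (auto simp: raising_def intro: loop_potential_nonneg)
  have "\<exists>t s' g'. exec w (While ?c up_body) s t s' \<and> raising E lev b v g' s' \<and> \<not> bval w s' ?c \<and>
      real t + ?\<Phi> g' \<le> ?\<Phi> (b, own, D) + real (1 + btime ?c)"
    by (rule exec_While_sem[where I = "raising E lev b v" and \<Phi> = ?\<Phi> and K = step_time, OF start loopfree_blocks(1)])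
      (simp add: step_time_def, erule (1) step, erule bound)
  then obtain t s1 g where
    1: "exec w (While ?c up_body) s t s1" "raising E lev b v g s1" "\<not> bval w s1 ?c"
      "real t + ?\<Phi> g \<le> loop_potential E lev v b D + real (1 + btime ?c)"
    unfolding prod.case by blast
  obtain b' own' D' where g: "g = (b', own', D')" by (cases g)
  have st1: "static s1" and bk1: "buckets s1 (arcs E) b'" and ow1: "owned s1 E own'" and sk1: "stack s1 D'"
    and LV1: "\<And>x. x < n \<Longrightarrow> words s1 LEV x = lev x" and V1: "words s1 VV 0 = v" "words s1 II 0 = lev v"
    and vD1: "v \<in> D'"
    and ei: "\<And>x y. {x, y} \<in> E \<Longrightarrow> edge_inv (if x = v \<and> b' x y = lev v \<or> y = v \<and> b' y x = lev v then lev else ?lev') b' own' x y"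
    and b0: "\<And>y. {v, y} \<in> E \<Longrightarrow> b' v y = b v y \<or> b v y = lev v \<and> b' v y = Suc (b v y)"
    and sb1: "\<And>x. x < n \<Longrightarrow> x \<notin> D' \<Longrightarrow> stable (arcs E) b' lev x"
    using 1(2) unfolding g raising_def prod.case by blast+
  have "{y. (v, y) \<in> arcs E \<and> b' v y = lev v} = {}"
  proof -
    have "card {y. (v, y) \<in> arcs E \<and> b' v y = lev v} = 0"
      using 1(3) guard[OF 1(2)] buckets_card(1)[OF bk1 vn iJ] by simp
    moreover have "{y. (v, y) \<in> arcs E \<and> b' v y = lev v} \<subseteq> {..<n}" using edge_ends(2)[OF E] by auto
    ultimately show ?thesis by (meson card_0_eq finite_lessThan finite_subset)
  qed
  then have none: "b' v y \<noteq> lev v" if "{v, y} \<in> E" for y using that by auto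
  have ei': "edge_inv ?lev' b' own' x y" if "{x, y} \<in> E" for x y
    using ei[OF that] none[of x] none[of y] that by (auto simp: insert_commute split: if_splits)
  have lvw: "Suc (lev v) < 2 ^ w" using iJ iL J_bound by (simp add: J_def)
  define s2 where "s2 = set_word LEV v (Suc (lev v)) s1"
  have s2: "sem w (WSet LEV (var VV) (WAdd (var II) (WLit 1))) s1 = s2"
    using V1 lvw small_lits(1) by (simp add: s2_def)
  \<comment> \<open>A load above 2 has been at most halved, so the raised vertex starts on its new
    level without any deficit.\<close>
  have ld: "2 ^ L \<le> load (arcs E) b' v"
  proof -
    have "load (arcs E) b v \<le> 2 * load (arcs E) b' v"
      by (rule load_halved) (metis arcs_iff b0 iL)
    then show ?thesis using hv by (simp add: heavy_def)
  qed
  have "2 ^ Suc (lev v) \<le> k v" using hv by (simp add: heavy_def)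
  then have "inv s2 E b' ?lev' own' D'"
    unfolding s2_def using cf iL
    by (intro set_level[OF st1 bk1 ow1 sk1 LV1 _ ei' _ _ vD1 sb1]) (auto simp: config_def)
  moreover have "exec w raise s (t + (1 + wtime (var VV) + wtime (WAdd (var II) (WLit 1)))) s2"
    unfolding raise_def
    by (rule exec.Seq[OF 1(1)]) (use exec.WSet[of w LEV "var VV" "WAdd (var II) (WLit 1)" s1] s2 in simp)
  moreover have "real (t + (1 + wtime (var VV) + wtime (WAdd (var II) (WLit 1)))) + potential E b' ?lev' D' + real step_time
     \<le> potential E b lev D + real (wtime bucket + 20)"
  proof -
    have "deficits (arcs E) b' ?lev' {..<n} = deficit (Suc (lev v)) (load (arcs E) b' v) + deficits (arcs E) b' ?lev' ({..<n} - {v})"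
      using deficits_insert[OF vn, of "arcs E" b' ?lev'] by simp
    moreover have "deficits (arcs E) b' ?lev' ({..<n} - {v}) = deficits (arcs E) b' lev ({..<n} - {v})"
      by (rule deficits_cong) simp
    moreover have "deficit (Suc (lev v)) (load (arcs E) b' v) = 0"
    proof -
      have "real (2 ^ L) \<le> real (load (arcs E) b' v)" using ld by (simp only: of_nat_le_iff)
      then show ?thesis by (simp add: deficit_def)
    qed
    ultimately have d1: "deficits (arcs E) b' ?lev' {..<n} = deficits (arcs E) b' lev ({..<n} - {v})" by simp
    have d2: "deficits (arcs E) b lev ({..<n} - {v}) \<le> deficits (arcs E) b lev {..<n}"
      using deficits_insert[OF vn, of "arcs E" b lev] deficit_nonneg by simp
    have d3: "real (\<Sum>x<n. ?lev' x) = real (\<Sum>x<n. lev x) + 1"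
      using sum_level_upd[OF vn, of lev "Suc (lev v)"] by linarith
    have "potential E b' ?lev' D' + real step_time = loop_potential E lev v b' D' - real step_time * real (\<Sum>x<n. lev x)"
      unfolding potential_def loop_potential_def d1 d3 by (simp add: algebra_simps)
    moreover have "loop_potential E lev v b D - real step_time * real (\<Sum>x<n. lev x) \<le> potential E b lev D"
    proof -
      have "real step_time * (9 * mass (arcs E) b + 16 * deficits (arcs E) b lev ({..<n} - {v}) + real (card D))
        \<le> real step_time * (9 * mass (arcs E) b + 16 * deficits (arcs E) b lev {..<n} + real (card D))"
        using d2 by (intro mult_left_mono) auto
      then show ?thesis unfolding potential_def loop_potential_def by (simp add: algebra_simps)
    qed
    moreover have "real t + loop_potential E lev v b' D' \<le> loop_potential E lev v b D + real (1 + btime ?c)"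
      using 1(4) by (simp add: g)
    ultimately show ?thesis by simp
  qed
  ultimately show ?thesis by blast
qed


subsection \<open>Lowering a light vertex\<close>

definition waiting :: "memory \<Rightarrow> nat \<Rightarrow> nat \<Rightarrow> nat \<Rightarrow> nat set" where
  "waiting s v i p = (\<lambda>q. words s ELT ((i * n + v) * n + q)) ` {..<p}"

text \<open>Entries at positions below \<open>p\<close> are still to be scanned and obey the
  invariant for the old level. Unlike in \<open>raising\<close> they cannot be told by their level,
  since an edge handed over to its other end remains in bucket \<open>lev v\<close>.
  \<open>b0\<close> holds the initial levels, against which the load of \<open>v\<close> is
  compared.\<close>

definition lowering ::
  "nat set set \<Rightarrow> (nat \<Rightarrow> nat) \<Rightarrow> arc_levels \<Rightarrow> nat \<Rightarrow>
   arc_levels \<times> (nat set \<Rightarrow> nat) \<times> nat set \<times> nat \<Rightarrow> memory \<Rightarrow> bool" where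
  "lowering E lev b0 v = (\<lambda>(b, own, D, p) s. static s \<and> buckets s (arcs E) b \<and> owned s E own \<and> stack s D \<and>
     (\<forall>x<n. words s LEV x = lev x) \<and> words s VV 0 = v \<and> words s II 0 = lev v \<and> words s PP 0 = p \<and> v \<in> D \<and>
     p \<le> words s SIZE (lev v * n + v) \<and>
     (\<forall>x y. {x, y} \<in> E \<longrightarrow> edge_inv (if x = v \<and> y \<in> waiting s v (lev v) p \<or> y = v \<and> x \<in> waiting s v (lev v) p
        then lev else lev(v := lev v - 1)) b own x y) \<and>
     load (arcs E) b0 v \<le> load (arcs E) b v \<and>
     (\<forall>x<n. x \<notin> D \<longrightarrow> stable (arcs E) b lev x))"

lemma waiting_Suc: "waiting s v i (Suc p) = insert (words s ELT ((i * n + v) * n + p)) (waiting s v i p)"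
  by (simp add: waiting_def lessThan_Suc)

lemma waiting_cong:
  "(\<And>q. q < p \<Longrightarrow> words s' ELT ((i * n + v) * n + q) = words s ELT ((i * n + v) * n + q)) \<Longrightarrow>
    waiting s' v i p = waiting s v i p"
  by (auto simp: waiting_def intro!: image_cong)

text \<open>Accounts: the credit of 20 for the scanned entry pays 18 for the two levels returned to
  \<open>mass\<close>, 1 for a possible push and 1 for the round. Loads never fall, so no deficit
  rises.\<close>

lemma down_body:
  assumes R: "lowering E lev b0 v (b, own, D, p) s" and p: "0 < p"
    and levL: "\<And>x. x < n \<Longrightarrow> lev x \<le> L" and i0: "0 < lev v" and vn: "v < n"
  shows "\<exists>b' own' D'. lowering E lev b0 v (b', own', D', p - 1) (sem w down_body s) \<and>
    real step_time + (loop_potential E lev v b' D' + real (20 * step_time) * real (p - 1)) \<le>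
      loop_potential E lev v b D + real (20 * step_time) * real p"
proof -
  define i where "i = lev v"
  define p' where "p' = p - 1"
  define u where "u = words s ELT ((i * n + v) * n + p')"
  define lev' where "lev' = lev(v := i - 1)"
  have pS: "p = Suc p'" using p by (simp add: p'_def)
  have st: "static s" and bk: "buckets s (arcs E) b" and ow: "owned s E own" and sk: "stack s D"
    and LV: "\<And>x. x < n \<Longrightarrow> words s LEV x = lev x" and V: "words s VV 0 = v" and I: "words s II 0 = i"
    and P: "words s PP 0 = p" and vD: "v \<in> D" and psz: "p \<le> words s SIZE (i * n + v)"
    and ei: "\<And>x y. {x, y} \<in> E \<Longrightarrow> edge_inv (if x = v \<and> y \<in> waiting s v i p \<or> y = v \<and> x \<in> waiting s v i p
        then lev else lev') b own x y"
    and ld: "load (arcs E) b0 v \<le> load (arcs E) b v"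
    and sb: "\<And>x. x < n \<Longrightarrow> x \<notin> D \<Longrightarrow> stable (arcs E) b lev x"
    using R unfolding lowering_def prod.case i_def lev'_def by blast+
  note D = bucketsD[OF bk]
  have iL: "0 < i" "i \<le> L" using i0 levL[OF vn] by (simp_all add: i_def)
  have iJ: "i \<le> J" using iL by (simp add: J_def)
  have pn: "p \<le> n" using psz buckets_card(2)[OF bk vn iJ] by simp
  have W: "waiting s v i p = insert u (waiting s v i p')" by (simp add: pS waiting_Suc u_def)
  have el: "{v, words s ELT ((i * n + v) * n + q)} \<in> E" "b v (words s ELT ((i * n + v) * n + q)) = i"
    "words s POS (v * n + words s ELT ((i * n + v) * n + q)) = q" if "q < p" for q
    using D(9)[OF vn iJ, of q] that psz by simp_all
  have u: "{v, u} \<in> E" "b v u = i" "words s POS (v * n + u) = p'"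
    using el[of p'] by (simp_all add: u_def pS)
  have un: "u < n" "v \<noteq> u" using edge_ends[OF owned_edges[OF ow] u(1)] by auto
  have uv: "{u, v} \<in> E" using u(1) by (simp add: insert_commute)
  have vu: "(v, u) \<in> arcs E" "(u, v) \<in> arcs E" using u uv by auto
  have u_nW: "u \<notin> waiting s v i p'"
  proof
    assume "u \<in> waiting s v i p'"
    then obtain q where "q < p'" "u = words s ELT ((i * n + v) * n + q)" by (auto simp: waiting_def)
    then show False using el(3)[of q] u(3) by (simp add: pS)
  qed
  have pw: "p < 2 ^ w" using pn n_bound by linarith
  have ps: "nat ((int p - 1) mod 2 ^ w) = p'" using word_diff[of 1 p w] p pw by (simp add: p'_def)
  have p1: "p' \<le> n" using pn by (simp add: pS)
  note cb = cell_bound[OF iJ vn p1]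
  define s1 where "s1 = set_word UU 0 u (set_word PP 0 p' s)"
  have sm1: "same {UU, PP} s s1" by (auto simp: s1_def same_def)
  have st1: "static s1" by (rule static_same[OF sm1 _ st]) simp
  have bk1: "buckets s1 (arcs E) b" by (rule buckets_same[OF sm1 _ bk]) simp
  have V1: "words s1 VV 0 = v" "words s1 UU 0 = u" using V by (simp_all add: s1_def)
  define sp where "sp = set_word PP 0 p' s"
  have smp: "same {PP} s sp" by (auto simp: sp_def same_def)
  have stp: "static sp" by (rule static_same[OF smp _ st]) simp
  have bvp: "wval w sp bucket = i * n + v"
    by (rule bucket_val[OF stp _ _ vn iJ]) (simp_all add: sp_def V I)
  have s1: "sem w (setv UU (WGet ELT (ix bucket (var PP)))) (sem w (setv PP (WSub (var PP) (WLit 1))) s) = s1"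
    using cb small_lits(1) bvp
    by (simp add: s1_def P ps[simplified] sp_def[symmetric] staticD[OF stp] u_def[symmetric])
      (simp add: sp_def u_def)
  have eu: "edge_inv lev b own v u" using ei[OF u(1)] W by simp
  have buv: "b u v \<le> i + L + 1" "lev u \<le> b u v"
    using eu u(2) offset_bound[of v u "b v u" "b u v"] by (auto simp: edge_inv_def)
  have guard: "bval w s1 (WLess (WGet LEV (var UU)) (get_bkt UU VV)) \<longleftrightarrow> lev u < b u v"
    using get_bkt[OF st1 _ un(1) vn V1(2,1), of "b u v"] D(4)[OF vu(2)] LV[OF un(1)]
    by (simp add: V1) (simp add: s1_def)
  have body: "sem w down_body s = (if lev u < b u v then sem w (push UU) (sem w (shift WSub) s1)
      else sem w (gain_owner UU) (sem w drop_owner s1))"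
    unfolding down_body_def sem.simps(4,5) s1 guard ..
  have u_eq: "x = v \<and> y = u \<or> x = u \<and> y = v" if "{x, y} = {v, u}" for x y
    using that by (auto simp: doubleton_eq_iff)
  have cond_other: "(x = v \<and> y \<in> waiting s v i p \<or> y = v \<and> x \<in> waiting s v i p) \<longleftrightarrow>
     (x = v \<and> y \<in> waiting s v i p' \<or> y = v \<and> x \<in> waiting s v i p')" if "{x, y} \<noteq> {v, u}" for x y
    using that by (auto simp: W)
  show ?thesis
  proof (cases "lev u < b u v")
    case True
    define b' where "b' = upd2 v u (\<lambda>m. m - 1) b"
    have J: "b v u \<le> J" "b u v \<le> J" using D(5)[OF vu(1)] D(5)[OF vu(2)] by auto
    have f: "wval w s (WSub e (WLit 1)) = m - 1" if "wval w s e = m" "0 < m" "m \<le> J" for s e m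
    proof -
      have "m < 2 ^ w" using that J_bound by simp
      then show ?thesis using that word_diff[of 1 m w] small_lits(1) by simp
    qed
    have pos: "0 < b v u" "0 < b u v" using u(2) iL True by simp_all
    have g1: "b v u - 1 \<le> J" "b u v - 1 \<le> J" using J by linarith+
    define s2 where "s2 = sem w (shift WSub) s1"
    note h2 = shift[OF st1 bk1 vu un(2) V1, of WSub "\<lambda>m. m - 1", OF f[OF _ pos(1) J(1)] f[OF _ pos(2) J(2)] g1,
        folded s2_def b'_def]
    have sm2: "same {BKT, SIZE, ELT, POS, WT, AA, BB, QQ, LL} s1 s2" by (rule h2(2)) auto
    have sm12: "same {UU, PP, BKT, SIZE, ELT, POS, WT, AA, BB, QQ, LL} s s2"
      by (rule same_mono[OF same_trans[OF sm1 sm2]]) auto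
    have sk2: "stack s2 D" by (rule stack_same[OF sm12 _ sk]) auto
    have V2: "words s2 VV 0 = v" "words s2 UU 0 = u" using V1 same_words[OF sm2] by simp_all
    define s3 where "s3 = sem w (push UU) s2"
    note h3 = push[OF sk2 V2(2) un(1), simplified, folded s3_def]
    have sm13: "same {UU, PP, BKT, SIZE, ELT, POS, WT, AA, BB, QQ, LL, SP, FLAG, STK} s s3"
      by (rule same_mono[OF same_trans[OF sm12 h3(2)]]) auto
    have s3: "sem w down_body s = s3" using True by (simp add: body s3_def s2_def)
    have bk2: "buckets s2 (arcs E) b'" by (rule h2(1)) auto
    have bk3: "buckets s3 (arcs E) b'" by (rule buckets_same[OF h3(2) _ bk2]) auto
    have ow3: "owned s3 E own" by (rule owned_same[OF sm13 _ ow]) auto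
    have st3: "static s3" by (rule static_same[OF sm13 _ st]) auto
    have b'v: "b' v u = i - 1" "b' u v = b u v - 1" using u(2) by (auto simp: b'_def upd2_def)
    have b'_other: "b' x y = b x y" if "{x, y} \<noteq> {v, u}" for x y
      using that by (auto simp: b'_def upd2_def)
    \<comment> \<open>The freed position is \<open>p'\<close> itself and the arc goes to bucket
      \<open>i - 1\<close>, so the positions below \<open>p'\<close> keep their entries.\<close>
    have W3: "waiting s3 v i p' = waiting s v i p'"
    proof (rule waiting_cong)
      fix q assume q: "q < p'"
      have "words s3 ELT ((i * n + v) * n + q) = words s2 ELT ((i * n + v) * n + q)"
        using same_words[OF h3(2)] by simp
      also have "words s2 ELT ((i * n + v) * n + q) = words s1 ELT ((i * n + v) * n + q)"
        using h2(3)[of i q] iJ q p1 u iL by (simp add: s1_def)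
      finally show "words s3 ELT ((i * n + v) * n + q) = words s ELT ((i * n + v) * n + q)"
        by (simp add: s1_def)
    qed
    have ei': "edge_inv (if x = v \<and> y \<in> waiting s3 v i p' \<or> y = v \<and> x \<in> waiting s3 v i p'
        then lev else lev') b' own x y" if xy: "{x, y} \<in> E" for x y
    proof (cases "{x, y} = {v, u}")
      case True2: True
      have "offset v u (b v u) (b u v) \<longleftrightarrow> offset v u (b' v u) (b' u v)"
        "offset u v (b u v) (b v u) \<longleftrightarrow> offset u v (b' u v) (b' v u)"
        using offset_Suc[of v u "i - 1" "b u v - 1"] offset_Suc[of u v "b u v - 1" "i - 1"] iL pos
        by (simp_all add: b'v u(2))
      then have "edge_inv lev' b' own v u"
        using eu un buv True by (auto simp: edge_inv_def lev'_def b'v u(2))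
      with u_eq[OF True2] un u_nW show ?thesis
        by (auto simp: W3 edge_inv_sym[of _ _ _ u v])
    next
      case False
      have "{y, x} \<noteq> {v, u}" using False by (simp add: insert_commute)
      note b = b'_other[OF False] b'_other[OF this]
      show ?thesis unfolding W3 cond_other[OF False, symmetric]
        by (rule edge_inv_cong[OF ei[OF xy]]) (simp_all add: b)
    qed
    note lu = load_upd2[OF D(1) vu un(2), where g = "\<lambda>m. m - 1" and b = b, folded b'_def]
    have "load (arcs E) b v \<le> load (arcs E) b' v" "load (arcs E) b u \<le> load (arcs E) b' u"
      using lu(1,2) T_antimono[of "b v u - 1" "b v u"] T_antimono[of "b u v - 1" "b u v"] by simp_all
    then have mono: "load (arcs E) b x \<le> load (arcs E) b' x" for x
      using lu(3)[of x] by (cases "x = v \<or> x = u") auto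
    have sb': "stable (arcs E) b' lev x" if "x < n" "x \<notin> insert u D" for x
    proof -
      have "load (arcs E) b' x = load (arcs E) b x" using that vD by (intro lu(3)) auto
      then show ?thesis using stable_cong[of "arcs E" b' x b lev lev] sb[of x] that by simp
    qed
    have "p' \<le> words s3 SIZE (i * n + v)"
    proof -
      have fin: "finite {y. (v, y) \<in> arcs E \<and> b v y = i}"
        by (rule finite_subset[of _ "{..<n}"]) (use D(3) in auto)
      have eq: "{y. (v, y) \<in> arcs E \<and> b' v y = i} = {y. (v, y) \<in> arcs E \<and> b v y = i} - {u}"
        using u iL un by (auto simp: b'_def upd2_def)
      show ?thesis using buckets_card(1)[OF bk3 vn iJ] buckets_card(1)[OF bk vn iJ] psz u
        unfolding eq by (simp add: pS fin)
    qed
    then have "lowering E lev b0 v (b', own, insert u D, p') s3"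
      unfolding lowering_def prod.case i_def[symmetric] lev'_def[symmetric]
      using st3 bk3 ow3 h3(1) ei' sb' vD LV V I same_words[OF sm13] order_trans[OF ld mono[of v]]
        same_words[OF same_trans[OF sm2 h3(2)], of PP] by (auto simp: s1_def)
    moreover have "real step_time + (loop_potential E lev v b' (insert u D) + real (20 * step_time) * real p') \<le>
      loop_potential E lev v b D + real (20 * step_time) * real p"
    proof -
      have "mass (arcs E) b' = mass (arcs E) b + 2"
        using mass_upd2[OF D(1) vu un(2), where g = "\<lambda>m. m - 1" and b = b] pos
        by (simp add: b'_def of_nat_diff)
      moreover have "deficits (arcs E) b' lev ({..<n} - {v}) \<le> deficits (arcs E) b lev ({..<n} - {v})"
        by (rule deficits_mono[OF mono])
      moreover have "real (card (insert u D)) \<le> real (card D) + 1"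
        by (rule card_insert_real[OF stack_card(2)[OF sk]])
      ultimately have "1 + (9 * mass (arcs E) b' + 16 * deficits (arcs E) b' lev ({..<n} - {v}) + real (card (insert u D)))
         \<le> 9 * mass (arcs E) b + 16 * deficits (arcs E) b lev ({..<n} - {v}) + real (card D) + 20"
        by linarith
      from mult_left_mono[OF this, of "real step_time"] show ?thesis
        unfolding loop_potential_def pS by (simp add: distrib_left)
    qed
    ultimately show ?thesis unfolding s3 p'_def[symmetric] by blast
  next
    case False
    \<comment> \<open>The edge cannot go down at \<open>u\<close>, but \<open>u\<close> can own it.
      It stays on level \<open>i\<close> of \<open>v\<close>, above the new level of
      \<open>v\<close>.\<close>
    then have bu: "b u v = lev u" using buv by simp
    define own' where "own' = own({v, u} := u)"
    define s2 where "s2 = sem w (gain_owner UU) (sem w drop_owner s1)"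
    have ow1: "owned s1 E own" by (rule owned_same[OF sm1 _ ow]) auto
    note h2 = reassign[OF st1 ow1 u(1) V1 V1(2) un(1), simplified, folded s2_def own'_def]
    have sm12: "same {UU, PP, 3, 4, CNT, IX, OW} s s2"
      by (rule same_mono[OF same_trans[OF sm1 h2(2)]]) auto
    have s2: "sem w down_body s = s2" using False by (simp add: body s2_def)
    have st2: "static s2" by (rule static_same[OF sm12 _ st]) auto
    have bk2: "buckets s2 (arcs E) b" by (rule buckets_same[OF sm12 _ bk]) auto
    have sk2: "stack s2 D" by (rule stack_same[OF sm12 _ sk]) auto
    have W2: "waiting s2 v i p' = waiting s v i p'"
      by (rule waiting_cong) (use same_words[OF sm12] in simp)
    have ei': "edge_inv (if x = v \<and> y \<in> waiting s2 v i p' \<or> y = v \<and> x \<in> waiting s2 v i p'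
        then lev else lev') b own' x y" if xy: "{x, y} \<in> E" for x y
    proof (cases "{x, y} = {v, u}")
      case True
      have "edge_inv lev' b own' v u"
        using eu un bu by (auto simp: edge_inv_def lev'_def own'_def u(2))
      with u_eq[OF True] un u_nW show ?thesis
        by (auto simp: W2 edge_inv_sym[of _ _ _ u v])
    next
      case False
      have o: "own' {x, y} = own {x, y}" using False by (simp add: own'_def)
      show ?thesis unfolding W2 cond_other[OF False, symmetric]
        by (rule edge_inv_cong[OF ei[OF xy]]) (simp_all add: o)
    qed
    have "lowering E lev b0 v (b, own', D, p') s2"
      unfolding lowering_def prod.case i_def[symmetric] lev'_def[symmetric]
      using st2 bk2 h2(1) sk2 ei' sb vD LV V I same_words[OF sm12] ld psz
        same_words[OF h2(2), of PP] by (auto simp: s1_def pS)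
    moreover have "real step_time + (loop_potential E lev v b D + real (20 * step_time) * real p') \<le>
      loop_potential E lev v b D + real (20 * step_time) * real p"
      unfolding pS by (simp add: algebra_simps)
    ultimately show ?thesis unfolding s2 p'_def[symmetric] by blast
  qed
qed

text \<open>By \<open>deficit_lower\<close> the deficit of \<open>v\<close> yields 20 for each
  bucket entry, the credit used in \<open>down_body\<close>, and 2 more: one balances the level sum,
  which falls, and one is the \<open>step_time\<close> released.\<close>

lemma lower:
  assumes inv: "inv s E b lev own D" and vD: "v \<in> D"
    and V: "words s VV 0 = v" and I: "words s II 0 = lev v"
    and lt: "light (arcs E) b lev v"
  shows "\<exists>t s' b' lev' own' D'. exec w lower s t s' \<and> inv s' E b' lev' own' D' \<and>
     real t + potential E b' lev' D' + real step_time \<le> potential E b lev D + real (wtime bucket + 20)"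
proof -
  note iD = invD[OF inv]
  note st = iD(1) and bk = iD(2) and ow = iD(3) and sk = iD(4) and LV = iD(5) and cf = iD(6) and sb = iD(7)
  have vn: "v < n" using vD sk by (auto simp: stack_def)
  have E: "E \<subseteq> edges_on n" using cf by (simp add: config_def)
  have levL: "lev x \<le> L" if "x < n" for x using cf that by (simp add: config_def)
  have i0: "0 < lev v" using lt by (simp add: light_def)
  have iJ: "lev v \<le> J" using levL[OF vn] by (simp add: J_def)
  let ?lev' = "lev(v := lev v - 1)"
  define m where "m = words s SIZE (lev v * n + v)"
  define s0 where "s0 = set_word PP 0 m s"
  have s0: "sem w (setv PP (WGet SIZE bucket)) s = s0"
    using bucket_val[OF st V I vn iJ] by (simp add: s0_def m_def)
  have sm0: "same {PP} s s0" by (auto simp: s0_def same_def)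
  let ?c = "WLess (WLit 0) (var PP)"
  let ?\<Phi> = "\<lambda>(b, own, D, p). loop_potential E lev v b D + real (20 * step_time) * real p"
  have start: "lowering E lev b v (b, own, D, m) s0"
    unfolding lowering_def prod.case
  proof (intro conjI allI impI)
    fix x y assume xy: "{x, y} \<in> E"
    note e = config_edge[OF cf xy]
    have W: "z \<in> waiting s0 v (lev v) m" if "{v, z} \<in> E" "b v z = lev v" for z
    proof -
      have "words s ELT ((lev v * n + v) * n + words s POS (v * n + z)) = z"
        "words s POS (v * n + z) < m"
        using bucketsD(7,8)[OF bk, of v z] that by (simp_all add: m_def)
      then show ?thesis unfolding waiting_def by (intro image_eqI[of _ _ "words s POS (v * n + z)"]) (simp_all add: s0_def)
    qed
    show "edge_inv (if x = v \<and> y \<in> waiting s0 v (lev v) m \<or> y = v \<and> x \<in> waiting s0 v (lev v) m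
        then lev else ?lev') b own x y"
    proof (cases "x = v \<and> y \<in> waiting s0 v (lev v) m \<or> y = v \<and> x \<in> waiting s0 v (lev v) m")
      case False
      have "{y, x} \<in> E" using xy by (simp add: insert_commute)
      then have "\<not> (x = v \<and> b x y = lev v)" "\<not> (y = v \<and> b y x = lev v)" using False W xy by auto
      with False show ?thesis using e edge_ends[OF E xy] unfolding edge_inv_def by auto
    qed (use e in simp)
  next
    show "static s0" by (rule static_same[OF sm0 _ st]) auto
    show "buckets s0 (arcs E) b" by (rule buckets_same[OF sm0 _ bk]) auto
    show "owned s0 E own" by (rule owned_same[OF sm0 _ ow]) auto
    show "stack s0 D" by (rule stack_same[OF sm0 _ sk]) auto
  qed (use LV V I vD sb in \<open>auto simp: s0_def m_def\<close>)
  have guard: "bval w s ?c \<longleftrightarrow> 0 < p" if "lowering E lev b v (b1, own1, D1, p) s" for b1 own1 D1 p s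
    using that by (simp add: lowering_def)
  have step: "\<exists>g'. lowering E lev b v g' (sem w down_body s) \<and> real step_time + ?\<Phi> g' \<le> ?\<Phi> g"
    if g: "lowering E lev b v g s" "bval w s ?c" for g s
  proof -
    obtain b1 own1 D1 p where g': "g = (b1, own1, D1, p)" by (cases g)
    have p: "0 < p" using guard g unfolding g' by blast
    show ?thesis using down_body[OF g(1)[unfolded g'] p levL i0 vn] unfolding g' by force
  qed
  have bound: "0 \<le> ?\<Phi> g" if "lowering E lev b v g s" for g s
    using that by (auto simp: lowering_def intro!: add_nonneg_nonneg loop_potential_nonneg)
  have "\<exists>t s' g'. exec w (While ?c down_body) s0 t s' \<and> lowering E lev b v g' s' \<and> \<not> bval w s' ?c \<and>
      real t + ?\<Phi> g' \<le> ?\<Phi> (b, own, D, m) + real (1 + btime ?c)"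
    by (rule exec_While_sem[where I = "lowering E lev b v" and \<Phi> = ?\<Phi> and K = step_time, OF start loopfree_blocks(2)])
      (simp add: step_time_def, erule (1) step, erule bound)
  then obtain t s1 g where
    1: "exec w (While ?c down_body) s0 t s1" "lowering E lev b v g s1" "\<not> bval w s1 ?c"
      "real t + ?\<Phi> g \<le> loop_potential E lev v b D + real (20 * step_time) * real m + real (1 + btime ?c)"
    unfolding prod.case by blast
  obtain b' own' D' p where g: "g = (b', own', D', p)" by (cases g)
  have p0: "p = 0" using 1(2,3) guard unfolding g by blast
  have st1: "static s1" and bk1: "buckets s1 (arcs E) b'" and ow1: "owned s1 E own'" and sk1: "stack s1 D'"
    and LV1: "\<And>x. x < n \<Longrightarrow> words s1 LEV x = lev x" and V1: "words s1 VV 0 = v" "words s1 II 0 = lev v"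
    and vD1: "v \<in> D'"
    and ei: "\<And>x y. {x, y} \<in> E \<Longrightarrow> edge_inv (if x = v \<and> y \<in> waiting s1 v (lev v) p \<or> y = v \<and> x \<in> waiting s1 v (lev v) p
        then lev else ?lev') b' own' x y"
    and ld: "load (arcs E) b v \<le> load (arcs E) b' v"
    and sb1: "\<And>x. x < n \<Longrightarrow> x \<notin> D' \<Longrightarrow> stable (arcs E) b' lev x"
    using 1(2) unfolding g lowering_def prod.case by blast+
  have ei': "edge_inv ?lev' b' own' x y" if "{x, y} \<in> E" for x y
    using ei[OF that] by (simp add: p0 waiting_def)
  have lvw: "nat ((int (lev v) - 1) mod 2 ^ w) = lev v - 1"
    using word_diff[of 1 "lev v" w] i0 iJ J_bound by simp
  define s2 where "s2 = set_word LEV v (lev v - 1) s1"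
  have s2: "sem w (WSet LEV (var VV) (WSub (var II) (WLit 1))) s1 = s2"
    using V1 lvw small_lits(1) by (simp add: s2_def)
  have "(2::nat) ^ (lev v - 1) \<le> 2 ^ lev v" by (intro power_increasing) auto
  also have "\<dots> \<le> k v" using cf vn by (simp add: config_def)
  finally have "inv s2 E b' ?lev' own' D'"
    unfolding s2_def using cf levL[OF vn]
    by (intro set_level[OF st1 bk1 ow1 sk1 LV1 _ ei' _ _ vD1 sb1]) (auto simp: config_def)
  moreover obtain t0 where t0: "t0 \<le> max_time (setv PP (WGet SIZE bucket))"
    "exec w (setv PP (WGet SIZE bucket)) s t0 s0"
    using exec_sem[of "setv PP (WGet SIZE bucket)" w s] unfolding s0 by auto
  let ?tl = "1 + wtime (var VV) + wtime (WSub (var II) (WLit 1))"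
  have "exec w (Seq (While ?c down_body) (WSet LEV (var VV) (WSub (var II) (WLit 1)))) s0 (t + ?tl) s2"
    by (rule exec.Seq[OF 1(1)]) (use exec.WSet[of w LEV "var VV" "WSub (var II) (WLit 1)" s1] s2 in simp)
  from exec.Seq[OF t0(2) this] have "exec w lower s (t0 + (t + ?tl)) s2"
    unfolding lower_def .
  moreover have "real (t0 + (t + ?tl)) + potential E b' ?lev' D' + real step_time
     \<le> potential E b lev D + real (wtime bucket + 20)"
  proof -
    \<comment> \<open>Each entry of the bucket has weight \<open>T (lev v)\<close>, so the load of a
      light vertex also limits the number of edges to be scanned.\<close>
    have mT: "m * T (lev v) \<le> load (arcs E) b v"
      using load_ge_card[OF arcs_subset[OF E], of v b "lev v"] buckets_card(1)[OF bk vn iJ] by (simp add: m_def)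
    have dl: "16 * deficit (lev v - 1) (load (arcs E) b' v) + 20 * real m + 2 \<le> 16 * deficit (lev v) (load (arcs E) b v)"
      by (rule deficit_lower) (use lt ld i0 levL[OF vn] mT in \<open>auto simp: light_def\<close>)
    have d1: "deficits (arcs E) b' ?lev' {..<n} = deficit (lev v - 1) (load (arcs E) b' v) + deficits (arcs E) b' lev ({..<n} - {v})"
    proof -
      have "deficits (arcs E) b' ?lev' ({..<n} - {v}) = deficits (arcs E) b' lev ({..<n} - {v})"
        by (rule deficits_cong) simp
      then show ?thesis using deficits_insert[OF vn, of "arcs E" b' ?lev'] by simp
    qed
    have d2: "deficits (arcs E) b lev {..<n} = deficit (lev v) (load (arcs E) b v) + deficits (arcs E) b lev ({..<n} - {v})"
      using deficits_insert[OF vn, of "arcs E" b lev] .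
    have d3: "real (\<Sum>x<n. ?lev' x) = real (\<Sum>x<n. lev x) - 1"
      using sum_level_upd[OF vn, of lev "lev v - 1"] i0 by linarith
    have "loop_potential E lev v b D + real (20 * step_time) * real m + real step_time * 2 +
        real step_time * (16 * deficit (lev v - 1) (load (arcs E) b' v)) - real step_time * real (\<Sum>x<n. lev x)
      \<le> potential E b lev D"
      using mult_left_mono[OF dl, of "real step_time"]
      unfolding potential_def loop_potential_def d2 by (simp add: algebra_simps)
    moreover have "potential E b' ?lev' D' + real step_time = loop_potential E lev v b' D' + real step_time * 2 +
        real step_time * (16 * deficit (lev v - 1) (load (arcs E) b' v)) - real step_time * real (\<Sum>x<n. lev x)"
      unfolding potential_def loop_potential_def d1 d3 by (simp add: algebra_simps)
    moreover have "real t + loop_potential E lev v b' D' \<le>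
        loop_potential E lev v b D + real (20 * step_time) * real m + real (1 + btime ?c)"
      using 1(4) by (simp add: g p0)
    ultimately show ?thesis using t0(1) by simp
  qed
  ultimately show ?thesis by blast
qed

subsection \<open>The repair loop\<close>

lemma too_heavy:
  assumes inv: "inv s E b lev own D" and V: "words s VV 0 = v" "v < n" and I: "words s II 0 = lev v"
  shows "bval w s too_heavy \<longleftrightarrow> heavy (arcs E) b lev v"
proof -
  have st: "static s" and bk: "buckets s (arcs E) b" and cf: "config E b lev own"
    using inv by (auto simp: inv_def)
  have iL: "lev v \<le> L" using cf V by (simp add: config_def)
  have "2 * 2 ^ L < (2 :: nat) ^ w"
  proof -
    have "n \<le> n ^ 2" by (simp add: power2_eq_square)
    then show ?thesis using L_upper poly_bounds(2) by linarith
  qed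
  moreover have "2 * 2 ^ lev v \<le> 2 * (2 :: nat) ^ L" using iL by simp
  ultimately have b: "2 * 2 ^ L < (2::nat) ^ w" "2 * 2 ^ lev v < (2::nat) ^ w" by linarith+
  have "2 ^ L div T (lev v) = 2 ^ lev v"
  proof -
    have "(2::nat) ^ L = 2 ^ lev v * 2 ^ (L - lev v)" using iL by (simp add: power_add[symmetric])
    then show ?thesis using iL by (simp add: T_le)
  qed
  then show ?thesis
    using b staticD(5)[OF st V(2), simplified]
    by (auto simp: too_heavy_def heavy_def staticD(1-4)[OF st] V(1) I bucketsD(6)[OF bk V(2)])
qed

lemma too_light:
  assumes inv: "inv s E b lev own D" and V: "words s VV 0 = v" "v < n" and I: "words s II 0 = lev v"
  shows "bval w s too_light \<longleftrightarrow> light (arcs E) b lev v"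
proof -
  have st: "static s" and bk: "buckets s (arcs E) b" using inv by (auto simp: inv_def)
  have "4 * load (arcs E) b v < 2 ^ w"
    using load_le[OF bucketsD(1)[OF bk], of b v] poly_bounds(2) by linarith
  then show ?thesis
    by (simp add: too_light_def light_def staticD(1-4)[OF st] V(1) I bucketsD(6)[OF bk V(2)])
qed

text \<open>Raising and lowering each release one \<open>step_time\<close>, and so does popping, by
  way of \<open>card D\<close>. This covers fetching and testing the vertex, with 10 left for the
  test of the surrounding loop.\<close>

lemma repair_body:
  assumes inv: "inv s E b lev own D" and ne: "D \<noteq> {}"
  shows "\<exists>t s' b' lev' own' D'. exec w repair_body s t s' \<and> inv s' E b' lev' own' D' \<and>
     real t + 10 + potential E b' lev' D' \<le> potential E b lev D"
proof -
  note iD = invD[OF inv]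
  note st = iD(1) and bk = iD(2) and ow = iD(3) and sk = iD(4) and LV = iD(5) and cf = iD(6) and sb = iD(7)
  note top = stack_top[OF sk ne]
  define v where "v = words s STK (words s SP 0 - 1)"
  have vD: "v \<in> D" using top(1) by (simp add: v_def)
  have vn: "v < n" using vD sk by (auto simp: stack_def)
  define s1 where "s1 = sem w fetch s"
  have s1: "s1 = set_word II 0 (lev v) (set_word VV 0 v s)"
    using top(2) small_lits(1) LV[OF vn] by (simp add: s1_def fetch_def v_def)
  have sm: "same {II, VV} s s1" by (auto simp: s1 same_def)
  have inv1: "inv s1 E b lev own D" by (rule inv_same[OF inv sm]) auto
  have V1: "words s1 VV 0 = v" "words s1 II 0 = lev v" by (simp_all add: s1)
  obtain t0 where t0: "t0 \<le> max_time fetch" "exec w fetch s t0 s1"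
    using exec_sem[OF loopfree_blocks(3), of w s] by (auto simp: s1_def)
  define t1 where "t1 = t0 + (1 + btime too_heavy) + (1 + btime too_light)"
  have K: "t1 + max_time pop + 10 \<le> step_time" "t1 + wtime bucket + 30 \<le> step_time"
    using t0(1) by (simp_all add: t1_def step_time_def)
  note th = too_heavy[OF inv1 V1(1) vn V1(2)] and tl = too_light[OF inv1 V1(1) vn V1(2)]
  show ?thesis
  proof (cases "heavy (arcs E) b lev v")
    case True
    obtain t s' b' lev' own' D' where r: "exec w raise s1 t s'" "inv s' E b' lev' own' D'"
      "real t + potential E b' lev' D' + real step_time \<le> potential E b lev D + real (wtime bucket + 20)"
      using raise[OF inv1 vD V1 True] by blast
    have "exec w repair_body s (t0 + (1 + btime too_heavy + t)) s'"
      unfolding repair_body_def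
      by (rule exec.Seq[OF t0(2) exec.CondTrue[OF _ r(1)]]) (use True th in simp)
    moreover have "real (t0 + (1 + btime too_heavy + t)) + 10 + potential E b' lev' D' \<le> potential E b lev D"
      using r(3) K(2) by (simp add: t1_def)
    ultimately show ?thesis using r(2) by blast
  next
    case nh: False
    show ?thesis
    proof (cases "light (arcs E) b lev v")
      case True
      obtain t s' b' lev' own' D' where r: "exec w lower s1 t s'" "inv s' E b' lev' own' D'"
        "real t + potential E b' lev' D' + real step_time \<le> potential E b lev D + real (wtime bucket + 20)"
        using lower[OF inv1 vD V1 True] by blast
      have "exec w repair_body s (t0 + (1 + btime too_heavy + (1 + btime too_light + t))) s'"
        unfolding repair_body_def
        by (rule exec.Seq[OF t0(2) exec.CondFalse[OF _ exec.CondTrue[OF _ r(1)]]]) (use True nh th tl in simp_all)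
      moreover have "real (t0 + (1 + btime too_heavy + (1 + btime too_light + t))) + 10 + potential E b' lev' D' \<le> potential E b lev D"
        using r(3) K(2) by (simp add: t1_def)
      ultimately show ?thesis using r(2) by blast
    next
      case nl: False
      have sk1: "stack s1 D" using inv1 by (simp add: inv_def)
      define s2 where "s2 = sem w pop s1"
      have "words s1 VV 0 = words s1 STK (words s1 SP 0 - 1)" by (simp add: s1 v_def)
      note h = pop[OF sk1 ne this, folded s2_def, unfolded V1(1)]
      obtain t where t: "t \<le> max_time pop" "exec w pop s1 t s2"
        using exec_sem[OF loopfree_blocks(4), of w s1] by (auto simp: s2_def)
      have "exec w repair_body s (t0 + (1 + btime too_heavy + (1 + btime too_light + t))) s2"
        unfolding repair_body_def
        by (rule exec.Seq[OF t0(2) exec.CondFalse[OF _ exec.CondFalse[OF _ t(2)]]]) (use nh nl th tl in simp_all)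
      moreover have "inv s2 E b lev own (D - {v})"
        unfolding inv_def
      proof (intro conjI allI impI)
        show "static s2" by (rule static_same[OF h(2)]) (use inv1 in \<open>auto simp: inv_def\<close>)
        show "buckets s2 (arcs E) b" by (rule buckets_same[OF h(2)]) (use inv1 in \<open>auto simp: inv_def\<close>)
        show "owned s2 E own" by (rule owned_same[OF h(2)]) (use inv1 in \<open>auto simp: inv_def\<close>)
        show "stack s2 (D - {v})" by (rule h(1))
        show "config E b lev own" by fact
        show "words s2 LEV x = lev x" if "x < n" for x
          using inv1 that same_words[OF h(2)] by (simp add: inv_def)
        show "\<not> heavy (arcs E) b lev x" "\<not> light (arcs E) b lev x" if "x < n" "x \<notin> D - {v}" for x
          using sb[OF that(1)] that nh nl by auto
      qed
      moreover have "real (t0 + (1 + btime too_heavy + (1 + btime too_light + t))) + 10 + potential E b lev (D - {v}) \<le> potential E b lev D"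
      proof -
        have "0 < card D" using vD stack_card(2)[OF sk] card_gt_0_iff by blast
        then have "real (card D) = real (card (D - {v})) + 1"
          using vD stack_card(2)[OF sk] by (simp add: of_nat_diff)
        then have "potential E b lev (D - {v}) = potential E b lev D - real step_time"
          unfolding potential_def by (simp only: algebra_simps)
        then show ?thesis using K(1) t(1) by (simp add: t1_def)
      qed
      ultimately show ?thesis by blast
    qed
  qed
qed

lemma repair:
  assumes "inv s E b lev own D"
  shows "\<exists>t s' b' lev' own'. exec w repair s t s' \<and> inv s' E b' lev' own' {} \<and>
     real t + potential E b' lev' {} \<le> potential E b lev D + 10"
proof -
  let ?I = "\<lambda>(b, lev, own, D) s. inv s E b lev own D"
  let ?\<Phi> = "\<lambda>(b, lev, own :: nat set \<Rightarrow> nat, D). potential E b lev D"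
  let ?c = "WLess (WLit 0) (var SP)"
  have guard: "bval w s ?c \<longleftrightarrow> D \<noteq> {}" if "inv s E b lev own D" for s b lev own D
  proof -
    have sk: "stack s D" using that by (simp add: inv_def)
    then have "words s SP 0 = card D" by (simp add: stack_def)
    then show ?thesis using stack_card(2)[OF sk] by (simp add: card_gt_0_iff)
  qed
  have start: "?I (b, lev, own, D) s" using assms by simp
  have step: "\<exists>t s' g'. exec w repair_body s t s' \<and> ?I g' s' \<and> real t + real (1 + btime ?c) + ?\<Phi> g' \<le> ?\<Phi> g"
    if g: "?I g s" "bval w s ?c" for g s
  proof -
    obtain b lev own D where g': "g = (b, lev, own, D)" by (cases g)
    have i: "inv s E b lev own D" using g(1) by (simp add: g')
    obtain t s' b' lev' own' D' where "exec w repair_body s t s'" "inv s' E b' lev' own' D'"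
      "real t + 10 + potential E b' lev' D' \<le> potential E b lev D"
      using repair_body[OF i] guard[OF i] g(2) by blast
    then show ?thesis
      by (intro exI[of _ t] exI[of _ s'] exI[of _ "(b', lev', own', D')"]) (simp add: g')
  qed
  \<comment> \<open>The potential may be negative, but only through the level sum. This crude bound
    gives termination and does not enter the running time.\<close>
  have bound: "- (real step_time * real (n * L)) \<le> ?\<Phi> g" if "?I g s" for g s
  proof -
    obtain b lev own D where g': "g = (b, lev, own, D)" by (cases g)
    have i: "buckets s (arcs E) b" "config E b lev own" using that by (simp_all add: g' inv_def)
    have "(\<Sum>x<n. lev x) \<le> (\<Sum>x<n. L)" using i(2) by (intro sum_mono) (simp add: config_def)
    then have "real (\<Sum>x<n. lev x) \<le> real (n * L)" by (simp only: of_nat_le_iff) simp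
    then have "- real (n * L) \<le> 9 * mass (arcs E) b + 16 * deficits (arcs E) b lev {..<n} -
     real (\<Sum>x<n. lev x) + real (card D)"
      using mass_nonneg[OF i(1)] deficits_nonneg[of "arcs E" b lev "{..<n}"] by linarith
    from mult_left_mono[OF this, of "real step_time"] show ?thesis by (simp add: g' potential_def)
  qed
  have "\<exists>t s' g'. exec w (While ?c repair_body) s t s' \<and> ?I g' s' \<and> \<not> bval w s' ?c \<and>
      real t + ?\<Phi> g' \<le> ?\<Phi> (b, lev, own, D) + real (1 + btime ?c)"
    by (rule exec_While[where I = ?I and \<Phi> = ?\<Phi> and l = "- (real step_time * real (n * L))", OF start])
      (erule (1) step, erule bound)
  then obtain t s' b' lev' own' D' where 1: "exec w repair s t s'" "inv s' E b' lev' own' D'"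
    "\<not> bval w s' ?c" "real t + potential E b' lev' D' \<le> potential E b lev D + real (1 + btime ?c)"
    unfolding repair_def by auto
  have "D' = {}" using guard[OF 1(2)] 1(3) by blast
  with 1 show ?thesis by (intro exI[of _ t] exI[of _ s'] exI[of _ b'] exI[of _ lev'] exI[of _ own']) simp
qed


section \<open>Processing updates\<close>

lemma mass_le_subset:
  assumes "H' \<subseteq> H" "buckets s H b" shows "mass H' b \<le> mass H b"
proof -
  have "finite H" by (rule finite_subset[OF bucketsD(1)[OF assms(2)]]) simp
  then show ?thesis
    unfolding mass_def using assms by (intro sum_mono2) (auto simp: bucketsD)
qed

lemma mass_insert:
  assumes "finite H" "(x, y) \<notin> H"
  shows "mass (insert (x, y) H) b = mass H b + (real J - real (b x y))"
  using assms by (simp add: mass_def)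

lemma mass_cong:
  "(\<And>x y. (x, y) \<in> H \<Longrightarrow> b x y = b' x y) \<Longrightarrow> mass H b = mass H b'"
  unfolding mass_def by (intro sum.cong) auto

text \<open>34 is \<open>2 * 16 + 2\<close>: each end loses one arc, of weight at most that of its
  own level, so its deficit rises by at most 1, and both ends are pushed. \<open>mass\<close> does
  not grow.\<close>

lemma delete_edge:
  assumes inv: "inv s E b lev own {}" and e: "{u, v} \<in> E"
    and arg: "words s 2 0 = u" "words s 2 1 = v"
  shows "inv (sem w delete_edge s) (E - {{u, v}}) b lev own {u, v} \<and>
    potential (E - {{u, v}}) b lev {u, v} \<le> potential E b lev {} + real (34 * step_time)"
proof -
  note iD = invD[OF inv]
  note st = iD(1) and bk = iD(2) and ow = iD(3) and sk = iD(4) and LV = iD(5) and cf = iD(6) and sb = iD(7)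
  have E: "E \<subseteq> edges_on n" using cf by (simp add: config_def)
  have un: "u < n" "v < n" "u \<noteq> v" using edge_ends[OF E e] by auto
  let ?E = "E - {{u, v}}"
  let ?H1 = "arcs E - {(u, v)}"
  let ?H2 = "?H1 - {(v, u)}"
  have vu: "{v, u} \<in> E" using e by (simp add: insert_commute)
  have A: "(u, v) \<in> arcs E" "(v, u) \<in> ?H1" using e vu un by auto
  have H2: "arcs ?E = ?H2" by (auto simp: arcs_def doubleton_eq_iff)
  define s1 where "s1 = set_word VV 0 v (set_word UU 0 u s)"
  have s1: "sem w (setv VV (WGet 2 (WLit 1))) (sem w (setv UU (WGet 2 (WLit 0))) s) = s1"
    using arg small_lits(1) by (simp add: s1_def)
  have sm1: "same {UU, VV} s s1" by (auto simp: s1_def same_def)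
  have st1: "static s1" by (rule static_same[OF sm1 _ st]) auto
  have bk1: "buckets s1 (arcs E) b" by (rule buckets_same[OF sm1 _ bk]) auto
  have V1: "words s1 UU 0 = u" "words s1 VV 0 = v" by (simp_all add: s1_def)
  define s2 where "s2 = sem w (half_rem UU VV) s1"
  note h2 = half_rem[OF st1 bk1 A(1) V1(1) _ _ V1(2), simplified, folded s2_def]
  have st2: "static s2" by (rule static_same[OF h2(2) _ st1]) auto
  have V2: "words s2 UU 0 = u" "words s2 VV 0 = v" using V1 same_words[OF h2(2)] by simp_all
  define s3 where "s3 = sem w (half_rem VV UU) s2"
  note h3 = half_rem[OF st2 h2(1) A(2) V2(2) _ _ V2(1), simplified, folded s3_def]
  have st3: "static s3" by (rule static_same[OF h3(2) _ st2]) auto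
  have V3: "words s3 UU 0 = u" "words s3 VV 0 = v" using V2 same_words[OF h3(2)] by simp_all
  have sm13: "same {UU, VV, SIZE, ELT, POS, WT, AA, BB, QQ, LL} s s3"
    by (rule same_mono[OF same_trans[OF sm1 same_trans[OF h2(2) h3(2)]]]) auto
  have ow3: "owned s3 E own" by (rule owned_same[OF sm13 _ ow]) auto
  have sk3: "stack s3 {}" by (rule stack_same[OF sm13 _ sk]) auto
  define s4 where "s4 = sem w drop_owner s3"
  note h4 = drop_owner[OF st3 ow3 vu V3(2,1), folded s4_def]
  have sk4: "stack s4 {}" by (rule stack_same[OF h4(2) _ sk3]) auto
  have V4: "words s4 UU 0 = u" "words s4 VV 0 = v" using V3 same_words[OF h4(2)] by simp_all
  define s5 where "s5 = sem w (push UU) s4"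
  note h5 = push[OF sk4 V4(1) un(1), simplified, folded s5_def]
  have V5: "words s5 VV 0 = v" using V4 same_words[OF h5(2)] by simp
  define s6 where "s6 = sem w (push VV) s5"
  note h6 = push[OF h5(1) V5 un(2), simplified, folded s6_def]
  have fin: "sem w delete_edge s = s6"
    unfolding delete_edge_def sem.simps(4) s1 s2_def[symmetric] s3_def[symmetric] s4_def[symmetric]
      s5_def[symmetric] s6_def ..
  have sm46: "same {SP, FLAG, STK} s4 s6" using same_trans[OF h5(2) h6(2)] by simp
  have sm36: "same {3, CNT, IX, OW, SP, FLAG, STK} s3 s6"
    by (rule same_mono[OF same_trans[OF h4(2) sm46]]) auto
  have load2: "load ?H2 b x = load (arcs E) b x" if "x \<noteq> u" "x \<noteq> v" for x
    using load_remove(1)[OF bucketsD(1)[OF bk] A(1), of b x] load_remove(1)[OF bucketsD(1)[OF h2(1)] A(2), of b x]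
      that by simp
  have "inv s6 ?E b lev own {u, v}"
    unfolding inv_def
  proof (intro conjI allI impI)
    show "static s6" by (rule static_same[OF sm36 _ st3]) auto
    show "buckets s6 (arcs ?E) b" unfolding H2 by (rule buckets_same[OF sm36 _ h3(1)]) auto
    show "owned s6 ?E own"
      by (rule owned_same[OF sm46]) (use h4(1) in \<open>auto simp: insert_commute\<close>)
    show "stack s6 {u, v}" using h6(1) by (simp add: insert_commute)
    show "words s6 LEV x = lev x" if "x < n" for x
      using LV[OF that] same_words[OF sm36] same_words[OF sm13] by simp
    show "config ?E b lev own" using cf by (auto simp: config_def)
    show "\<not> heavy (arcs ?E) b lev x" "\<not> light (arcs ?E) b lev x" if "x < n" "x \<notin> {u, v}" for x
      using sb[OF that(1)] load2[of x] that by (auto simp: heavy_def light_def H2)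
  qed
  moreover have "potential ?E b lev {u, v} \<le> potential E b lev {} + real (34 * step_time)"
  proof -
    have levL: "lev x \<le> L" if "x < n" for x using cf that by (simp add: config_def)
    have ei: "lev u \<le> b u v" "lev v \<le> b v u" using config_edge[OF cf e] by (auto simp: edge_inv_def)
    have "deficits ?H1 b lev {..<n} \<le> deficits (arcs E) b lev {..<n} + 1"
    proof (rule deficits_drop[of _ u])
      show "load (arcs E) b x \<le> load ?H1 b x" if "x \<noteq> u" for x
        using load_remove(1)[OF bucketsD(1)[OF bk] A(1), of b x] that by simp
      show "load (arcs E) b u \<le> load ?H1 b u + T (lev u)"
        using load_remove(1)[OF bucketsD(1)[OF bk] A(1), of b u] T_antimono[OF ei(1)] by simp
    qed (use levL un in auto)
    moreover have "deficits ?H2 b lev {..<n} \<le> deficits ?H1 b lev {..<n} + 1"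
    proof (rule deficits_drop[of _ v])
      show "load ?H1 b x \<le> load ?H2 b x" if "x \<noteq> v" for x
        using load_remove(1)[OF bucketsD(1)[OF h2(1)] A(2), of b x] that by simp
      show "load ?H1 b v \<le> load ?H2 b v + T (lev v)"
        using load_remove(1)[OF bucketsD(1)[OF h2(1)] A(2), of b v] T_antimono[OF ei(2)] by simp
    qed (use levL un in auto)
    moreover have "mass ?H2 b \<le> mass (arcs E) b" by (rule mass_le_subset[OF _ bk]) auto
    moreover have "card {u, v} = 2" using un by simp
    ultimately have "9 * mass ?H2 b + 16 * deficits ?H2 b lev {..<n} - real (\<Sum>x<n. lev x) + real (card {u, v})
      \<le> 9 * mass (arcs E) b + 16 * deficits (arcs E) b lev {..<n} - real (\<Sum>x<n. lev x) + real (card ({} :: nat set)) + 34"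
      by simp
    from mult_left_mono[OF this, of "real step_time"] show ?thesis
      unfolding potential_def H2 by (simp add: distrib_left)
  qed
  ultimately show ?thesis by (simp add: fin)
qed

lemma sort_ends:
  assumes st: "static s" and uv: "u < n" "v < n"
    and arg: "words s 2 0 = u" "words s 2 1 = v"
  defines "s' \<equiv> sem w sort_ends s"
  shows "\<exists>x y. {x, y} = {u, v} \<and> c x \<le> c y \<and> words s' UU 0 = x \<and> words s' VV 0 = y \<and>
    words s' SS 0 = 0 \<and> reals s' 1 0 = c x \<and> same {UU, VV, SS} s s'"
proof (cases "c v < c u")
  case True
  have "s' = set_real 1 0 (c v) (set_word SS 0 0 (set_word VV 0 u (set_word UU 0 v s)))"
    using True arg small_lits(1) by (simp add: s'_def sort_ends_def staticD(6)[OF st] uv)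
  then show ?thesis using True by (intro exI[of _ v] exI[of _ u]) (auto simp: same_def)
next
  case False
  have "s' = set_real 1 0 (c u) (set_word SS 0 0 (set_word VV 0 v (set_word UU 0 u s)))"
    using False arg small_lits(1) by (simp add: s'_def sort_ends_def staticD(6)[OF st] uv)
  then show ?thesis using False by (intro exI[of _ u] exI[of _ v]) (auto simp: same_def)
qed

text \<open>The loop stops because another doubling would exceed \<open>c v\<close> or because the
  count has reached \<open>L + 1\<close>; these are the two ways in which \<open>offset\<close> can
  hold. Only the difference of the levels matters, hence the claim for all \<open>j\<close>: the
  actual levels are still to be chosen.\<close>

lemma offset_loop:
  assumes st: "static s" and U: "words s UU 0 = u" "words s VV 0 = v" "u < n" "v < n"
    and le: "c u \<le> c v" and S: "words s SS 0 = 0" "reals s 1 0 = c u"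
  shows "\<exists>t s' i. exec w (While offset_test offset_body) s t s' \<and> same {SS} s s' \<and> words s' SS 0 = i \<and>
    (\<forall>j. offset u v j (j + i)) \<and> t \<le> step_time * (L + 2)"
proof -
  let ?I = "\<lambda>i s'. same {SS} s s' \<and> words s' SS 0 = i \<and> reals s' 1 0 = c u * 2 ^ i \<and> c u * 2 ^ i \<le> c v \<and> i \<le> L + 1"
  let ?\<Phi> = "\<lambda>i. real step_time * (real (L + 1) - real i)"
  have guard: "bval w s' offset_test \<longleftrightarrow> i \<le> L \<and> c u * 2 ^ (i + 1) \<le> c v" if "?I i s'" for i s'
  proof -
    have st': "static s'" by (rule static_same[OF _ _ st, of "{SS}"]) (use that in auto)
    have "words s' VV 0 = v" using that U by (auto simp: same_def)
    then show ?thesis using that U by (auto simp: offset_test_def staticD[OF st'] not_less mult.commute mult.left_commute)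
  qed
  have "\<exists>t s' g'. exec w (While offset_test offset_body) s t s' \<and> ?I g' s' \<and> \<not> bval w s' offset_test \<and>
      real t + ?\<Phi> g' \<le> ?\<Phi> 0 + real (1 + btime offset_test)"
  proof (rule exec_While_sem[where I = ?I and \<Phi> = ?\<Phi> and K = step_time, OF _ loopfree_blocks(6)])
    show "?I 0 s" using S le by (simp add: same_def)
    show "0 \<le> ?\<Phi> i" if "?I i s'" for i s' using that by simp
    show "max_time offset_body + (1 + btime offset_test) \<le> step_time" by (simp add: step_time_def)
  next
    fix i s' assume I: "?I i s'" and c: "bval w s' offset_test"
    then have i: "i \<le> L" "c u * 2 ^ (i + 1) \<le> c v" using guard by blast+
    have "i + 1 \<le> J" using i by (simp add: J_def)
    then have "Suc i < 2 ^ w" using J_bound by simp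
    then have s2: "sem w offset_body s' = set_word SS 0 (Suc i) (set_real 1 0 (2 * (c u * 2 ^ i)) s')"
      using I small_lits(1) by (simp add: offset_body_def)
    have "?I (i + 1) (sem w offset_body s')" using I i by (auto simp: s2 same_def)
    moreover have "real step_time + ?\<Phi> (i + 1) \<le> ?\<Phi> i" by (simp add: algebra_simps)
    ultimately show "\<exists>g'. ?I g' (sem w offset_body s') \<and> real step_time + ?\<Phi> g' \<le> ?\<Phi> i" by blast
  qed
  then obtain t s' i where 1: "exec w (While offset_test offset_body) s t s'" "?I i s'"
    "\<not> bval w s' offset_test" "real t + ?\<Phi> i \<le> ?\<Phi> 0 + real (1 + btime offset_test)" by blast
  have "offset u v j (j + i)" for j
    using 1(2) le guard[OF 1(2)] 1(3) by (auto simp: offset_def)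
  moreover have "t \<le> step_time * (L + 2)"
  proof -
    have "0 \<le> ?\<Phi> i" using 1(2) by simp
    moreover have "1 + btime offset_test \<le> step_time" by (simp add: step_time_def)
    ultimately have "real t \<le> real step_time * real (L + 1) + real step_time"
      using 1(4) by simp
    also have "\<dots> = real (step_time * (L + 2))" by (simp add: algebra_simps)
    finally show ?thesis by (simp only: of_nat_le_iff)
  qed
  ultimately show ?thesis using 1 by blast
qed

text \<open>Accounts: the two new arcs add at most \<open>2 * J\<close> to \<open>mass\<close>, with
  weight 9, and both ends are pushed. Loads never fall, so no deficit rises.\<close>

lemma insert_edge:
  assumes inv: "inv s E b lev own {}" and e: "{u, v} \<notin> E" "{u, v} \<in> edges_on n"
    and U: "words s UU 0 = u" "words s VV 0 = v" and S: "words s SS 0 = i"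
    and off: "\<And>j. offset u v j (j + i)"
  shows "\<exists>b' own'. inv (sem w insert_edge s) (insert {u, v} E) b' lev own' {u, v} \<and>
    potential (insert {u, v} E) b' lev {u, v} \<le> potential E b lev {} + real (step_time * (18 * J + 2))"
proof -
  note iD = invD[OF inv]
  note st = iD(1) and bk = iD(2) and ow = iD(3) and sk = iD(4) and LV = iD(5) and cf = iD(6) and sb = iD(7)
  have E: "E \<subseteq> edges_on n" using cf by (simp add: config_def)
  let ?E = "insert {u, v} E"
  have E': "?E \<subseteq> edges_on n" using E e by simp
  have un: "u < n" "v < n" "u \<noteq> v" using edge_ends[OF E', of u v] by auto
  have levL: "lev x \<le> L" if "x < n" for x using cf that by (simp add: config_def)
  have iL: "i \<le> L + 1" using off[of 0] by (simp add: offset_def)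
  define bu bv z where "bu = (if lev u + i < lev v then lev v - i else lev u)"
    and "bv = (if lev u + i < lev v then lev v else lev u + i)"
    and "z = (if lev u + i < lev v then v else u)"
  have bJ: "bu \<le> J" "bv \<le> J" using levL[OF un(1)] levL[OF un(2)] iL by (auto simp: bu_def bv_def J_def)
  have bo: "bv = bu + i" by (auto simp: bu_def bv_def)
  define b' where "b' = b(u := (b u)(v := bu), v := (b v)(u := bv))"
  have b': "b' u v = bu" "b' v u = bv" "\<And>x y. {x, y} \<noteq> {u, v} \<Longrightarrow> b' x y = b x y"
    using un by (auto simp: b'_def)
  let ?H1 = "insert (u, v) (arcs E)"
  let ?H2 = "insert (v, u) ?H1"
  have H2: "arcs ?E = ?H2" by (auto simp: arcs_def doubleton_eq_iff)
  have A: "(u, v) \<notin> arcs E" "(v, u) \<notin> arcs E" "(v, u) \<notin> ?H1" using e un by (auto simp: insert_commute)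
  have b'E: "b' x y = b x y" if "(x, y) \<in> arcs E" for x y using that A by (intro b'(3)) (auto simp: doubleton_eq_iff)
  define q where "q = set_word ZZ 0 z (set_word PP 0 bu (set_word II 0 bv s))"
  have w1: "lev u + i < 2 ^ w" "lev v < 2 ^ w"
    using J_bound levL[OF un(1)] levL[OF un(2)] iL by (simp_all add: J_def)
  have smq: "same {ZZ, PP, II} s q" by (auto simp: q_def same_def)
  have stq: "static q" by (rule static_same[OF smq _ st]) auto
  have bkq: "buckets q (arcs E) b" by (rule buckets_same[OF smq _ bk]) auto
  have Uq: "words q UU 0 = u" "words q VV 0 = v" "wval w q (var PP) = bu" by (simp_all add: q_def U)
  define r where "r = sem w (set_bkt UU VV (var PP)) q"
  note k1 = set_bkt[OF stq bkq A(1) un(1,2) Uq(1,2), of "var PP", folded r_def, unfolded Uq(3)]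
  have str: "static r" by (rule static_same[OF k1(2) _ stq]) auto
  have Ur: "words r UU 0 = u" "words r VV 0 = v" "wval w r (var II) = bv"
    using same_words[OF k1(2)] Uq by (simp_all add: q_def)
  define s1 where "s1 = sem w (set_bkt VV UU (var II)) r"
  note k2 = set_bkt[OF str k1(1) A(2) un(2,1) Ur(2,1), of "var II", folded s1_def, unfolded Ur(3)]
  have place: "sem w place_edge s = s1"
    unfolding place_edge_def s1_def r_def q_def z_def bu_def bv_def using w1 word_diff[of i "lev v" w]
    by (simp add: U S LV un)
  have "b' = (b(u := (b u)(v := bu)))(v := ((b(u := (b u)(v := bu))) v)(u := bv))"
    using un by (auto simp: b'_def fun_eq_iff)
  then have "buckets s1 (arcs E) b'" using k2(1) by (simp only:)
  moreover have "same {BKT, ZZ, PP, II} s s1"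
    by (rule same_mono[OF same_trans[OF same_trans[OF smq k1(2)] k2(2)]]) auto
  moreover have "words s1 BKT (u * n + v) = bu" "words s1 BKT (v * n + u) = bv" "words s1 ZZ 0 = z"
    using k1(3) k2(3) un same_words[OF k1(2)] same_words[OF k2(2)] by (simp_all add: q_def ix_inj)
  ultimately have bk1: "buckets s1 (arcs E) b'" and sm1: "same {BKT, ZZ, PP, II} s s1"
    and B1: "words s1 BKT (u * n + v) = b' u v" "words s1 BKT (v * n + u) = b' v u" and Z1: "words s1 ZZ 0 = z"
    by (simp_all add: b')
  have zn: "z < n" using un by (simp add: z_def)
  have st1: "static s1" by (rule static_same[OF sm1 _ st]) auto
  have V1: "words s1 UU 0 = u" "words s1 VV 0 = v" using U same_words[OF sm1] by simp_all
  define s2 where "s2 = sem w (half_add UU VV) s1"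
  note h2 = half_add[OF st1 bk1 A(1) un(1,2) V1(1) _ _ V1(2) _ _ B1(1), simplified, folded s2_def]
  have bJ': "b' u v \<le> J" "b' v u \<le> J" using bJ by (simp_all add: b')
  note h2 = h2[OF bJ'(1)]
  have st2: "static s2" by (rule static_same[OF h2(2) _ st1]) auto
  have V2: "words s2 UU 0 = u" "words s2 VV 0 = v" "words s2 ZZ 0 = z" "words s2 BKT (v * n + u) = b' v u"
    using V1 Z1 B1 same_words[OF h2(2)] by simp_all
  define s3 where "s3 = sem w (half_add VV UU) s2"
  note h3 = half_add[OF st2 h2(1) A(3) un(2,1) V2(2) _ _ V2(1) _ _ V2(4) bJ'(2), simplified, folded s3_def]
  have st3: "static s3" by (rule static_same[OF h3(2) _ st2]) auto
  have V3: "words s3 UU 0 = u" "words s3 VV 0 = v" "words s3 ZZ 0 = z" using V2 same_words[OF h3(2)] by simp_all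
  have sm13: "same {BKT, ZZ, PP, II, SIZE, ELT, POS, WT, AA, BB} s s3"
    by (rule same_mono[OF same_trans[OF sm1 same_trans[OF h2(2) h3(2)]]]) auto
  have ow3: "owned s3 E own" by (rule owned_same[OF sm13 _ ow]) auto
  have sk3: "stack s3 {}" by (rule stack_same[OF sm13 _ sk]) auto
  define own' where "own' = own({v, u} := z)"
  define s4 where "s4 = sem w (gain_owner ZZ) s3"
  have e': "{v, u} \<notin> E" "{v, u} \<in> edges_on n" using e by (simp_all add: insert_commute)
  note h4 = gain_owner[OF st3 ow3 e' V3(2,1,3) zn, simplified, folded s4_def own'_def]
  have sk4: "stack s4 {}" by (rule stack_same[OF h4(2) _ sk3]) auto
  have V4: "words s4 UU 0 = u" "words s4 VV 0 = v" using V3 same_words[OF h4(2)] by simp_all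
  define s5 where "s5 = sem w (push UU) s4"
  note h5 = push[OF sk4 V4(1) un(1), simplified, folded s5_def]
  have V5: "words s5 VV 0 = v" using V4 same_words[OF h5(2)] by simp
  define s6 where "s6 = sem w (push VV) s5"
  note h6 = push[OF h5(1) V5 un(2), simplified, folded s6_def]
  have fin: "sem w insert_edge s = s6"
    unfolding insert_edge_def sem.simps(4) place s2_def[symmetric]
      s3_def[symmetric] s4_def[symmetric] s5_def[symmetric] s6_def ..
  have sm46: "same {SP, FLAG, STK} s4 s6" using same_trans[OF h5(2) h6(2)] by simp
  have sm36: "same {3, 4, CNT, IX, OW, SP, FLAG, STK} s3 s6"
    by (rule same_mono[OF same_trans[OF h4(2) sm46]]) auto
  have ld: "load ?H2 b' x = load (arcs E) b x + (if x = u then T bu else 0) + (if x = v then T bv else 0)" for x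
    using load_insert[OF bucketsD(1)[OF bk] A(1), of b' x] load_insert[OF bucketsD(1)[OF h2(1)] A(3), of b' x]
      load_cong[of x "arcs E" b' b] b'E un(3) by (auto simp: b')
  have "inv s6 ?E b' lev own' {u, v}"
    unfolding inv_def
  proof (intro conjI allI impI)
    show "static s6" by (rule static_same[OF sm36 _ st3]) auto
    show "buckets s6 (arcs ?E) b'" unfolding H2 by (rule buckets_same[OF sm36 _ h3(1)]) auto
    show "owned s6 ?E own'"
      by (rule owned_same[OF sm46]) (use h4(1) in \<open>auto simp: insert_commute\<close>)
    show "stack s6 {u, v}" using h6(1) by (simp add: insert_commute)
    show "words s6 LEV x = lev x" if "x < n" for x
      using LV[OF that] same_words[OF sm36] same_words[OF sm13] by simp
    show "config ?E b' lev own'"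
      unfolding config_def
    proof (intro conjI allI impI)
      fix x y assume xy: "{x, y} \<in> ?E"
      show "edge_inv lev b' own' x y"
      proof (cases "{x, y} = {u, v}")
        case True
        have "edge_inv lev b' own' u v"
          using off[of bu] un
          by (auto simp: edge_inv_def b' bo[symmetric] own'_def insert_commute z_def bu_def bv_def)
        moreover have "x = u \<and> y = v \<or> x = v \<and> y = u" using True by (auto simp: doubleton_eq_iff)
        ultimately show ?thesis using edge_inv_sym by blast
      next
        case False
        then have xyE: "{x, y} \<in> E" "{y, x} \<noteq> {u, v}" using xy by (auto simp: insert_commute)
        show ?thesis
          by (rule edge_inv_cong[OF config_edge[OF cf xyE(1)]])
            (use False in \<open>simp_all add: b'(3)[OF False] b'(3)[OF xyE(2)] own'_def insert_commute\<close>)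
      qed
    qed (use E' cf in \<open>auto simp: config_def\<close>)
    show "\<not> heavy (arcs ?E) b' lev x" "\<not> light (arcs ?E) b' lev x" if "x < n" "x \<notin> {u, v}" for x
      using sb[OF that(1)] ld[of x] that by (auto simp: heavy_def light_def H2)
  qed
  moreover have "potential ?E b' lev {u, v} \<le> potential E b lev {} + real (step_time * (18 * J + 2))"
  proof -
    have "finite (arcs E)" by (rule finite_subset[OF bucketsD(1)[OF bk]]) simp
    then have "mass ?H2 b' = mass (arcs E) b' + (real J - real bu) + (real J - real bv)"
      using mass_insert[of ?H1 v u b'] mass_insert[of "arcs E" u v b'] A by (simp add: b')
    moreover have "mass (arcs E) b' = mass (arcs E) b" by (rule mass_cong) (rule b'E)
    moreover have "deficits ?H2 b' lev {..<n} \<le> deficits (arcs E) b lev {..<n}"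
      by (rule deficits_mono) (simp add: ld)
    moreover have "card {u, v} = 2" using un by simp
    ultimately have "9 * mass ?H2 b' + 16 * deficits ?H2 b' lev {..<n} - real (\<Sum>x<n. lev x) + real (card {u, v})
      \<le> 9 * mass (arcs E) b + 16 * deficits (arcs E) b lev {..<n} - real (\<Sum>x<n. lev x) + real (card ({} :: nat set)) + (18 * real J + 2)"
      by simp
    from mult_left_mono[OF this, of "real step_time"] show ?thesis
      unfolding potential_def H2 by (simp add: distrib_left)
  qed
  ultimately show ?thesis unfolding fin by blast
qed

lemma pass_edge:
  "same {2} s (pass_edge u v s)" "words (pass_edge u v s) 2 0 = u" "words (pass_edge u v s) 2 1 = v"
  by (auto simp: pass_edge_def same_def)

text \<open>In units of \<open>step_time\<close>, an insertion needs
  \<open>18 * J + 2 = 36 * L + 20\<close> for the potential, \<open>L + 2\<close> for the doubling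
  loop and 1 for the remaining blocks. A deletion needs 35, which the constant 36 covers
  too.\<close>

lemma update:
  assumes inv: "inv s E b lev own {}" and valid: "valid_update n E q"
  shows "\<exists>t s' b' lev' own'. process_update w vc_alg q s t s' \<and> inv s' (apply_update q E) b' lev' own' {} \<and>
    real t + potential (apply_update q E) b' lev' {} \<le> potential E b lev {} + real (step_time * (37 * L + 36))"
proof (cases q)
  case (Delete u v)
  let ?s = "pass_edge u v s"
  have i0: "inv ?s E b lev own {}" by (rule inv_same[OF inv pass_edge(1)]) auto
  have e: "{u, v} \<in> E" using valid Delete by simp
  note d = delete_edge[OF i0 e pass_edge(2,3)]
  obtain t0 where t0: "t0 \<le> max_time delete_edge" "exec w delete_edge ?s t0 (sem w delete_edge ?s)"
    using exec_sem[OF loopfree_blocks(8)] by blast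
  obtain t s' b' lev' own' where r: "exec w repair (sem w delete_edge ?s) t s'" "inv s' (E - {{u, v}}) b' lev' own' {}"
    "real t + potential (E - {{u, v}}) b' lev' {} \<le> potential (E - {{u, v}}) b lev {u, v} + 10"
    using repair[OF d[THEN conjunct1]] by blast
  have "exec w (deletion vc_alg) ?s (t0 + t) s'"
    unfolding vc_alg_def by (simp add: exec.Seq[OF t0(2) r(1)])
  moreover have "real (t0 + t) + potential (E - {{u, v}}) b' lev' {} \<le> potential E b lev {} + real (step_time * (37 * L + 36))"
  proof -
    have "t0 + 10 \<le> step_time" using t0(1) by (simp add: step_time_def)
    moreover have "step_time * 35 \<le> step_time * (37 * L + 36)" by (intro mult_left_mono) auto
    ultimately have "t0 + 10 + 34 * step_time \<le> step_time * (37 * L + 36)" by linarith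
    then have "real t0 + 10 + real (34 * step_time) \<le> real (step_time * (37 * L + 36))" by linarith
    then show ?thesis using r(3) d[THEN conjunct2] by simp
  qed
  ultimately show ?thesis using r(2) unfolding Delete by (auto intro!: exI)
next
  case (Insert u v)
  let ?s = "pass_edge u v s"
  have i0: "inv ?s E b lev own {}" by (rule inv_same[OF inv pass_edge(1)]) auto
  have e: "{u, v} \<in> edges_on n" "{u, v} \<notin> E" using valid Insert by auto
  have un: "u < n" "v < n" using edge_ends[of "edges_on n"] e by auto
  have st0: "static ?s" using i0 by (simp add: inv_def)
  define s1 where "s1 = sem w sort_ends ?s"
  obtain x y where xy: "{x, y} = {u, v}" "c x \<le> c y" "words s1 UU 0 = x" "words s1 VV 0 = y"
    "words s1 SS 0 = 0" "reals s1 1 0 = c x" "same {UU, VV, SS} ?s s1"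
    using sort_ends[OF st0 un pass_edge(2,3)] unfolding s1_def by blast
  have xn: "x < n" "y < n" using xy(1) un by (auto simp: doubleton_eq_iff)
  have i1: "inv s1 E b lev own {}" by (rule inv_same[OF i0 xy(7)]) auto
  have st1: "static s1" using i1 by (simp add: inv_def)
  obtain t0 where t0: "t0 \<le> max_time sort_ends" "exec w sort_ends ?s t0 s1"
    using exec_sem[OF loopfree_blocks(5)] unfolding s1_def by blast
  obtain t1 s2 i where l: "exec w (While offset_test offset_body) s1 t1 s2" "same {SS} s1 s2" "words s2 SS 0 = i"
    "\<And>j. offset x y j (j + i)" "t1 \<le> step_time * (L + 2)"
    using offset_loop[OF st1 xy(3,4) xn xy(2,5,6)] by blast
  have i2: "inv s2 E b lev own {}" by (rule inv_same[OF i1 l(2)]) auto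
  have V2: "words s2 UU 0 = x" "words s2 VV 0 = y" using xy same_words[OF l(2)] by simp_all
  have e': "{x, y} \<notin> E" "{x, y} \<in> edges_on n" using e xy(1) by simp_all
  obtain b1 own1 where d: "inv (sem w insert_edge s2) (insert {x, y} E) b1 lev own1 {x, y}"
    "potential (insert {x, y} E) b1 lev {x, y} \<le> potential E b lev {} + real (step_time * (18 * J + 2))"
    using insert_edge[OF i2 e' V2 l(3,4)] by blast
  obtain t2 where t2: "t2 \<le> max_time insert_edge" "exec w insert_edge s2 t2 (sem w insert_edge s2)"
    using exec_sem[OF loopfree_blocks(7)] by blast
  obtain t s' b' lev' own' where r: "exec w repair (sem w insert_edge s2) t s'" "inv s' (insert {x, y} E) b' lev' own' {}"
    "real t + potential (insert {x, y} E) b' lev' {} \<le> potential (insert {x, y} E) b1 lev {x, y} + 10"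
    using repair[OF d(1)] by blast
  have E': "insert {x, y} E = apply_update q E" unfolding Insert xy(1) by simp
  have "exec w (insertion vc_alg) ?s (t0 + (t1 + (t2 + t))) s'"
    unfolding vc_alg_def by (simp add: exec.Seq[OF t0(2) exec.Seq[OF l(1) exec.Seq[OF t2(2) r(1)]]])
  moreover have "real (t0 + (t1 + (t2 + t))) + potential (insert {x, y} E) b' lev' {} \<le> potential E b lev {} + real (step_time * (37 * L + 36))"
  proof -
    have "t0 + t2 + 10 \<le> step_time" using t0(1) t2(1) by (simp add: step_time_def)
    moreover have "step_time * (18 * J + 2) + step_time * (L + 2) + step_time \<le> step_time * (37 * L + 36)"
      by (simp add: J_def algebra_simps)
    ultimately have "t0 + t1 + t2 + 10 + step_time * (18 * J + 2) \<le> step_time * (37 * L + 36)"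
      using l(5) by linarith
    then have "real t0 + real t1 + real t2 + 10 + real (step_time * (18 * J + 2)) \<le> real (step_time * (37 * L + 36))"
      by linarith
    then show ?thesis using r(3) d(2) by simp
  qed
  ultimately show ?thesis using r(2) unfolding E' unfolding Insert by (auto intro!: exI)
qed

lemma updates:
  "inv s E b lev own {} \<Longrightarrow> valid_updates n E qs \<Longrightarrow>
   \<exists>t s' b' lev' own'. process_updates w vc_alg qs s t s' \<and> inv s' (fold apply_update qs E) b' lev' own' {} \<and>
    real t + potential (fold apply_update qs E) b' lev' {} \<le>
      potential E b lev {} + real (step_time * (37 * L + 36)) * real (length qs) \<and>
    card (fold apply_update qs E) \<le> card E + length qs"
proof (induction qs arbitrary: s E b lev own)
  case Nil
  then show ?case by (intro exI[of _ 0] exI[of _ s]) (auto intro: process_updates.Nil)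
next
  case (Cons q qs)
  have v: "valid_update n E q" "valid_updates n (apply_update q E) qs" using Cons.prems by simp_all
  obtain t s' b' lev' own' where 1: "process_update w vc_alg q s t s'" "inv s' (apply_update q E) b' lev' own' {}"
    "real t + potential (apply_update q E) b' lev' {} \<le> potential E b lev {} + real (step_time * (37 * L + 36))"
    using update[OF Cons.prems(1) v(1)] by blast
  obtain t2 s2 b2 lev2 own2 where 2: "process_updates w vc_alg qs s' t2 s2"
    "inv s2 (fold apply_update qs (apply_update q E)) b2 lev2 own2 {}"
    "real t2 + potential (fold apply_update qs (apply_update q E)) b2 lev2 {} \<le>
      potential (apply_update q E) b' lev' {} + real (step_time * (37 * L + 36)) * real (length qs)"
    "card (fold apply_update qs (apply_update q E)) \<le> card (apply_update q E) + length qs"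
    using Cons.IH[OF 1(2) v(2)] by blast
  have "finite E" using Cons.prems(1) card_edges_le(1) by (auto simp: inv_def config_def)
  then have "card (apply_update q E) \<le> card E + 1"
    by (cases q) (auto simp: card_insert_if card_Diff_singleton_if)
  then show ?case
    using process_updates.Cons[OF 1(1) 2(1)] 2 1(3)
    by (intro exI[of _ "t + t2"] exI[of _ s2] exI[of _ b2] exI[of _ lev2] exI[of _ own2])
      (simp add: algebra_simps)
qed

text \<open>A vertex on a positive level that is not light has a nonzero load, hence an edge, and
  every edge has two ends. A bound by \<open>n * L\<close> would not do: it would burden short
  update sequences with an additive term.\<close>

lemma lev_sum_bound:
  assumes inv: "inv s E b lev own {}" shows "(\<Sum>x<n. lev x) \<le> 2 * L * card E"
proof -
  have cf: "config E b lev own" and sb: "\<And>x. x < n \<Longrightarrow> \<not> light (arcs E) b lev x"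
    using inv by (auto simp: inv_def)
  have E: "E \<subseteq> edges_on n" using cf by (simp add: config_def)
  have fin: "finite E" by (rule card_edges_le(1)[OF E])
  have *: "x \<in> \<Union>E" if "x < n" "0 < lev x" for x
  proof -
    have "load (arcs E) b x \<noteq> 0" using sb[OF that(1)] that(2) by (cases "load (arcs E) b x = 0") (auto simp: light_def)
    then have "arcs E `` {x} \<noteq> {}" by (auto simp: load_def)
    then show ?thesis by auto
  qed
  have c2: "finite e \<and> card e = 2" if "e \<in> E" for e using that E by (auto simp: edges_on_def)
  have finU: "finite (\<Union>E)" using fin c2 by auto
  have "(\<Sum>x<n. lev x) \<le> (\<Sum>x<n. if x \<in> \<Union>E then L else 0)"
  proof (rule sum_mono)
    fix x assume "x \<in> {..<n}"
    then have x: "x < n" "lev x \<le> L" using cf by (simp_all add: config_def)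
    show "lev x \<le> (if x \<in> \<Union>E then L else 0)"
      using *[OF x(1)] x(2) by (cases "0 < lev x") simp_all
  qed
  also have "\<dots> = (\<Sum>x\<in>{..<n} \<inter> \<Union>E. L)" by (rule sum.inter_restrict[symmetric], simp)
  also have "\<dots> \<le> (\<Sum>x\<in>\<Union>E. L)" using finU by (intro sum_mono2) auto
  also have "\<dots> = card (\<Union>E) * L" by simp
  also have "card (\<Union>E) \<le> (\<Sum>e\<in>E. card e)" by (rule card_Union_le_sum_card)
  also have "(\<Sum>e\<in>E. card e) = card E * 2" using c2 by simp
  finally show ?thesis by (simp add: algebra_simps)
qed

lemma process_all:
  assumes inv: "inv s {} b (\<lambda>_. 0) own {}" and valid: "valid_updates n {} qs"
  shows "\<exists>t s'. process_updates w vc_alg qs s t s' \<and>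
    t \<le> step_time * (39 * L + 36) * length qs \<and> holds_approx_cover 36 n c k (graph_after qs) s'"
proof -
  obtain t s' b' lev' own' where 1: "process_updates w vc_alg qs s t s'"
    "inv s' (graph_after qs) b' lev' own' {}"
    "real t + potential (graph_after qs) b' lev' {} \<le>
      potential {} b (\<lambda>_. 0) {} + real (step_time * (37 * L + 36)) * real (length qs)"
    "card (graph_after qs) \<le> length qs"
    using updates[OF inv valid] by (auto simp: graph_after_def)
  let ?E = "graph_after qs"
  have p0: "potential {} b (\<lambda>_. 0) {} = 0"
    by (simp add: potential_def mass_def arcs_def deficits_def deficit_def)
  have bk: "buckets s' (arcs ?E) b'" and cf: "config ?E b' lev' own'" and ow: "owned s' ?E own'"
    and sb: "\<And>x. x < n \<Longrightarrow> stable (arcs ?E) b' lev' x"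
    using 1(2) by (auto simp: inv_def)
  \<comment> \<open>Starting from the empty graph there are at most as many edges as updates, so the
    negative term of the potential costs another \<open>2 * L\<close> per update:
    \<open>37 + 2 = 39\<close>.\<close>
  have "(\<Sum>x<n. lev' x) \<le> 2 * L * length qs"
    using lev_sum_bound[OF 1(2)] mult_left_mono[OF 1(4), of "2 * L"] by linarith
  then have "real (\<Sum>x<n. lev' x) \<le> real (2 * L * length qs)" by (simp only: of_nat_le_iff)
  then have "- real (2 * L * length qs) \<le> 9 * mass (arcs ?E) b' + 16 * deficits (arcs ?E) b' lev' {..<n} -
     real (\<Sum>x<n. lev' x) + real (card ({} :: nat set))"
    using mass_nonneg[OF bk] deficits_nonneg[of "arcs ?E" b' lev' "{..<n}"] by simp
  from mult_left_mono[OF this, of "real step_time"]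
  have "- real (step_time * (2 * L * length qs)) \<le> potential ?E b' lev' {}" by (simp add: potential_def)
  then have "real t \<le> real (step_time * (37 * L + 36)) * real (length qs) + real (step_time * (2 * L * length qs))"
    using 1(3) p0 by linarith
  also have "\<dots> = real (step_time * (39 * L + 36) * length qs)" by (simp add: algebra_simps)
  finally have t: "t \<le> step_time * (39 * L + 36) * length qs" by (simp only: of_nat_le_iff)
  have a: "output_assignment n s' e = own' e" if "e \<in> ?E" for e
    using ow that by (simp add: output_assignment_def owned_def)
  have eq: "{e \<in> ?E. output_assignment n s' e = v} = {e \<in> ?E. own' e = v}" for v using a by auto
  have x: "output_copies s' v = copies v (card {e \<in> ?E. output_assignment n s' e = v})" if "v < n" for v
    using ow that by (simp add: output_copies_def owned_def eq)
  note ap = constant_ratio[OF cf sb x a]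
  \<comment> \<open>The cost being nonnegative, so is the minimum, and the ratio 35 may be weakened
    to the announced 36.\<close>
  have "0 \<le> cover_cost n c (output_copies s')"
    unfolding cover_cost_def using c_pos by (intro sum_nonneg mult_nonneg_nonneg) (auto simp: less_imp_le)
  with ap have "holds_approx_cover 36 n c k ?E s'" by (simp add: holds_approx_cover_def)
  with 1(1) t show ?thesis by blast
qed

subsection \<open>Preprocessing\<close>

lemma preprocess:
  "\<exists>t s. exec w (preprocess vc_alg) (input_memory n c k) t s \<and> t \<le> 100 * (n + 1) \<and>
     inv s {} (\<lambda>_ _. 0) (\<lambda>_. 0) (\<lambda>_. 0) {}"
proof -
  define s0 where "s0 = input_memory n c k"
  define s1 where "s1 = set_word FULL 0 1 s0"
  let ?I = "\<lambda>j s. same {FULL, LOGN} s1 s \<and> words s FULL = (\<lambda>_. 0)(0 := 2 ^ j) \<and> words s LOGN = (\<lambda>_. 0)(0 := j) \<and> j \<le> L"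
  let ?c = "WLess (var FULL) (var 0)"
  let ?p = "setv FULL (WMul (WLit 2) (var FULL)) ;; setv LOGN (WAdd (var LOGN) (WLit 1))"
  let ?\<Phi> = "\<lambda>j. 30 * (real L - real j)"
  have Lw: "2 ^ L < (2 :: nat) ^ w"
  proof -
    have "n \<le> n ^ 2" by (simp add: power2_eq_square)
    then show ?thesis using L_upper poly_bounds(2) by linarith
  qed
  have guard: "bval w s ?c \<longleftrightarrow> 2 ^ j < n" if "?I j s" for j s
  proof -
    have "words s 0 = words s1 0" using that by (auto simp: same_def)
    then show ?thesis using that by (simp add: s1_def s0_def input_memory_def)
  qed
  have "\<exists>t s' g'. exec w (While ?c ?p) s1 t s' \<and> ?I g' s' \<and> \<not> bval w s' ?c \<and> real t + ?\<Phi> g' \<le> ?\<Phi> 0 + real (1 + btime ?c)"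
  proof (rule exec_While_sem[where I = ?I and \<Phi> = ?\<Phi> and K = 30])
    show "?I 0 s1" by (auto simp: s1_def s0_def input_memory_def same_def fun_eq_iff)
    show "0 \<le> ?\<Phi> j" if "?I j s" for j s using that by simp
  next
    fix j s assume I: "?I j s" and c: "bval w s ?c"
    have j: "j < L"
    proof (rule ccontr)
      assume "\<not> j < L"
      then have "n \<le> 2 ^ j" using I L_lower by simp
      then show False using guard[OF I] c by simp
    qed
    have "(2::nat) ^ Suc j \<le> 2 ^ L" using j by (intro power_increasing) auto
    from le_less_trans[OF this Lw] have b: "2 * 2 ^ j < (2::nat) ^ w" by simp
    have "Suc j \<le> J" using j by (simp add: J_def)
    then have b2: "Suc j < 2 ^ w" using J_bound by linarith
    have "?I (Suc j) (sem w ?p s)"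
      using I j b b2 small_lits(1,2) by (auto simp: same_def fun_eq_iff)
    moreover have "real 30 + ?\<Phi> (Suc j) \<le> ?\<Phi> j" by simp
    ultimately show "\<exists>g'. ?I g' (sem w ?p s) \<and> real 30 + ?\<Phi> g' \<le> ?\<Phi> j" by blast
  qed simp_all
  then obtain t1 s2 j where l1: "exec w (While ?c ?p) s1 t1 s2" "?I j s2" "\<not> bval w s2 ?c"
    "real t1 + ?\<Phi> j \<le> ?\<Phi> 0 + real (1 + btime ?c)" by blast
  \<comment> \<open>Stopping at a smaller \<open>j\<close> would mean \<open>n \<le> 2 ^ j\<close>,
    and \<open>2 ^ L\<close> would be at least \<open>2 * n\<close>.\<close>
  have j: "j = L"
  proof (rule ccontr)
    assume "j \<noteq> L"
    then have "(2::nat) ^ Suc j \<le> 2 ^ L" using l1(2) by (intro power_increasing) auto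
    then show False using guard[OF l1(2)] l1(3) L_upper by simp
  qed
  define s3 where "s3 = set_word QQ 0 (2 ^ L) s2"
  let ?I' = "\<lambda>j s. same {QQ, PP, TAB} s3 s \<and> words s QQ 0 = T j \<and> words s PP 0 = j \<and>
     words s TAB = (\<lambda>i. if i < j then T i else 0) \<and> j \<le> L + 1"
  let ?c' = "WLess (WLit 0) (var QQ)"
  let ?p' = "WSet TAB (var PP) (var QQ) ;; setv QQ (WDiv (var QQ) (WLit 2)) ;; setv PP (WAdd (var PP) (WLit 1))"
  let ?\<Phi>' = "\<lambda>j. 30 * (real (L + 1) - real j)"
  have w2: "words s2 i = words s1 i" if "i \<noteq> FULL" "i \<noteq> LOGN" for i using l1(2) that by (simp add: same_def)
  have "\<exists>t s' g'. exec w (While ?c' ?p') s3 t s' \<and> ?I' g' s' \<and> \<not> bval w s' ?c' \<and> real t + ?\<Phi>' g' \<le> ?\<Phi>' 0 + real (1 + btime ?c')"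
  proof (rule exec_While_sem[where I = ?I' and \<Phi> = ?\<Phi>' and K = 30])
    show "?I' 0 s3" using w2 by (auto simp: s3_def s1_def s0_def input_memory_def same_def fun_eq_iff T_0)
    show "0 \<le> ?\<Phi>' j" if "?I' j s" for j s using that by simp
  next
    fix j s assume I: "?I' j s" and c: "bval w s ?c'"
    have j: "j \<le> L" using I c T_gt[of j] by (cases "j \<le> L") auto
    have "Suc j \<le> J" using j by (simp add: J_def)
    then have b2: "Suc j < 2 ^ w" using J_bound by linarith
    have "?I' (Suc j) (sem w ?p' s)"
      using I j b2 small_lits(1,2) by (auto simp: same_def fun_eq_iff T_Suc less_Suc_eq)
    moreover have "real 30 + ?\<Phi>' (Suc j) \<le> ?\<Phi>' j" by simp
    ultimately show "\<exists>g'. ?I' g' (sem w ?p' s) \<and> real 30 + ?\<Phi>' g' \<le> ?\<Phi>' j" by blast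
  qed simp_all
  then obtain t2 s4 j' where l2: "exec w (While ?c' ?p') s3 t2 s4" "?I' j' s4" "\<not> bval w s4 ?c'"
    "real t2 + ?\<Phi>' j' \<le> ?\<Phi>' 0 + real (1 + btime ?c')" by blast
  have j': "j' = L + 1"
  proof (rule ccontr)
    assume "j' \<noteq> L + 1"
    then have "0 < T j'" using l2(2) by (simp add: T_le)
    then show False using l2(2,3) by simp
  qed
  \<comment> \<open>Entries beyond \<open>L\<close> are never written; the initial 0 is already the
    right value.\<close>
  have tab: "words s4 TAB i = T i" for i using l2(2) by (simp add: j' T_gt)
  have w4: "words s4 i = (if i = 0 then (\<lambda>j. if j = 0 then n else 0) else if i = 1 then (\<lambda>j. if j < n then k j else 0)
      else (\<lambda>_. 0))" if "i \<notin> {FULL, LOGN, QQ, PP, TAB}" for i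
  proof -
    have "words s4 i = words s1 i" using l2(2) w2[of i] that by (auto simp: same_def s3_def)
    then show ?thesis using that by (auto simp: s1_def s0_def input_memory_def fun_eq_iff)
  qed
  have r4: "reals s4 0 = reals s1 0" using l1(2) l2(2) by (simp add: same_def s3_def)
  have "words s4 FULL 0 = 2 ^ L" "words s4 LOGN 0 = L"
    using l2(2) l1(2) j by (auto simp: same_def s3_def)
  then have st: "static s4"
    by (simp add: static_def w4 tab r4) (simp add: s1_def s0_def input_memory_def)
  have "inv s4 {} (\<lambda>_ _. 0) (\<lambda>_. 0) (\<lambda>_. 0) {}"
    unfolding inv_def
  proof (intro conjI allI impI)
    show "buckets s4 (arcs {}) (\<lambda>_ _. 0)"
      by (auto simp: buckets_def arcs_def slots_def w4 load_def)
    show "owned s4 {} (\<lambda>_. 0)" by (auto simp: owned_def w4 copies_def)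
    show "stack s4 {}" by (auto simp: stack_def w4 bij_betw_def)
    show "config {} (\<lambda>_ _. 0) (\<lambda>_. 0) (\<lambda>_. 0)"
      using k_pos by (auto simp: config_def Suc_le_eq)
  qed (use st in \<open>simp_all add: w4 heavy_def light_def load_def arcs_def\<close>)
  moreover have "exec w (preprocess vc_alg) s0
      (1 + btime (WEq (var 0) (WLit 0)) + (1 + 1 + 1 + (t1 + (1 + 1 + 2 + t2)))) s4"
  proof -
    have e1: "exec w (setv FULL (WLit 1)) s0 (1 + 1 + 1) s1"
      using exec.WSet[of w FULL "WLit 0" "WLit 1" s0] small_lits(1) by (simp add: s1_def)
    have "words s2 FULL 0 = 2 ^ L" using l1(2) j by simp
    then have e3: "exec w (setv QQ (var FULL)) s2 (1 + 1 + 2) s3"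
      using exec.WSet[of w QQ "WLit 0" "var FULL" s2] by (simp add: s3_def)
    have g: "\<not> bval w s0 (WEq (var 0) (WLit 0))" using n_pos by (simp add: s0_def input_memory_def)
    show ?thesis
      unfolding vc_alg_def init_loop_def table_loop_def dyn_alg.simps
      by (rule exec.CondFalse[OF g exec.Seq[OF e1 exec.Seq[OF l1(1) exec.Seq[OF e3 l2(1)]]]])
  qed
  moreover have "1 + btime (WEq (var 0) (WLit 0)) + (1 + 1 + 1 + (t1 + (1 + 1 + 2 + t2))) \<le> 100 * (n + 1)"
  proof -
    have "real t1 \<le> real (30 * L + 6)" "real t2 \<le> real (30 * L + 35)"
      using l1(4) l2(4) by (simp_all add: j j')
    then have "t1 \<le> 30 * L + 6" "t2 \<le> 30 * L + 35" by linarith+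
    then show ?thesis using L_le by simp
  qed
  ultimately show ?thesis unfolding s0_def by blast
qed

end

section \<open>Degenerate vertex sets and the final constants\<close>

lemma ex_log_ceiling:
  fixes n :: nat
  assumes "0 < n" shows "\<exists>L. n \<le> 2 ^ L \<and> 2 ^ L < 2 * n"
proof -
  define L where "L = (LEAST m. n \<le> 2 ^ m)"
  have "n \<le> 2 ^ n" by (simp add: less_imp_le)
  then have "n \<le> 2 ^ L" unfolding L_def by (rule LeastI)
  moreover have "2 ^ L < 2 * n"
  proof (cases L)
    case (Suc m)
    then have "\<not> n \<le> 2 ^ m" using not_less_Least[of m "\<lambda>m. n \<le> 2 ^ m"] by (simp add: L_def)
    then show ?thesis using Suc by simp
  qed (use assms in simp)
  ultimately show ?thesis by blast
qed

lemma no_edges: "n < 2 \<Longrightarrow> edges_on n = {}"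
  by (auto simp: edges_on_def)

text \<open>With fewer than two vertices the logarithm in the time bound is 0 (for
  \<open>n = 0\<close> by convention), so no time at all may be spent on updates; luckily none is
  possible.\<close>

lemma valid_updates_no_edges: "valid_updates n {} qs \<Longrightarrow> n < 2 \<Longrightarrow> qs = []"
proof (cases qs)
  case (Cons q qs')
  then show "valid_updates n {} qs \<Longrightarrow> n < 2 \<Longrightarrow> qs = []"
    by (cases q) (auto simp: no_edges)
qed simp

text \<open>The locale requires a positive \<open>n\<close>, so the empty vertex set is treated
  apart; the 6 steps are the test for it and \<open>Skip\<close>.\<close>

lemma vc_alg_no_vertices:
  assumes "0 \<le> T" "6 \<le> P" shows "maintains_cover w vc_alg 36 P T 0 c k"
proof -
  let ?s = "input_memory 0 c k"
  have "exec w (preprocess vc_alg) ?s (1 + btime (WEq (var 0) (WLit 0)) + 1) ?s"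
    unfolding vc_alg_def dyn_alg.simps
    by (rule exec.CondTrue[OF _ exec.Skip]) (simp add: input_memory_def)
  moreover have "1 + btime (WEq (var 0) (WLit 0)) + 1 = 6" by simp
  ultimately have pre: "exec w (preprocess vc_alg) ?s 6 ?s" by (simp only:)
  have run: "process_updates w vc_alg qs ?s 0 ?s \<and> holds_approx_cover 36 0 c k (graph_after qs) ?s"
    if "valid_updates 0 {} qs" for qs
  proof -
    have "qs = []" using valid_updates_no_edges[OF that] by simp
    moreover have "{cover_cost 0 c x |x a. cap_vertex_cover 0 k {} x a} = {0}"
      by (auto simp: cover_cost_def cap_vertex_cover_def)
    ultimately show ?thesis
      by (auto simp: holds_approx_cover_def cap_vertex_cover_def min_cover_cost_def cover_cost_def graph_after_def
          intro: process_updates.Nil)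
  qed
  have "\<exists>t s. process_updates w vc_alg qs ?s t s \<and> real t \<le> T * real (length qs) \<and>
      holds_approx_cover 36 0 c k (graph_after qs) s" if "valid_updates 0 {} qs" for qs
    using run[OF that] assms(1) by (intro exI[of _ 0] exI[of _ ?s]) simp
  with pre assms(2) show ?thesis
    unfolding maintains_cover_def by (intro exI[of _ 6] exI[of _ ?s]) simp
qed

theorem theorem1:
  "\<exists>(\<rho> :: real) (C :: real) (d :: nat). \<bar>\<rho> - 36\<bar> \<le> 1 / 2 \<and>
     (\<forall>\<epsilon> :: real. 0 < \<epsilon> \<and> \<epsilon> < 1 \<longrightarrow>
        (\<exists>A :: dyn_alg. \<forall>(n :: nat) (c :: nat \<Rightarrow> real) (k :: nat \<Rightarrow> nat) (w :: nat).
           (\<forall>v<n. c v > 0) \<and> (\<forall>v<n. k v > 0) \<and>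
           (n + 1) ^ d \<le> 2 ^ w \<and> (\<forall>v<n. k v < 2 ^ w) \<longrightarrow>
           maintains_cover w A \<rho> (C * real (n + 1)) (C * (log 2 (real n) / \<epsilon>)) n c k))"
proof -
  \<comment> \<open>100 is for preprocessing, 114 for the updates. \<open>step_time\<close> is read
    off the program text, so \<open>C\<close> depends neither on the instance nor on
    \<open>\<epsilon>\<close>.\<close>
  define C :: real where "C = 100 + 114 * real step_time"
  have main: "maintains_cover w vc_alg 36 (C * real (n + 1)) (C * (log 2 (real n) / \<epsilon>)) n c k"
    if \<epsilon>: "0 < \<epsilon>" "\<epsilon> < 1" and c: "\<forall>v<n. c v > 0" and k: "\<forall>v<n. k v > 0"
      and w: "(n + 1) ^ 6 \<le> 2 ^ w" "\<forall>v<n. k v < 2 ^ w"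
    for \<epsilon> :: real and n w :: nat and c :: "nat \<Rightarrow> real" and k :: "nat \<Rightarrow> nat"
  proof (cases "n = 0")
    case True
    then show ?thesis
      by (auto simp: C_def log_def intro!: vc_alg_no_vertices)
  next
    case False
    then obtain L where L: "n \<le> 2 ^ L" "2 ^ L < 2 * n" using ex_log_ceiling by blast
    interpret vc_instance n w L c k
      by unfold_locales (use False w c k L in auto)
    obtain t0 s0 where pre: "exec w (preprocess vc_alg) (input_memory n c k) t0 s0" "t0 \<le> 100 * (n + 1)"
      "inv s0 {} (\<lambda>_ _. 0) (\<lambda>_. 0) (\<lambda>_. 0) {}"
      using preprocess by blast
    have "real t0 \<le> real (100 * (n + 1))" using pre(2) by (simp only: of_nat_le_iff)
    also have "\<dots> \<le> C * real (n + 1)" unfolding C_def of_nat_mult by (intro mult_right_mono) auto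
    finally have t0: "real t0 \<le> C * real (n + 1)" .
    have time: "real (step_time * (39 * L + 36) * length qs) \<le> C * (log 2 (real n) / \<epsilon>) * real (length qs)"
      if "valid_updates n {} qs" for qs
    proof (cases "qs = []")
      case False
      then have n2: "2 \<le> n" using valid_updates_no_edges[OF that] by linarith
      then have l1: "1 \<le> log 2 (real n)" by (simp add: le_log_iff)
      have "real (2 ^ L) \<le> real (2 * n)" using L(2) by (simp only: of_nat_le_iff less_imp_le)
      then have "log 2 (2 ^ L) \<le> log 2 (2 * real n)" using n2 by (subst log_le_cancel_iff) auto
      then have "real L \<le> 1 + log 2 (real n)" using n2 by (simp add: log_mult log_nat_power)
      \<comment> \<open>With \<open>l\<close> for the logarithm,
        \<open>39 * (1 + l) + 36 = 39 * l + 75\<close>, and \<open>l \<ge> 1\<close> absorbs the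
        75.\<close>
      then have "39 * real L + 36 \<le> 114 * log 2 (real n)" using l1 by linarith
      then have "real step_time * (39 * real L + 36) \<le> real step_time * (114 * log 2 (real n))"
        by (intro mult_left_mono) auto
      also have "\<dots> \<le> C * log 2 (real n)" using l1 by (simp add: C_def algebra_simps)
      also have "\<dots> \<le> C * (log 2 (real n) / \<epsilon>)"
      proof (rule mult_left_mono)
        have "log 2 (real n) * \<epsilon> \<le> log 2 (real n) * 1" using \<epsilon> l1 by (intro mult_left_mono) auto
        then show "log 2 (real n) \<le> log 2 (real n) / \<epsilon>" using \<epsilon> by (simp add: field_simps)
      qed (simp add: C_def)
      finally have "real step_time * (39 * real L + 36) * real (length qs) \<le>
        C * (log 2 (real n) / \<epsilon>) * real (length qs)" by (intro mult_right_mono) auto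
      then show ?thesis by simp
    qed simp
    show ?thesis
      unfolding maintains_cover_def
    proof (rule exI[of _ t0], rule exI[of _ s0], intro conjI allI impI)
      show "exec w (preprocess vc_alg) (input_memory n c k) t0 s0" by fact
      show "real t0 \<le> C * real (n + 1)" by fact
      fix qs assume v: "valid_updates n {} qs"
      obtain t s where "process_updates w vc_alg qs s0 t s" "t \<le> step_time * (39 * L + 36) * length qs"
        "holds_approx_cover 36 n c k (graph_after qs) s"
        using process_all[OF pre(3) v] by blast
      moreover from this(2) have "real t \<le> real (step_time * (39 * L + 36) * length qs)"
        by (simp only: of_nat_le_iff)
      ultimately show "\<exists>t s. process_updates w vc_alg qs s0 t s \<and>
          real t \<le> C * (log 2 (real n) / \<epsilon>) * real (length qs) \<and>
          holds_approx_cover 36 n c k (graph_after qs) s"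
        using time[OF v] order_trans by blast
    qed
  qed
  show ?thesis
    by (rule exI[of _ 36], rule exI[of _ C], rule exI[of _ 6])
      (use main in \<open>auto intro!: exI[of _ vc_alg]\<close>)
qed

end
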